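(* Let $K$ be a finite CAT(0) square $2$-complex having a $2$-cell $\sigma$ with a free $1$-dimensional face $e$, and let $K' = K\setminus\{e,\sigma\}$ be the subcomplex obtained by the corresponding elementary collapse. Then every point of $|K'|$ has a neighborhood in $|K'|$ that is a CAT(0) space (i.e. $|K'|$, with its induced length metric, is non-positively curved).
   Context: A cubical complex is a complex obtained from a disjoint union of unit Euclidean cubes $[0,1]^{n_\lambda}$ by gluing faces by isometries, such that each cube injects into the complex and the intersection of any two cells is empty or a single face. A square ($2$-)complex is a $2$-dimensional cubical complex. Its underlying space $|K|$ carries the length metric in which every cell is isometric to a unit cube; $K$ is CAT(0) if $|K|$ with this metric is a CAT(0) space. The space $|K'|$ carries the induced length metric (infimum of lengths of paths contained in $|K'|$). A $1$-dimensional face $e$ of a $2$-cell $\sigma$ is free if it is not a face of any other cell of $K$. $K\setminus\{e,\sigma\}$ is the subcomplex obtained by removing the open cells $e$ and $\sigma$. A metric space is non-positively curved if every point has a ball around it which, with the induced metric, is a CAT(0) space. *)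

theory Defs
  imports "HOL-Analysis.Analysis"
begin

section \<open>Unit Euclidean cubes\<close>

text \<open>Points of Euclidean n-space are functions on the naturals vanishing from n on, as in
  \<open>Euclidean_space\<close>.\<close>

definition unit_cube :: "nat \<Rightarrow> (nat \<Rightarrow> real) set" where
  "unit_cube n = {x. (\<forall>k<n. 0 \<le> x k \<and> x k \<le> 1) \<and> (\<forall>k\<ge>n. x k = 0)}"

definition edist :: "nat \<Rightarrow> (nat \<Rightarrow> real) \<Rightarrow> (nat \<Rightarrow> real) \<Rightarrow> real" where
  "edist n x y = L2_set (\<lambda>k. x k - y k) {..<n}"

text \<open>A face is cut out by setting the coordinates in \<open>A\<close> to 0 and those in \<open>B\<close> to 1;
  \<open>m\<close> is its dimension. The whole cube is a face of itself, the empty set is not a face.\<close>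

definition cube_face :: "nat \<Rightarrow> nat \<Rightarrow> (nat \<Rightarrow> real) set \<Rightarrow> bool" where
  "cube_face n m F \<longleftrightarrow> (\<exists>A B. A \<subseteq> {..<n} \<and> B \<subseteq> {..<n} \<and> A \<inter> B = {} \<and> m + card (A \<union> B) = n \<and>
     F = {x \<in> unit_cube n. (\<forall>k\<in>A. x k = 0) \<and> (\<forall>k\<in>B. x k = 1)})"


section \<open>Cubical complexes\<close>

text \<open>The quotient of a disjoint union of cubes is presented by the restrictions of the quotient map
  to the individual cubes: \<open>chart K i\<close> maps the cube with index \<open>i\<close> to the set of points of the
  complex. Values of \<open>chart K i\<close> outside the cube are irrelevant.\<close>

record ('i, 'a) cube_gluing =
  cubes :: "'i set"
  cube_dim :: "'i \<Rightarrow> nat"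
  chart :: "'i \<Rightarrow> (nat \<Rightarrow> real) \<Rightarrow> 'a"

definition cube_of :: "('i, 'a) cube_gluing \<Rightarrow> 'i \<Rightarrow> (nat \<Rightarrow> real) set" where
  "cube_of K i = unit_cube (cube_dim K i)"

definition realization :: "('i, 'a) cube_gluing \<Rightarrow> 'a set" where
  "realization K = (\<Union>i\<in>cubes K. chart K i ` cube_of K i)"

text \<open>Each cube injects, and two cubes whose images meet are glued exactly along one face of each,
  by an isometry between these faces.\<close>

definition cubical_complex :: "('i, 'a) cube_gluing \<Rightarrow> bool" where
  "cubical_complex K \<longleftrightarrow>
     (\<forall>i\<in>cubes K. inj_on (chart K i) (cube_of K i)) \<and>
     (\<forall>i\<in>cubes K. \<forall>j\<in>cubes K.
        chart K i ` cube_of K i \<inter> chart K j ` cube_of K j \<noteq> {} \<longrightarrow>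
        (\<exists>m m' T T' h.
           cube_face (cube_dim K i) m T \<and> cube_face (cube_dim K j) m' T' \<and> h ` T = T' \<and>
           (\<forall>u\<in>T. \<forall>v\<in>T. edist (cube_dim K j) (h u) (h v) = edist (cube_dim K i) u v) \<and>
           (\<forall>u\<in>cube_of K i. \<forall>v\<in>cube_of K j.
              chart K i u = chart K j v \<longleftrightarrow> u \<in> T \<and> v = h u)))"

definition square_complex :: "('i, 'a) cube_gluing \<Rightarrow> bool" where
  "square_complex K \<longleftrightarrow> cubical_complex K \<and>
     (\<forall>i\<in>cubes K. cube_dim K i \<le> 2) \<and> (\<exists>i\<in>cubes K. cube_dim K i = 2)"

text \<open>The (closed) cells are the images of all faces of the cubes, so that \<open>cells K\<close> does not
  depend on whether the faces of a cube are themselves listed in \<open>cubes K\<close>.\<close>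

definition is_cell :: "('i, 'a) cube_gluing \<Rightarrow> nat \<Rightarrow> 'a set \<Rightarrow> bool" where
  "is_cell K m c \<longleftrightarrow> (\<exists>i\<in>cubes K. \<exists>F. cube_face (cube_dim K i) m F \<and> c = chart K i ` F)"

definition cells :: "('i, 'a) cube_gluing \<Rightarrow> 'a set set" where
  "cells K = {c. \<exists>m. is_cell K m c}"

definition cell_face :: "('i, 'a) cube_gluing \<Rightarrow> 'a set \<Rightarrow> 'a set \<Rightarrow> bool" where
  "cell_face K f c \<longleftrightarrow> (\<exists>i\<in>cubes K. \<exists>l m F G.
     cube_face (cube_dim K i) l F \<and> cube_face (cube_dim K i) m G \<and> F \<subseteq> G \<and>
     f = chart K i ` F \<and> c = chart K i ` G)"

text \<open>Every cell is a face of itself, hence the exception \<open>c = e\<close>.\<close>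

definition free_face :: "('i, 'a) cube_gluing \<Rightarrow> 'a set \<Rightarrow> 'a set \<Rightarrow> bool" where
  "free_face K e s \<longleftrightarrow> cell_face K e s \<and> e \<noteq> s \<and>
     (\<forall>c\<in>cells K. cell_face K e c \<longrightarrow> c = s \<or> c = e)"

definition open_cell :: "('i, 'a) cube_gluing \<Rightarrow> 'a set \<Rightarrow> 'a set" where
  "open_cell K c = c - \<Union>{f. cell_face K f c \<and> f \<noteq> c}"

definition collapse :: "('i, 'a) cube_gluing \<Rightarrow> 'a set \<Rightarrow> 'a set \<Rightarrow> 'a set" where
  "collapse K e s = realization K - (open_cell K e \<union> open_cell K s)"


section \<open>The length metric of a complex\<close>

text \<open>\<open>chain K x y l\<close>: there is a piecewise straight path of length \<open>l\<close> from \<open>x\<close> to \<open>y\<close>, each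
  piece being a straight segment inside one cube.\<close>

inductive chain :: "('i, 'a) cube_gluing \<Rightarrow> 'a \<Rightarrow> 'a \<Rightarrow> real \<Rightarrow> bool" for K where
  chain_refl: "x \<in> realization K \<Longrightarrow> chain K x x 0"
| chain_step: "\<lbrakk>i \<in> cubes K; u \<in> cube_of K i; v \<in> cube_of K i; chain K (chart K i v) y l\<rbrakk> \<Longrightarrow>
     chain K (chart K i u) y (edist (cube_dim K i) u v + l)"

text \<open>Points that cannot be joined are at infinite distance, which \<open>enn2real\<close> turns into 0; a
  space with two such points is therefore not a \<open>Metric_space\<close>, let alone CAT(0).
  The same remark applies to \<open>induced_length_dist\<close> below.\<close>

definition complex_dist :: "('i, 'a) cube_gluing \<Rightarrow> 'a \<Rightarrow> 'a \<Rightarrow> real" where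
  "complex_dist K x y = enn2real (INF l\<in>{l. chain K x y l}. ennreal l)"


section \<open>Induced length metrics\<close>

definition curve_length :: "('a \<Rightarrow> 'a \<Rightarrow> real) \<Rightarrow> (real \<Rightarrow> 'a) \<Rightarrow> ennreal" where
  "curve_length d g = (SUP ts\<in>{ts. sorted ts \<and> set ts \<subseteq> {0..1}}.
     \<Sum>k<length ts - 1. ennreal (d (g (ts ! k)) (g (ts ! Suc k))))"

definition induced_length_dist ::
  "'a set \<Rightarrow> ('a \<Rightarrow> 'a \<Rightarrow> real) \<Rightarrow> 'a set \<Rightarrow> 'a \<Rightarrow> 'a \<Rightarrow> real" where
  "induced_length_dist M d S x y = enn2real (INF g\<in>{g.
     pathin (subtopology (Metric_space.mtopology M d) S) g \<and> g 0 = x \<and> g 1 = y}. curve_length d g)"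


section \<open>CAT(0) spaces and non-positive curvature\<close>

definition geodesic_segment ::
  "'a set \<Rightarrow> ('a \<Rightarrow> 'a \<Rightarrow> real) \<Rightarrow> 'a \<Rightarrow> 'a \<Rightarrow> 'a set \<Rightarrow> bool" where
  "geodesic_segment M d x y S \<longleftrightarrow> S \<subseteq> M \<and> (\<exists>g. g 0 = x \<and> g (d x y) = y \<and>
     (\<forall>s\<in>{0..d x y}. \<forall>t\<in>{0..d x y}. d (g s) (g t) = \<bar>s - t\<bar>) \<and> S = g ` {0..d x y})"

definition geodesic_space :: "'a set \<Rightarrow> ('a \<Rightarrow> 'a \<Rightarrow> real) \<Rightarrow> bool" where
  "geodesic_space M d \<longleftrightarrow> Metric_space M d \<and>
     (\<forall>x\<in>M. \<forall>y\<in>M. \<exists>S. geodesic_segment M d x y S)"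

text \<open>\<open>p'\<close> is a comparison point for \<open>p\<close>, where \<open>p\<close> lies on a side \<open>S\<close> issuing from \<open>x\<close> and the
  corresponding side of the comparison triangle joins \<open>x'\<close> to \<open>y'\<close>.\<close>

definition comparison_point :: "('a \<Rightarrow> 'a \<Rightarrow> real) \<Rightarrow> 'a \<Rightarrow> 'a set \<Rightarrow>
  real^2 \<Rightarrow> real^2 \<Rightarrow> 'a \<Rightarrow> real^2 \<Rightarrow> bool" where
  "comparison_point d x S x' y' p p' \<longleftrightarrow>
     p \<in> S \<and> p' \<in> closed_segment x' y' \<and> dist x' p' = d x p"

definition CAT0 :: "'a set \<Rightarrow> ('a \<Rightarrow> 'a \<Rightarrow> real) \<Rightarrow> bool" where
  "CAT0 M d \<longleftrightarrow> geodesic_space M d \<and>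
     (\<forall>x\<in>M. \<forall>y\<in>M. \<forall>z\<in>M. \<forall>S1 S2 S3.
        geodesic_segment M d x y S1 \<and> geodesic_segment M d y z S2 \<and> geodesic_segment M d z x S3 \<longrightarrow>
        (\<forall>x' y' z' :: real^2.
           dist x' y' = d x y \<and> dist y' z' = d y z \<and> dist z' x' = d z x \<longrightarrow>
           (let cmp = (\<lambda>p p'. comparison_point d x S1 x' y' p p' \<or>
                  comparison_point d y S2 y' z' p p' \<or> comparison_point d z S3 z' x' p p')
            in \<forall>p q p' q'. cmp p p' \<and> cmp q q' \<longrightarrow> d p q \<le> dist p' q')))"

definition nonpositively_curved :: "'a set \<Rightarrow> ('a \<Rightarrow> 'a \<Rightarrow> real) \<Rightarrow> bool" where
  "nonpositively_curved M d \<longleftrightarrow> Metric_space M d \<and>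
     (\<forall>x\<in>M. \<exists>r>0. CAT0 (Metric_space.mball M d x r) d)"

end

(* Away from the two corners of the square opposite to e, the collapsed complex K' is locally convex
   in K. At such a corner q, a geodesic of K leaves K' only by cutting off q. Following the
   geodesics in K from x to the points of a path in K' from x to y, one finds a moment at which the
   geodesic starts to cut off q, hence a path that is at least as long as the way through q. So near
   every point q of K' the induced distance of x and y is d x y, or d x q + d q y if the geodesic
   from x to y leaves K'.

   This dichotomy alone yields the CAT(0) inequality, in the form of Stewart's inequality: along a
   geodesic the function t |-> d'(z, g t)^2 - t^2 selects continuously between two convex functions,
   one below the other, and is therefore convex. No links or angles are needed. *)

theory Submission
  imports Defs
begin

section \<open>Stewart's inequality and CAT(0)\<close>

text \<open>Stewart's inequality involves a single cevian and only distances, so it can be verified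
  along one geodesic at a time. The obstacle is a shortest path of K' that bends at a corner
  \<open>q\<close> and is no geodesic of K. For it the inequality is needed at \<open>q\<close>
  itself, where it says that the comparison angles at \<open>q\<close> sum to at least pi. This
  holds because otherwise the path could be shortened near \<open>q\<close>; the other points of the
  path follow by subdividing the triangle at \<open>q\<close>. The complex enters through two facts.
  A 1-Lipschitz function on the square that is constant off the removed part extends to |K|, which
  together with CAT(0) makes the square embed isometrically. And the depth to which a short geodesic
  enters the removed part bounds the smaller of the two pieces that it cuts off the sides. The depth
  is continuous, so it tends to zero at the moment when the geodesics from \<open>x\<close> start to
  leave K', and a crossing point then tends to \<open>q\<close>.\<close>

definition metric_interval :: "'a set \<Rightarrow> ('a \<Rightarrow> 'a \<Rightarrow> real) \<Rightarrow> 'a \<Rightarrow> 'a \<Rightarrow> 'a set" where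
  "metric_interval M d x y = {z\<in>M. d x z + d z y = d x y}"

text \<open>CAT(0) in terms of distances: a cevian of a Euclidean triangle has the length given by
  Stewart's theorem, and the cevian of the space is at most that long. The form without division
  stays meaningful, and becomes trivial, for \<open>x = y\<close>. The point \<open>m\<close> is any
  point between \<open>x\<close> and \<open>y\<close>, so uniqueness of geodesics is built
  in.\<close>

locale stewart_space = Metric_space M d for M :: "'a set" and d +
  assumes between: "\<lbrakk>x \<in> M; y \<in> M; 0 \<le> a; a \<le> d x y\<rbrakk> \<Longrightarrow> \<exists>m\<in>M. d x m = a \<and> d m y = d x y - a"
    and stewart: "\<lbrakk>x \<in> M; y \<in> M; z \<in> M; m \<in> M; d x m + d m y = d x y\<rbrakk> \<Longrightarrow>
      d x y * (d z m)^2 \<le> d m y * (d z x)^2 + d x m * (d z y)^2 - d x m * d m y * d x y"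
begin

abbreviation I where "I \<equiv> metric_interval M d"

lemma metric_interval_commute: "I x y = I y x"
  unfolding metric_interval_def by (rule Collect_cong) (metis commute add.commute)

text \<open>Stewart's inequality for the cevian from \<open>m'\<close> to \<open>m\<close>: the
  comparison triangle with apex \<open>m'\<close> is degenerate and its cevian has length 0. Hence
  \<open>I x y\<close> is the only geodesic between its ends, and sets can be used in place of
  parametrised geodesics.\<close>

lemma between_unique:
  assumes "x \<in> M" "y \<in> M" "m \<in> I x y" "m' \<in> I x y"
    and eq: "d x m = d x m'"
  shows "m = m'"
proof (cases "d x y = 0")
  case True
  then have "d x m + d m y = 0" "d x m' + d m' y = 0"
    using assms unfolding metric_interval_def by auto
  then have "d x m = 0" "d x m' = 0"
    using nonneg[of x m] nonneg[of m y] nonneg[of x m'] nonneg[of m' y] by linarith+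
  moreover have "m \<in> M" "m' \<in> M" using assms unfolding metric_interval_def by auto
  ultimately show ?thesis using zero[of x m] zero[of x m'] \<open>x \<in> M\<close> by metis
next
  case False
  then have pos: "d x y > 0" using nonneg[of x y] by linarith
  have mm: "m \<in> M" "m' \<in> M" "d x m + d m y = d x y" "d x m' + d m' y = d x y"
    using assms unfolding metric_interval_def by auto
  have e: "d m' x = d x m" "d m' y = d m y" using eq mm commute[of m' x] by auto
  have "d x y * (d m' m)^2 \<le> d m y * (d m' x)^2 + d x m * (d m' y)^2 - d x m * d m y * d x y"
    by (rule stewart) (use assms mm in auto)
  also have "\<dots> = 0" unfolding e mm(3)[symmetric] by (simp add: power2_eq_square algebra_simps)
  finally have "(d m' m)^2 \<le> 0" using pos by (simp add: mult_le_0_iff)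
  then have "d m' m = 0" by simp
  then show ?thesis using mm by auto
qed

lemma metric_interval_subset:
  assumes "x \<in> M" "y \<in> M" "m \<in> I x y"
  shows "I x m \<subseteq> I x y"
proof
  fix n assume n: "n \<in> I x m"
  have "d n y \<le> d n m + d m y" "d x y \<le> d x n + d n y"
    using n assms unfolding metric_interval_def by (auto intro!: triangle)
  then show "n \<in> I x y"
    using n assms unfolding metric_interval_def by auto
qed

lemma between_dist_le:
  assumes "x \<in> M" "y \<in> M" "m \<in> I x y" "m' \<in> I x y"
    and le: "d x m \<le> d x m'"
  shows "d x m + d m m' = d x m'"
proof -
  have mm: "m \<in> M" "m' \<in> M" using assms unfolding metric_interval_def by auto
  \<comment> \<open>A point between \<open>x\<close> and \<open>m'\<close> at the same distance from
    \<open>x\<close> as \<open>m\<close>; uniqueness identifies it with \<open>m\<close>, so that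
    \<open>m\<close> lies between \<open>x\<close> and \<open>m'\<close>.\<close>
  obtain n where n: "n \<in> M" "d x n = d x m" "d n m' = d x m' - d x m"
    using between[of x m' "d x m"] assms mm by auto
  then have "n \<in> I x m'" unfolding metric_interval_def by auto
  then have "n \<in> I x y" using metric_interval_subset assms by blast
  then have "n = m" using between_unique assms n by blast
  then show ?thesis using n by auto
qed

lemma between_dist:
  assumes "x \<in> M" "y \<in> M" "m \<in> I x y" "m' \<in> I x y"
  shows "d m m' = \<bar>d x m - d x m'\<bar>"
  using between_dist_le[OF assms] between_dist_le[OF assms(1,2,4,3)] commute[of m m']
  by linarith

lemma geodesic_exists:
  assumes "x \<in> M" "y \<in> M"
  obtains g where "g 0 = x" "g (d x y) = y" "\<And>s t. \<lbrakk>s \<in> {0..d x y}; t \<in> {0..d x y}\<rbrakk> \<Longrightarrow> d (g s) (g t) = \<bar>s - t\<bar>"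
    "g ` {0..d x y} = I x y"
proof -
  have "\<forall>a\<in>{0..d x y}. \<exists>m\<in>M. d x m = a \<and> d m y = d x y - a" using between assms by auto
  then obtain g where g: "\<And>a. a \<in> {0..d x y} \<Longrightarrow> g a \<in> M \<and> d x (g a) = a \<and> d (g a) y = d x y - a"
    by metis
  have gI: "g a \<in> I x y" if "a \<in> {0..d x y}" for a
    using g[OF that] unfolding metric_interval_def by auto
  show ?thesis
  proof
    show "g 0 = x" using g[of 0] assms zero[of x "g 0"] by auto
    show "g (d x y) = y" using g[of "d x y"] assms zero[of "g (d x y)" y] by auto
    show "d (g s) (g t) = \<bar>s - t\<bar>" if "s \<in> {0..d x y}" "t \<in> {0..d x y}" for s t
      using between_dist[OF assms gI gI, OF that] g that by auto
    show "g ` {0..d x y} = I x y"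
    proof
      show "g ` {0..d x y} \<subseteq> I x y" using gI by auto
      show "I x y \<subseteq> g ` {0..d x y}"
      proof
        fix m assume m: "m \<in> I x y"
        then have "d x m + d m y = d x y" unfolding metric_interval_def by auto
        then have a: "d x m \<in> {0..d x y}"
          using nonneg[of m y] nonneg[of x m] unfolding atLeastAtMost_iff by linarith
        then have "g (d x m) = m" using between_unique[OF assms gI m] g by auto
        then show "m \<in> g ` {0..d x y}" using a by (metis imageI)
      qed
    qed
  qed
qed

lemma stewart_ratio:
  assumes "x \<in> M" "y \<in> M" "z \<in> M" "m \<in> M" "0 \<le> l" "l \<le> 1"
    and "d x m = l * d x y" "d m y = (1 - l) * d x y"
  shows "(d z m)^2 \<le> (1 - l) * (d z x)^2 + l * (d z y)^2 - l * (1 - l) * (d x y)^2"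
proof (cases "d x y = 0")
  case True
  then have "x = y" "m = x" using assms zero[of x y] zero[of x m] by auto
  then show ?thesis using True by (auto simp: algebra_simps)
next
  case False
  then have pos: "d x y > 0" using nonneg[of x y] by linarith
  have "d x y * (d z m)^2 \<le> d m y * (d z x)^2 + d x m * (d z y)^2 - d x m * d m y * d x y"
    by (rule stewart) (use assms in \<open>auto simp: algebra_simps\<close>)
  also have "\<dots> = d x y * ((1 - l) * (d z x)^2 + l * (d z y)^2 - l * (1 - l) * (d x y)^2)"
    unfolding assms(7,8) by (simp add: algebra_simps power2_eq_square)
  finally show ?thesis using pos by simp
qed

text \<open>The law of cosines, with the cosine of the comparison angle at \<open>p\<close> eliminated.\<close>

lemma hinge_comparison:
  assumes "p \<in> M" "x \<in> M" "y \<in> M" "x' \<in> M" "y' \<in> M" "0 \<le> l" "l \<le> 1" "0 \<le> k" "k \<le> 1"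
    and "d p x' = l * d p x" "d x' x = (1 - l) * d p x" "d p y' = k * d p y" "d y' y = (1 - k) * d p y"
  shows "(d x' y')^2 \<le> (l * d p x)^2 + (k * d p y)^2 - l * k * ((d p x)^2 + (d p y)^2 - (d x y)^2)"
proof -
  \<comment> \<open>One side of the hinge is shortened at a time: first the cevian from
    \<open>y\<close> to \<open>x'\<close> in the triangle \<open>p x y\<close>, then the cevian from
    \<open>x'\<close> to \<open>y'\<close> in the triangle \<open>p y x'\<close>.\<close>
  have 1: "(d y x')^2 \<le> (1 - l) * (d y p)^2 + l * (d y x)^2 - l * (1 - l) * (d p x)^2"
    by (rule stewart_ratio) (use assms in auto)
  have 2: "(d x' y')^2 \<le> (1 - k) * (d x' p)^2 + k * (d x' y)^2 - k * (1 - k) * (d p y)^2"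
    by (rule stewart_ratio) (use assms in auto)
  have "k * (d x' y)^2 \<le> k * ((1 - l) * (d y p)^2 + l * (d y x)^2 - l * (1 - l) * (d p x)^2)"
    using 1 assms commute[of y x'] by (intro mult_left_mono) auto
  with 2 show ?thesis
    using assms commute[of x' p] commute[of y p] commute[of y x]
    by (simp add: algebra_simps power2_eq_square)
qed

text \<open>Near \<open>p\<close> the comparison angle between the two sides is pi. Since this angle
  can only grow with the sides, it is pi for the full sides as well, which leaves no shortcut from
  \<open>x\<close> to \<open>y\<close>.\<close>

lemma geodesic_concat:
  assumes "x \<in> M" "y \<in> M" "p \<in> M" "x' \<in> M" "y' \<in> M" "\<epsilon> > 0"
    and "d p x' = \<epsilon>" "d x' x = d p x - \<epsilon>" "d p y' = \<epsilon>" "d y' y = d p y - \<epsilon>" "d x' y' = 2 * \<epsilon>"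
  shows "d x y = d x p + d p y"
proof -
  have pos: "d p x > 0" "d p y > 0" using assms nonneg[of x' x] nonneg[of y' y] by linarith+
  have le: "\<epsilon> \<le> d p x" "\<epsilon> \<le> d p y" using assms nonneg[of x' x] nonneg[of y' y] by linarith+
  define l k where "l = \<epsilon> / d p x" and "k = \<epsilon> / d p y"
  have lk: "l * d p x = \<epsilon>" "k * d p y = \<epsilon>" "0 < l" "l \<le> 1" "0 < k" "k \<le> 1"
    using pos le assms(6) unfolding l_def k_def by auto
  have "(d x' y')^2 \<le> (l * d p x)^2 + (k * d p y)^2 - l * k * ((d p x)^2 + (d p y)^2 - (d x y)^2)"
    by (rule hinge_comparison) (use assms lk in \<open>auto simp: algebra_simps\<close>)
  then have "l * k * ((d p x)^2 + (d p y)^2 - (d x y)^2) \<le> - 2 * \<epsilon> * \<epsilon>"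
    unfolding lk assms by (simp add: power2_eq_square)
  also have "\<dots> = l * k * (- 2 * d p x * d p y)"
    using lk by (metis (no_types, lifting) mult.assoc mult.left_commute mult.commute)
  finally have "(d p x)^2 + (d p y)^2 - (d x y)^2 \<le> - 2 * d p x * d p y"
    using mult_pos_pos[OF lk(3,5)] mult_le_cancel_left_pos by blast
  then have "(d p x + d p y)^2 \<le> (d x y)^2" by (simp add: power2_sum)
  then have "d p x + d p y \<le> d x y" by (rule power2_le_imp_le) simp
  then show ?thesis using triangle[of x p y] assms commute[of x p] by auto
qed

lemma local_geodesic_imp_geodesic:
  assumes gM: "\<And>t. t \<in> {0..L} \<Longrightarrow> g t \<in> M" and "m > 0"
    and loc: "\<And>s t. \<lbrakk>s \<in> {0..L}; t \<in> {0..L}; \<bar>s - t\<bar> \<le> m\<rbrakk> \<Longrightarrow> d (g s) (g t) = \<bar>s - t\<bar>"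
    and "s \<in> {0..L}" "t \<in> {0..L}"
  shows "d (g s) (g t) = \<bar>s - t\<bar>"
proof -
  have main: "\<forall>s t. s \<in> {0..L} \<longrightarrow> t \<in> {0..L} \<longrightarrow> s \<le> t \<longrightarrow> t - s \<le> m + real n * (m/2) \<longrightarrow> d (g s) (g t) = t - s" for n
  proof (induction n)
    case 0
    then show ?case using loc by force
  next
    case (Suc n)
    show ?case
    proof (intro allI impI)
      fix s t assume st: "s \<in> {0..L}" "t \<in> {0..L}" "s \<le> t" "t - s \<le> m + real (Suc n) * (m/2)"
      show "d (g s) (g t) = t - s"
      proof (cases "t - s \<le> m")
        case True
        then show ?thesis using loc st by force
      next
        case False
        \<comment> \<open>The pieces overlap: \<open>[s, p]\<close> is geodesic by induction,
          \<open>[p - m/2, t]\<close> by \<open>loc\<close>, and the common part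
          \<open>[p - m/2, p]\<close> makes \<open>geodesic_concat\<close> applicable at
          \<open>p\<close>.\<close>
        define p where "p = t - m/2"
        have ineq: "p - s \<le> m + real n * (m/2)" "p - s > m/2" "t - p = m/2" "p \<in> {0..L}"
          "p - m/2 \<in> {0..L}" "s \<le> p"
          using st False \<open>m > 0\<close> unfolding p_def by (auto simp: field_simps)
        have ih: "d (g s) (g p) = p - s" using Suc.IH st ineq by auto
        have ih2: "d (g s) (g (p - m/2)) = p - m/2 - s"
          using Suc.IH st ineq \<open>m > 0\<close> by auto
        have "d (g s) (g t) = d (g s) (g p) + d (g p) (g t)"
        proof (rule geodesic_concat[where \<epsilon> = "m/2" and x' = "g (p - m/2)" and y' = "g t"])
          show "d (g p) (g (p - m/2)) = m/2" using loc ineq \<open>m > 0\<close> by auto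
          show "d (g (p - m/2)) (g s) = d (g p) (g s) - m/2"
            using ih ih2 by (simp add: commute)
          show "d (g p) (g t) = m/2" using loc ineq st \<open>m > 0\<close> by auto
          then show "d (g t) (g t) = d (g p) (g t) - m/2" using gM st by auto
          show "d (g (p - m/2)) (g t) = 2 * (m/2)"
            using loc[of "p - m/2" t] ineq st \<open>m > 0\<close> by auto
        qed (use gM st ineq \<open>m > 0\<close> in auto)
        also have "d (g p) (g t) = t - p" using loc[of p t] ineq st \<open>m > 0\<close> by auto
        finally show ?thesis using ih by simp
      qed
    qed
  qed
  obtain n :: nat where "\<bar>s - t\<bar> / (m/2) < real n" using reals_Archimedean2 by blast
  then have "\<bar>s - t\<bar> \<le> m + real n * (m/2)" using \<open>m > 0\<close> by (simp add: field_simps)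
  then show ?thesis using main[of n] assms(4,5) commute[of "g s" "g t"]
    by (cases "s \<le> t") (force simp: abs_if)+
qed

end

section \<open>Comparison triangles, and the equivalence of CAT(0) with Stewart's inequality\<close>

lemma comparison_triangle_exists:
  assumes "0 < a" "0 \<le> b" "0 \<le> c" "a \<le> b + c" "b \<le> a + c" "c \<le> a + b"
  shows "\<exists>x y z :: real^2. dist x y = a \<and> dist y z = b \<and> dist z x = c"
proof -
  \<comment> \<open>\<open>(u, v)\<close> is the third vertex when the side of length
    \<open>a\<close> runs from the origin along the first axis: \<open>u\<close> comes from the law
    of cosines and \<open>v\<close> from Pythagoras. The triangle inequalities guarantee that
    \<open>v\<close> is real.\<close>
  define u where "u = (a^2 + c^2 - b^2) / (2 * a)"
  have au: "2 * a * u = a^2 + c^2 - b^2" using assms unfolding u_def by auto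
  have "b^2 \<le> (a + c)^2" "(a - c)^2 \<le> b^2"
    using assms abs_le_square_iff[of b "a + c"] abs_le_square_iff[of "a - c" b] by auto
  then have "2 * a * (- c) \<le> 2 * a * u" "2 * a * u \<le> 2 * a * c"
    unfolding au by (simp_all add: power2_eq_square algebra_simps)
  moreover have "0 < 2 * a" using assms(1) by simp
  ultimately have "- c \<le> u" "u \<le> c" using mult_le_cancel_left_pos by blast+
  then have uc: "u^2 \<le> c^2" using assms abs_le_square_iff[of u c] by linarith
  define v where "v = sqrt (c^2 - u^2)"
  have v2: "v^2 = c^2 - u^2" using uc unfolding v_def by simp
  have dist2: "dist p q = sqrt ((p$1 - q$1)^2 + (p$2 - q$2)^2)" for p q :: "real^2"
    by (simp add: dist_norm norm_vec_def L2_set_def UNIV_2)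
  show ?thesis
  proof (intro exI conjI)
    show "dist (0::real^2) (vector [a, 0]) = a" using assms by (simp add: dist2)
    have "(a - u)^2 + v^2 = b^2" using au v2 by (simp add: power2_eq_square algebra_simps)
    then show "dist (vector [a, 0] :: real^2) (vector [u, v]) = b"
      using assms by (simp add: dist2)
    show "dist (vector [u, v] :: real^2) 0 = c" using v2 assms by (simp add: dist2)
  qed
qed

lemma stewart_euclidean:
  fixes x y z :: "'b::real_inner"
  shows "(dist z ((1 - l) *\<^sub>R x + l *\<^sub>R y))^2 =
    (1 - l) * (dist z x)^2 + l * (dist z y)^2 - l * (1 - l) * (dist x y)^2"
  unfolding dist_norm power2_norm_eq_inner
  by (simp add: algebra_simps inner_simps inner_commute power2_eq_square)

lemma closed_segment_ratio:
  fixes x' y' p' :: "'b::real_inner"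
  assumes "p' \<in> closed_segment x' y'"
  obtains l where "0 \<le> l" "l \<le> 1" "p' = (1 - l) *\<^sub>R x' + l *\<^sub>R y'" "dist x' p' = l * dist x' y'"
    "dist p' y' = (1 - l) * dist x' y'"
proof -
  obtain l where l: "0 \<le> l" "l \<le> 1" "p' = (1 - l) *\<^sub>R x' + l *\<^sub>R y'"
    using assms unfolding closed_segment_def by auto
  have "x' - p' = l *\<^sub>R (x' - y')" "p' - y' = (1 - l) *\<^sub>R (x' - y')"
    unfolding l by (auto simp: algebra_simps)
  then show ?thesis using that l by (simp add: dist_norm)
qed

lemma geodesic_segment_mem_interval:
  assumes "Metric_space M d" "geodesic_segment M d x y S" "p \<in> S"
  shows "p \<in> M" "d x p + d p y = d x y"
proof -
  obtain g where g: "g 0 = x" "g (d x y) = y" "S = g ` {0..d x y}" "S \<subseteq> M"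
    "\<forall>s\<in>{0..d x y}. \<forall>t\<in>{0..d x y}. d (g s) (g t) = \<bar>s - t\<bar>"
    using assms unfolding geodesic_segment_def by auto
  then obtain t where t: "t \<in> {0..d x y}" "p = g t" using assms by auto
  have "d (g 0) (g t) = \<bar>0 - t\<bar>" "d (g t) (g (d x y)) = \<bar>t - d x y\<bar>"
    using bspec[OF bspec[OF g(5)], of 0 t] bspec[OF bspec[OF g(5)], of t "d x y"] t(1) by auto
  then show "d x p + d p y = d x y" using t unfolding g(1,2) by simp
  show "p \<in> M" using g(4) assms(3) by blast
qed

text \<open>Comparing two points on the sides takes two cevians. In the first use of
  \<open>key\<close>, \<open>u\<close> is a vertex; this bounds the distances from \<open>p\<close>
  to the three vertices, which is all that is required to let \<open>u\<close> be \<open>p\<close>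
  itself in the second use.\<close>

lemma (in stewart_space) CAT0: "CAT0 M d"
proof -
  have geo: "geodesic_space M d"
    unfolding geodesic_space_def
  proof (intro conjI ballI)
    show "Metric_space M d" by unfold_locales
    fix x y assume xy: "x \<in> M" "y \<in> M"
    obtain g where "g 0 = x" "g (d x y) = y" "\<And>s t. \<lbrakk>s \<in> {0..d x y}; t \<in> {0..d x y}\<rbrakk> \<Longrightarrow> d (g s) (g t) = \<bar>s - t\<bar>"
      "g ` {0..d x y} = I x y" using geodesic_exists[OF xy] by blast
    then have "geodesic_segment M d x y (I x y)"
      unfolding geodesic_segment_def
      by (intro conjI exI[of _ g] ballI) (auto simp: metric_interval_def)
    then show "\<exists>S. geodesic_segment M d x y S" by blast
  qed
  have key: "d u p \<le> dist u' p'"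
    if "x \<in> M" "y \<in> M" "u \<in> M" "geodesic_segment M d x y S" "comparison_point d x S x' y' p p'"
      "d u x \<le> dist u' x'" "d u y \<le> dist u' y'" "dist x' y' = d x y"
    for x y u S p and x' y' u' p' :: "real^2"
  proof -
    have p: "p \<in> S" "p' \<in> closed_segment x' y'" "dist x' p' = d x p"
      using that unfolding comparison_point_def by auto
    have pM: "p \<in> M" "d x p + d p y = d x y"
      using geodesic_segment_mem_interval[OF Metric_space_axioms that(4) p(1)] by auto
    obtain l where l: "0 \<le> l" "l \<le> 1" "p' = (1 - l) *\<^sub>R x' + l *\<^sub>R y'" "dist x' p' = l * dist x' y'"
      using closed_segment_ratio[OF p(2)] by metis
    have "(d u p)^2 \<le> (1 - l) * (d u x)^2 + l * (d u y)^2 - l * (1 - l) * (d x y)^2"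
    proof (rule stewart_ratio)
      show lD: "d x p = l * d x y" using l(4) p(3) that(8) by simp
      show "d p y = (1 - l) * d x y" using lD pM by (simp add: algebra_simps)
    qed (use that pM l in auto)
    also have "\<dots> \<le> (1 - l) * (dist u' x')^2 + l * (dist u' y')^2 - l * (1 - l) * (dist x' y')^2"
      using that l by (intro diff_mono add_mono mult_left_mono power_mono) auto
    also have "\<dots> = (dist u' p')^2" unfolding l(3) stewart_euclidean ..
    finally show ?thesis by (rule power2_le_imp_le) simp
  qed
  show ?thesis
    unfolding CAT0_def Let_def
  proof (intro conjI geo ballI allI impI; elim conjE)
    fix x y z S1 S2 S3 p q and x' y' z' p' q' :: "real^2"
    assume xyz: "x \<in> M" "y \<in> M" "z \<in> M"
      and S: "geodesic_segment M d x y S1" "geodesic_segment M d y z S2" "geodesic_segment M d z x S3"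
      and tri: "dist x' y' = d x y" "dist y' z' = d y z" "dist z' x' = d z x"
      and cp: "comparison_point d x S1 x' y' p p' \<or> comparison_point d y S2 y' z' p p' \<or>
        comparison_point d z S3 z' x' p p'"
      and cq: "comparison_point d x S1 x' y' q q' \<or> comparison_point d y S2 y' z' q q' \<or>
        comparison_point d z S3 z' x' q q'"
    have pM: "p \<in> M"
      using cp S geodesic_segment_mem_interval(1)[OF Metric_space_axioms] unfolding comparison_point_def by blast
    have tri': "dist y' x' = d y x" "dist z' y' = d z y" "dist x' z' = d x z"
      using tri by (auto simp: commute dist_commute)
    have vert: "d u p \<le> dist u' p'"
      if "u \<in> M" "d u x \<le> dist u' x'" "d u y \<le> dist u' y'" "d u z \<le> dist u' z'" for u and u' :: "real^2"
      using cp that key[OF xyz(1,2) that(1) S(1), of x' y' p p' u'] key[OF xyz(2,3) that(1) S(2), of y' z' p p' u']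
        key[OF xyz(3,1) that(1) S(3), of z' x' p p' u'] tri by blast
    have "d x p \<le> dist x' p'" "d y p \<le> dist y' p'" "d z p \<le> dist z' p'"
      using vert[of x x'] vert[of y y'] vert[of z z'] xyz tri tri' by auto
    then have le: "d p x \<le> dist p' x'" "d p y \<le> dist p' y'" "d p z \<le> dist p' z'"
      by (auto simp: commute dist_commute)
    show "d p q \<le> dist p' q'"
      using cq le key[OF xyz(1,2) pM S(1), of x' y' q q' p'] key[OF xyz(2,3) pM S(2), of y' z' q q' p']
        key[OF xyz(3,1) pM S(3), of z' x' q q' p'] tri by blast
  qed
qed

text \<open>Comparing a vertex with a point of the opposite side gives Stewart's inequality, but
  only for points on geodesic segments. That every \<open>m\<close> with
  \<open>d x m + d m y = d x y\<close> lies on a segment is shown afterwards, as in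
  \<open>between_unique\<close>.\<close>

lemma CAT0_imp_stewart_space:
  assumes cat: "CAT0 M d"
  shows "stewart_space M d"
proof -
  interpret Metric_space M d using cat unfolding CAT0_def geodesic_space_def by blast
  have seg: "\<exists>S. geodesic_segment M d x y S" if "x \<in> M" "y \<in> M" for x y
    using cat that unfolding CAT0_def geodesic_space_def by blast
  have bet: "\<exists>m\<in>S. d x m = a \<and> d m y = d x y - a"
    if S: "geodesic_segment M d x y S" and a: "0 \<le> a" "a \<le> d x y" for x y a S
  proof -
    obtain g where g: "g 0 = x" "g (d x y) = y" "S = g ` {0..d x y}" "S \<subseteq> M"
      "\<forall>s\<in>{0..d x y}. \<forall>t\<in>{0..d x y}. d (g s) (g t) = \<bar>s - t\<bar>"
      using S unfolding geodesic_segment_def by auto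
    have "d (g 0) (g a) = \<bar>0 - a\<bar>" "d (g a) (g (d x y)) = \<bar>a - d x y\<bar>"
      using bspec[OF bspec[OF g(5)], of 0 a] bspec[OF bspec[OF g(5)], of a "d x y"] a by auto
    then show ?thesis using a unfolding g(1,2) g(3) by (intro bexI[of _ "g a"]) auto
  qed
  have st: "d x y * (d z m)^2 \<le> d m y * (d z x)^2 + d x m * (d z y)^2 - d x m * d m y * d x y"
    if S1: "geodesic_segment M d x y S1" and m: "m \<in> S1" and xyz: "x \<in> M" "y \<in> M" "z \<in> M" for x y z m S1
  proof (cases "d x y = 0")
    case True
    have "d x m + d m y = d x y" using geodesic_segment_mem_interval[OF Metric_space_axioms S1 m] by auto
    then have "d x m = 0" "d m y = 0" using True nonneg[of x m] nonneg[of m y] by linarith+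
    then show ?thesis using True by auto
  next
    case False
    then have pos: "d x y > 0" using nonneg[of x y] by linarith
    have mM: "m \<in> M" "d x m + d m y = d x y"
      using geodesic_segment_mem_interval[OF Metric_space_axioms S1 m] by auto
    obtain S2 S3 where S23: "geodesic_segment M d y z S2" "geodesic_segment M d z x S3"
      using seg xyz by blast
    have "\<exists>x' y' z' :: real^2. dist x' y' = d x y \<and> dist y' z' = d y z \<and> dist z' x' = d z x"
      using pos xyz triangle[of x z y] triangle[of y x z] triangle[of z y x]
      by (intro comparison_triangle_exists) (auto simp: commute)
    then obtain x' y' z' :: "real^2" where tri: "dist x' y' = d x y" "dist y' z' = d y z" "dist z' x' = d z x"
      by blast
    define l where "l = d x m / d x y"
    have l: "0 \<le> l" "l \<le> 1" "d x m = l * d x y" "d m y = (1 - l) * d x y"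
    proof -
      show lD: "d x m = l * d x y" using pos unfolding l_def by simp
      show "0 \<le> l" unfolding l_def by simp
      have "d x m \<le> d x y" using mM nonneg[of m y] by linarith
      then show "l \<le> 1" using pos unfolding l_def by simp
      show "d m y = (1 - l) * d x y" using lD mM by (simp add: algebra_simps)
    qed
    define m' where "m' = (1 - l) *\<^sub>R x' + l *\<^sub>R y'"
    have "x' - m' = l *\<^sub>R (x' - y')" unfolding m'_def by (auto simp: algebra_simps)
    then have "dist x' m' = d x m" using l tri by (simp add: dist_norm)
    then have cm: "comparison_point d x S1 x' y' m m'"
      using m l unfolding comparison_point_def closed_segment_def m'_def by auto
    \<comment> \<open>The vertex \<open>z\<close> counts as a point of the side issuing from it, so
      that the CAT(0) inequality specialises to a cevian.\<close>
    have "z \<in> S3" using S23(2) unfolding geodesic_segment_def by (auto intro!: image_eqI[of _ _ 0])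
    then have cz: "comparison_point d z S3 z' x' z z'"
      unfolding comparison_point_def using xyz by auto
    have "d z m \<le> dist z' m'"
      using cat[unfolded CAT0_def Let_def, THEN conjunct2, rule_format, of x y z S1 S2 S3 x' y' z' z z' m m']
        xyz S1 S23 tri cm cz by blast
    then have "(d z m)^2 \<le> (dist z' m')^2" by (intro power_mono) auto
    also have "\<dots> = (1 - l) * (dist z' x')^2 + l * (dist z' y')^2 - l * (1 - l) * (dist x' y')^2"
      unfolding m'_def stewart_euclidean ..
    finally have "(d z m)^2 \<le> (1 - l) * (d z x)^2 + l * (d z y)^2 - l * (1 - l) * (d x y)^2"
      using tri by (simp add: commute dist_commute)
    then have "d x y * (d z m)^2 \<le> d x y * ((1 - l) * (d z x)^2 + l * (d z y)^2 - l * (1 - l) * (d x y)^2)"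
      using pos by (intro mult_left_mono) auto
    then show ?thesis unfolding l(3,4) by (simp add: algebra_simps power2_eq_square)
  qed
  show ?thesis
  proof
    fix x y a assume "x \<in> M" "y \<in> M" "0 \<le> a" "a \<le> d x y"
    then show "\<exists>m\<in>M. d x m = a \<and> d m y = d x y - a"
    proof -
      obtain S where S: "geodesic_segment M d x y S" using seg[OF \<open>x \<in> M\<close> \<open>y \<in> M\<close>] by blast
      then have "S \<subseteq> M" unfolding geodesic_segment_def by blast
      then show ?thesis using bet[OF S \<open>0 \<le> a\<close> \<open>a \<le> d x y\<close>] by blast
    qed
  next
    fix x y z m assume xyz: "x \<in> M" "y \<in> M" "z \<in> M" and m: "m \<in> M" "d x m + d m y = d x y"
    obtain S where S: "geodesic_segment M d x y S" using seg xyz by blast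
    have "0 \<le> d x m" "d x m \<le> d x y" using m(2) nonneg[of m y] nonneg[of x m] by linarith+
    then obtain n where n: "n \<in> S" "d x n = d x m" "d n y = d x y - d x m" using bet[OF S] by blast
    have nM: "n \<in> M" using S n unfolding geodesic_segment_def by auto
    have e: "d m x = d x m" "d n y = d m y" using n m commute[of m x] by auto
    \<comment> \<open>Stewart's inequality is known for \<open>n\<close>, which lies on a segment.
      With apex \<open>m\<close>, whose distances to \<open>x\<close> and \<open>y\<close> are those
      of \<open>n\<close>, it forces \<open>d m n = 0\<close>.\<close>
    have "n = m"
    proof (cases "d x y = 0")
      case True
      then have "d x m = 0" "d m y = 0" using m(2) nonneg[of x m] nonneg[of m y] by linarith+
      then show ?thesis using n nM m xyz by auto
    next
      case False
      have "d x y * (d m n)^2 \<le> d n y * (d m x)^2 + d x n * (d m y)^2 - d x n * d n y * d x y"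
        by (rule st) (use S n xyz m in auto)
      also have "\<dots> = 0" unfolding e n(2) m(2)[symmetric] by (simp add: algebra_simps power2_eq_square)
      finally have "(d m n)^2 \<le> 0" using False nonneg[of x y] by (simp add: mult_le_0_iff)
      then have "d m n = 0" by simp
      then show ?thesis using nM m by auto
    qed
    then show "d x y * (d z m)^2 \<le> d m y * (d z x)^2 + d x m * (d z y)^2 - d x m * d m y * d x y"
      using st[OF S n(1) xyz] by auto
  qed
qed

section \<open>Spaces in which long ways around pass through one point\<close>

lemma nonexpansive_imp_continuous_on:
  fixes f :: "real \<Rightarrow> real"
  assumes "\<And>s t. \<lbrakk>s \<in> S; t \<in> S\<rbrakk> \<Longrightarrow> \<bar>f s - f t\<bar> \<le> \<bar>s - t\<bar>"
  shows "continuous_on S f"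
proof -
  have "1-lipschitz_on S f" using assms by (intro lipschitz_onI) (auto simp: dist_real_def)
  then show ?thesis by (rule lipschitz_on_continuous_on)
qed

text \<open>Two nonempty closed sets that cover a connected interval must meet.\<close>

lemma switching_point:
  fixes f h k :: "real \<Rightarrow> real"
  assumes "continuous_on {a..b} f" "continuous_on {a..b} h" "continuous_on {a..b} k"
    and "a \<le> b" "\<And>t. t \<in> {a..b} \<Longrightarrow> f t = h t \<or> f t = k t" "f a = h a" "f b = k b"
  obtains t where "t \<in> {a..b}" "f t = h t" "f t = k t"
proof -
  define A B where "A = {t\<in>{a..b}. f t - h t = 0}" and "B = {t\<in>{a..b}. f t - k t = 0}"
  have "closed A" "closed B" unfolding A_def B_def
    by (intro continuous_closed_preimage_constant continuous_on_diff assms closed_atLeastAtMost)+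
  moreover have "{a..b} \<subseteq> A \<union> B" using assms(5) unfolding A_def B_def by force
  moreover have "a \<in> A \<inter> {a..b}" "b \<in> B \<inter> {a..b}" using assms unfolding A_def B_def by auto
  ultimately have "A \<inter> B \<inter> {a..b} \<noteq> {}"
    using connected_closedD[of "{a..b}" A B] by fastforce
  then obtain t where "t \<in> A \<inter> B \<inter> {a..b}" by blast
  then show ?thesis using that[of t] unfolding A_def B_def by simp
qed

lemma convex_on_interval_nonpos:
  fixes f :: "real \<Rightarrow> real"
  assumes "convex_on S f" "x \<in> S" "y \<in> S" "x \<le> t" "t \<le> y" "f x \<le> 0" "f y \<le> 0"
  shows "f t \<le> 0"
proof (cases "x = y")
  case True
  then show ?thesis using assms by auto
next
  case False
  define l where "l = (t - x) / (y - x)"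
  have l: "0 \<le> l" "l \<le> 1" using assms False unfolding l_def by auto
  have "l * (y - x) = t - x" using False unfolding l_def by auto
  then have "(1 - l) *\<^sub>R x + l *\<^sub>R y = t" by (simp add: algebra_simps)
  then have "f t \<le> (1 - l) * f x + l * f y" using convex_onD[OF assms(1) l assms(2,3)] by simp
  also have "\<dots> \<le> 0" using l assms by (simp add: add_nonpos_nonpos mult_nonneg_nonpos)
  finally show ?thesis .
qed

lemma convex_on_add_affine:
  fixes f :: "real \<Rightarrow> real"
  assumes "convex_on S f"
  shows "convex_on S (\<lambda>t. f t + (c * t + e))"
proof (rule convex_on_add[OF assms])
  have "c * (u * x + v * y) + e = u * (c * x + e) + v * (c * y + e)" if "u + v = 1" for u v x y
  proof -
    have "u * (c * x + e) + v * (c * y + e) = c * (u * x + v * y) + (u + v) * e"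
      by (simp add: algebra_simps)
    then show ?thesis using that by simp
  qed
  then show "convex_on S (\<lambda>t. c * t + e)"
    using assms unfolding convex_on_def by simp
qed

text \<open>Where \<open>f\<close> leaves the lower branch \<open>h\<close>, it stays on the convex upper branch \<open>k\<close> between two
  points at which it is either supported from below by \<open>h\<close> or at an end of the interval.\<close>

lemma convex_on_selection:
  fixes f h k :: "real \<Rightarrow> real"
  assumes cont: "continuous_on {a..b} f" "continuous_on {a..b} h" "continuous_on {a..b} k"
    and sel: "\<And>t. t \<in> {a..b} \<Longrightarrow> f t = h t \<or> f t = k t"
    and le: "\<And>t. t \<in> {a..b} \<Longrightarrow> h t \<le> f t"
    and conv: "convex_on {a..b} h" "convex_on {a..b} k"
  shows "convex_on {a..b} f"
proof (rule convex_on_linorderI)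
  fix l x y :: real
  assume l: "0 < l" "l < 1" and xy: "x \<in> {a..b}" "y \<in> {a..b}" "x < y"
  \<comment> \<open>\<open>c * t + e\<close> is the negative of the chord of \<open>f\<close> over
    \<open>[x, y]\<close>. After adding it, the ends have value 0 and convexity of \<open>f\<close>
    becomes a statement about a sign.\<close>
  define c e where "c = - (f y - f x) / (y - x)" and "e = - f x - c * x"
  define t where "t = (1 - l) *\<^sub>R x + l *\<^sub>R y"
  have zx: "f x + (c * x + e) = 0" unfolding e_def by simp
  have "c * (y - x) = - (f y - f x)" using xy unfolding c_def by simp
  then have zy: "f y + (c * y + e) = 0" unfolding e_def by (simp add: algebra_simps)
  have "t - x = l * (y - x)" "y - t = (1 - l) * (y - x)" unfolding t_def by (auto simp: algebra_simps)
  then have txy: "x \<le> t" "t \<le> y"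
    using l xy mult_nonneg_nonneg[of l "y - x"] mult_nonneg_nonneg[of "1 - l" "y - x"] by linarith+
  have sub: "{x..t} \<subseteq> {a..b}" "{t..y} \<subseteq> {a..b}" using xy txy by auto
  note hc = convex_on_add_affine[OF conv(1), of c e] and kc = convex_on_add_affine[OF conv(2), of c e]
  have hneg: "h s + (c * s + e) \<le> 0" if "x \<le> s" "s \<le> y" for s
    by (rule convex_on_interval_nonpos[OF hc xy(1,2) that]) (use le[OF xy(1)] le[OF xy(2)] zx zy in linarith)+
  have "f t + (c * t + e) \<le> 0"
  proof (cases "f t = h t")
    case True
    then show ?thesis using hneg[OF txy] by simp
  next
    case False
    then have ft: "f t = k t" using sel sub txy by fastforce
    \<comment> \<open>If \<open>f\<close> starts on \<open>h\<close>, it has to switch to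
      \<open>k\<close> before \<open>t\<close>. At the switch \<open>k\<close> equals
      \<open>h\<close>, which is below the chord by its own convexity.\<close>
    have "\<exists>x'\<in>{x..t}. k x' + (c * x' + e) \<le> 0"
    proof (cases "f x = h x")
      case True
      obtain s where "s \<in> {x..t}" "f s = h s" "f s = k s"
      proof (rule switching_point[of x t f h k])
        show "continuous_on {x..t} f" "continuous_on {x..t} h" "continuous_on {x..t} k"
          using cont sub(1) continuous_on_subset by blast+
        show "f r = h r \<or> f r = k r" if "r \<in> {x..t}" for r using sel sub(1) that by blast
      qed (use txy True ft in auto)
      then show ?thesis using hneg[of s] txy by (intro bexI[of _ s]) auto
    next
      case False
      then have "f x = k x" using sel xy by blast
      then show ?thesis using zx txy by (intro bexI[of _ x]) auto
    qed
    then obtain x' where x': "x' \<in> {x..t}" "k x' + (c * x' + e) \<le> 0" by blast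
    have "\<exists>y'\<in>{t..y}. k y' + (c * y' + e) \<le> 0"
    proof (cases "f y = h y")
      case True
      obtain s where "s \<in> {t..y}" "f s = k s" "f s = h s"
      proof (rule switching_point[of t y f k h])
        show "continuous_on {t..y} f" "continuous_on {t..y} h" "continuous_on {t..y} k"
          using cont sub(2) continuous_on_subset by blast+
        show "f r = k r \<or> f r = h r" if "r \<in> {t..y}" for r using sel sub(2) that by blast
      qed (use txy True ft in auto)
      then show ?thesis using hneg[of s] txy by (intro bexI[of _ s]) auto
    next
      case False
      then have "f y = k y" using sel xy by blast
      then show ?thesis using zy txy by (intro bexI[of _ y]) auto
    qed
    then obtain y' where y': "y' \<in> {t..y}" "k y' + (c * y' + e) \<le> 0" by blast
    have "k t + (c * t + e) \<le> 0"
      by (rule convex_on_interval_nonpos[OF kc, of x' y']) (use x' y' sub in auto)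
    then show ?thesis using ft by simp
  qed
  moreover have "f t + (c * t + e) = f t - ((1 - l) * f x + l * f y)"
  proof -
    have "(1 - l) * (f x + (c * x + e)) + l * (f y + (c * y + e)) = 0" using zx zy by simp
    then show ?thesis unfolding t_def by (simp add: algebra_simps)
  qed
  ultimately show "f ((1 - l) *\<^sub>R x + l *\<^sub>R y) \<le> (1 - l) * f x + l * f y" unfolding t_def by simp
qed simp

section \<open>Convexity of the distance along a geodesic\<close>

context stewart_space
begin

lemma endpoints_in_metric_interval:
  assumes "x \<in> M" "y \<in> M"
  shows "x \<in> I x y" "y \<in> I x y"
  using assms unfolding metric_interval_def by auto

lemma metric_interval_convex:
  assumes "x \<in> M" "y \<in> M" "m \<in> I x y" "n \<in> I x y"
  shows "I m n \<subseteq> I x y"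
proof -
  have *: "I m n \<subseteq> I x y"
    if "m \<in> I x y" "n \<in> I x y" "d x m \<le> d x n" for m n
  proof -
    have mn: "m \<in> M" "n \<in> M" using that unfolding metric_interval_def by auto
    have "m \<in> I n x"
      using between_dist_le[OF assms(1,2) that] mn unfolding metric_interval_def
      by (simp add: commute[of n] commute[of m x])
    then have "I n m \<subseteq> I n x"
      using metric_interval_subset mn assms by blast
    then show ?thesis
      using metric_interval_subset[OF assms(1,2) that(2)] by (simp add: metric_interval_commute)
  qed
  show ?thesis
    using *[OF assms(3,4)] *[OF assms(4,3)] by (metis linear metric_interval_commute)
qed

lemma continuous_on_dist_geodesic:
  assumes "z \<in> M" "g ` S \<subseteq> M" and iso: "\<And>s t. \<lbrakk>s \<in> S; t \<in> S\<rbrakk> \<Longrightarrow> d (g s) (g t) = \<bar>s - t\<bar>"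
  shows "continuous_on S (\<lambda>t. d z (g t))"
proof (rule nonexpansive_imp_continuous_on)
  fix s t assume st: "s \<in> S" "t \<in> S"
  then have "g s \<in> M" "g t \<in> M" using assms(2) by auto
  then show "\<bar>d z (g s) - d z (g t)\<bar> \<le> \<bar>s - t\<bar>"
    using iso[OF st] triangle[of z "g s" "g t"] triangle[of z "g t" "g s"] assms(1)
      commute[of "g s" "g t"] by (simp add: abs_le_iff)
qed

text \<open>The last term of Stewart's inequality is the convexity defect of \<open>t^2\<close>.
  Subtracting \<open>t^2\<close> thus turns the inequality into plain convexity, which is what
  \<open>convex_on_selection\<close> can handle.\<close>

lemma convex_on_dist_sq:
  assumes "z \<in> M" "g ` {0..L} \<subseteq> M"
    and iso: "\<And>s t. \<lbrakk>s \<in> {0..L}; t \<in> {0..L}\<rbrakk> \<Longrightarrow> d (g s) (g t) = \<bar>s - t\<bar>"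
  shows "convex_on {0..L} (\<lambda>t. (d z (g t))^2 - t^2)"
proof (rule convex_on_linorderI)
  fix l s t :: real
  assume l: "0 < l" "l < 1" and st: "s \<in> {0..L}" "t \<in> {0..L}" "s < t"
  define r where "r = (1 - l) *\<^sub>R s + l *\<^sub>R t"
  have r: "r \<in> {0..L}" unfolding r_def using convexD_alt[of "{0..L}" s t l] st l by auto
  have e: "r - s = l * (t - s)" "t - r = (1 - l) * (t - s)" unfolding r_def by (auto simp: algebra_simps)
  then have "s \<le> r" "r \<le> t"
    using l st mult_nonneg_nonneg[of l "t - s"] mult_nonneg_nonneg[of "1 - l" "t - s"] by linarith+
  then have "d (g s) (g r) = l * (t - s)" "d (g r) (g t) = (1 - l) * (t - s)" "d (g s) (g t) = t - s"
    using iso[of s r] iso[of r t] iso[of s t] st r unfolding e[symmetric] by simp_all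
  then have "(d z (g r))^2 \<le> (1 - l) * (d z (g s))^2 + l * (d z (g t))^2 - l * (1 - l) * (t - s)^2"
  proof -
    have "g s \<in> M" "g t \<in> M" "g r \<in> M" using assms(2) st r by auto
    then show ?thesis
      using stewart_ratio[of "g s" "g t" z "g r" l] assms(1) l
        \<open>d (g s) (g r) = l * (t - s)\<close> \<open>d (g r) (g t) = (1 - l) * (t - s)\<close> \<open>d (g s) (g t) = t - s\<close>
      by simp
  qed
  moreover have "r^2 = (1 - l) * s^2 + l * t^2 - l * (1 - l) * (t - s)^2"
    unfolding r_def by (simp add: power2_eq_square algebra_simps)
  ultimately show "(d z (g ((1 - l) *\<^sub>R s + l *\<^sub>R t)))^2 - ((1 - l) *\<^sub>R s + l *\<^sub>R t)^2 \<le>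
      (1 - l) * ((d z (g s))^2 - s^2) + l * ((d z (g t))^2 - t^2)"
    unfolding r_def[symmetric] by (simp add: algebra_simps)
qed simp

text \<open>The gain \<open>l * (1 - l) * (t - s)^2\<close> in Stewart's inequality is at least the
  convexity defect of the square function between the values at \<open>s\<close> and
  \<open>t\<close>, because the distance to \<open>z\<close> changes by at most
  \<open>t - s\<close>. Hence a square root can be taken.\<close>

lemma convex_on_dist:
  assumes "z \<in> M" "g ` {0..L} \<subseteq> M"
    and iso: "\<And>s t. \<lbrakk>s \<in> {0..L}; t \<in> {0..L}\<rbrakk> \<Longrightarrow> d (g s) (g t) = \<bar>s - t\<bar>"
  shows "convex_on {0..L} (\<lambda>t. d z (g t))"
proof (rule convex_on_linorderI)
  fix l s t :: real
  assume l: "0 < l" "l < 1" and st: "s \<in> {0..L}" "t \<in> {0..L}" "s < t"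
  define r where "r = (1 - l) *\<^sub>R s + l *\<^sub>R t"
  have "(d z (g r))^2 - r^2 \<le> (1 - l) * ((d z (g s))^2 - s^2) + l * ((d z (g t))^2 - t^2)"
    unfolding r_def using convex_onD[OF convex_on_dist_sq[OF assms]] l st by simp
  moreover have "r^2 = (1 - l) * s^2 + l * t^2 - l * (1 - l) * (t - s)^2"
    unfolding r_def by (simp add: power2_eq_square algebra_simps)
  ultimately have 1: "(d z (g r))^2 \<le> (1 - l) * (d z (g s))^2 + l * (d z (g t))^2 - l * (1 - l) * (t - s)^2"
    by (simp add: algebra_simps)
  have "g s \<in> M" "g t \<in> M" using assms(2) st by auto
  then have "\<bar>d z (g t) - d z (g s)\<bar> \<le> \<bar>t - s\<bar>"
    using iso[of s t] st triangle[of z "g s" "g t"] triangle[of z "g t" "g s"] assms(1)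
      commute[of "g s" "g t"] by (simp add: abs_le_iff)
  then have "(d z (g t) - d z (g s))^2 \<le> (t - s)^2" by (simp add: abs_le_square_iff)
  then have "l * (1 - l) * (d z (g t) - d z (g s))^2 \<le> l * (1 - l) * (t - s)^2"
    using l by (intro mult_left_mono) auto
  moreover have "((1 - l) * d z (g s) + l * d z (g t))^2 =
    (1 - l) * (d z (g s))^2 + l * (d z (g t))^2 - l * (1 - l) * (d z (g t) - d z (g s))^2"
    by (simp add: power2_eq_square algebra_simps)
  ultimately have "(d z (g r))^2 \<le> ((1 - l) * d z (g s) + l * d z (g t))^2" using 1 by linarith
  then have "d z (g r) \<le> (1 - l) * d z (g s) + l * d z (g t)"
    by (rule power2_le_imp_le) (use l in auto)
  then show "d z (g ((1 - l) *\<^sub>R s + l *\<^sub>R t)) \<le> (1 - l) * d z (g s) + l * d z (g t)"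
    unfolding r_def .
qed simp

end

text \<open>The situation near a point \<open>q\<close> of the collapsed complex: \<open>B\<close> is a small ball and \<open>d'\<close> the induced
  length metric.\<close>

locale detour_space = stewart_space M d + E: Metric_space B d'
  for M :: "'a set" and d and B :: "'a set" and d' +
  fixes q
  assumes subset: "B \<subseteq> M" and centre: "q \<in> B"
    and dist_le: "\<lbrakk>x \<in> B; y \<in> B\<rbrakk> \<Longrightarrow> d x y \<le> d' x y"
    and inside: "\<lbrakk>x \<in> B; y \<in> B; I x y \<subseteq> B\<rbrakk> \<Longrightarrow> d' x y = d x y"
    and detour: "\<lbrakk>x \<in> B; y \<in> B; \<not> I x y \<subseteq> B\<rbrakk> \<Longrightarrow> d' x y = d x q + d q y"
    and star: "x \<in> B \<Longrightarrow> I x q \<subseteq> B"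
begin

lemma inM: "x \<in> B \<Longrightarrow> x \<in> M" using subset by blast

lemma dist_centre: assumes "x \<in> B" shows "d' x q = d x q" "d' q x = d q x"
  using inside[OF assms centre star[OF assms]] by (auto simp: commute E.commute)

lemma inside_subinterval:
  assumes "x \<in> B" "y \<in> B" "I x y \<subseteq> B"
    and "m \<in> I x y" "n \<in> I x y"
  shows "d' m n = d m n"
  by (rule inside) (use assms metric_interval_convex[OF inM inM, OF assms(1,2,4,5)] in blast)+

lemma stewart_inside:
  assumes xyz: "x \<in> B" "y \<in> B" "z \<in> B" and I: "I x y \<subseteq> B"
    and m: "m \<in> I x y"
  shows "d x y * (d' z m)^2 \<le> d m y * (d' z x)^2 + d x m * (d' z y)^2 - d x m * d m y * d x y"
proof (cases "d x y = 0")
  case True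
  have "d x m + d m y = d x y" using m unfolding metric_interval_def by auto
  then have "d x m = 0" "d m y = 0" using True nonneg[of x m] nonneg[of m y] by linarith+
  then show ?thesis using True by simp
next
  case False
  define D where "D = d x y"
  have D: "D > 0" using False nonneg[of x y] unfolding D_def by linarith
  obtain g where g: "g 0 = x" "g D = y" "\<And>s t. \<lbrakk>s \<in> {0..D}; t \<in> {0..D}\<rbrakk> \<Longrightarrow> d (g s) (g t) = \<bar>s - t\<bar>"
    "g ` {0..D} = I x y" using geodesic_exists[OF inM inM, OF xyz(1,2)] unfolding D_def by metis
  have gB: "g t \<in> B" "g t \<in> M" if "t \<in> {0..D}" for t using that g(4) I inM by blast+
  have gd': "d' (g s) (g t) = \<bar>s - t\<bar>" if "s \<in> {0..D}" "t \<in> {0..D}" for s t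
  proof -
    have "g s \<in> I x y" "g t \<in> I x y" using g(4) that by blast+
    then show ?thesis using inside_subinterval[OF xyz(1,2) I] g(3) that by auto
  qed
  have zM: "z \<in> M" "q \<in> M" using xyz centre inM by auto
  \<comment> \<open>\<open>f\<close> follows \<open>h\<close> or \<open>k\<close> according to
    whether the geodesic from \<open>z\<close> to \<open>g t\<close> stays in \<open>B\<close>. The
    branch \<open>h\<close> is the lower one because \<open>d\<close> is at most
    \<open>d'\<close>.\<close>
  define f h k where "f = (\<lambda>t. (d' z (g t))^2 - t^2)" and "h = (\<lambda>t. (d z (g t))^2 - t^2)"
    and "k = (\<lambda>t. (d z q + d q (g t))^2 - t^2)"
  have "convex_on {0..D} f"
  proof (rule convex_on_selection[where h = h and k = k])
    have "continuous_on {0..D} (\<lambda>t. d' z (g t))"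
    proof (rule nonexpansive_imp_continuous_on)
      fix s t assume "s \<in> {0..D}" "t \<in> {0..D}"
      then show "\<bar>d' z (g s) - d' z (g t)\<bar> \<le> \<bar>s - t\<bar>"
        using gd'[of s t] gB E.triangle[of z "g s" "g t"] E.triangle[of z "g t" "g s"] xyz
          E.commute[of "g s" "g t"] by (simp add: abs_le_iff)
    qed
    then show "continuous_on {0..D} f" unfolding f_def by (intro continuous_intros)
    have gM: "g ` {0..D} \<subseteq> M" using gB by auto
    have c: "continuous_on {0..D} (\<lambda>t. d z (g t))" "continuous_on {0..D} (\<lambda>t. d q (g t))"
      by (rule continuous_on_dist_geodesic[OF _ gM g(3)]; use zM in simp)+
    show "continuous_on {0..D} h" "continuous_on {0..D} k"
      unfolding h_def k_def by (intro continuous_intros c)+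
    show "f t = h t \<or> f t = k t" if "t \<in> {0..D}" for t
      using inside[OF xyz(3) gB(1)[OF that]] detour[OF xyz(3) gB(1)[OF that]]
      unfolding f_def h_def k_def by auto
    show "h t \<le> f t" if "t \<in> {0..D}" for t
      using dist_le[OF xyz(3) gB(1)[OF that]] unfolding f_def h_def
      by (auto intro!: power_mono)
    show hc: "convex_on {0..D} h"
      unfolding h_def by (rule convex_on_dist_sq[OF zM(1) gM g(3)])
    \<comment> \<open>Expanding the square separates the convex function of
      \<open>convex_on_dist_sq\<close> from a nonnegative multiple of a convex distance.\<close>
    have "k = (\<lambda>t. ((d q (g t))^2 - t^2) + (2 * d z q * d q (g t) + (d z q)^2))"
      unfolding k_def by (auto simp: power2_eq_square algebra_simps)
    moreover have "convex_on {0..D} (\<lambda>t. ((d q (g t))^2 - t^2) + (2 * d z q * d q (g t) + (d z q)^2))"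
    proof (intro convex_on_add)
      show "convex_on {0..D} (\<lambda>t. (d q (g t))^2 - t^2)" by (rule convex_on_dist_sq[OF zM(2) gM g(3)])
      show "convex_on {0..D} (\<lambda>t. 2 * d z q * d q (g t))"
        by (rule convex_on_cmul[OF _ convex_on_dist[OF zM(2) gM g(3)]]) auto
      show "convex_on {0..D} (\<lambda>t. (d z q)^2)" unfolding convex_on_def by (simp add: distrib_right[symmetric])
    qed
    ultimately show "convex_on {0..D} k" by simp
  qed
  moreover obtain a where a: "a \<in> {0..D}" "m = g a" using m unfolding g(4)[symmetric] by blast
  define l where "l = a / D"
  have l: "0 \<le> l" "l \<le> 1" "l * D = a" using a D unfolding l_def by auto
  ultimately have "f ((1 - l) *\<^sub>R 0 + l *\<^sub>R D) \<le> (1 - l) * f 0 + l * f D"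
    using D by (intro convex_onD) auto
  then have "D * ((d' z m)^2 - a^2) \<le> D * ((1 - l) * (d' z x)^2 + l * ((d' z y)^2 - D^2))"
    using l D a g unfolding f_def by (intro mult_left_mono) auto
  also have "\<dots> = (D - l * D) * (d' z x)^2 + (l * D) * ((d' z y)^2 - D^2)"
    by (simp add: algebra_simps)
  finally have "D * (d' z m)^2 \<le> (D - a) * (d' z x)^2 + a * (d' z y)^2 - a * (D - a) * D"
    unfolding l by (simp add: algebra_simps power2_eq_square)
  moreover have "d x m = a" "d m y = D - a" using a D g(3)[of 0 a] g(3)[of a D] unfolding g(1,2) by auto
  ultimately show ?thesis unfolding D_def by simp
qed

lemma stewart_inside_ratio:
  assumes "x \<in> B" "y \<in> B" "z \<in> B" "I x y \<subseteq> B"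
    and m: "m \<in> M" "0 \<le> l" "l \<le> 1" "d x m = l * d x y" "d m y = (1 - l) * d x y"
  shows "(d' z m)^2 \<le> (1 - l) * (d' z x)^2 + l * (d' z y)^2 - l * (1 - l) * (d x y)^2"
proof (cases "d x y = 0")
  case True
  then have "x = y" "m = x" using m inM[OF assms(1)] inM[OF assms(2)] zero[of x y] zero[of x m] by auto
  then show ?thesis using True by (auto simp: algebra_simps)
next
  case False
  then have pos: "d x y > 0" using nonneg[of x y] by linarith
  have "m \<in> I x y" using m unfolding metric_interval_def by (auto simp: algebra_simps)
  from stewart_inside[OF assms(1-4) this]
  have "d x y * (d' z m)^2 \<le> d x y * ((1 - l) * (d' z x)^2 + l * (d' z y)^2 - l * (1 - l) * (d x y)^2)"
    unfolding m(4,5) by (simp add: algebra_simps power2_eq_square)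
  then show ?thesis using pos by simp
qed

text \<open>If the comparison angles at \<open>q\<close> towards \<open>z\<close> summed to less than \<open>\<pi>\<close>, then passing through a
  point of \<open>[q,z]\<close> very close to \<open>q\<close> would be shorter than passing through \<open>q\<close>.\<close>

lemma stewart_at_centre:
  assumes xyz: "x \<in> B" "y \<in> B" "z \<in> B" and xy: "d' x y = d q x + d q y"
    and pos: "d q x > 0" "d q y > 0"
  shows "d' x y * (d' z q)^2 \<le> d q y * (d' z x)^2 + d q x * (d' z y)^2 - d q x * d q y * d' x y"
proof (cases "d q z = 0")
  case True
  then have zq: "z = q" using zero[of q z] inM centre xyz by auto
  have "d' q q = 0" using centre by simp
  moreover have "d' q x = d q x" "d' q y = d q y" using dist_centre xyz by auto
  ultimately show ?thesis unfolding zq xy by (simp add: algebra_simps power2_eq_square)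
next
  case False
  define s a b where "s = d q z" and "a = d q x" and "b = d q y"
  have sp: "s > 0" "a > 0" "b > 0" using False pos nonneg[of q z] unfolding s_def a_def b_def by linarith+
  \<comment> \<open>Up to the factors \<open>2 * s * a\<close> and \<open>2 * s * b\<close> these
    are the cosines of the comparison angles at \<open>q\<close> for \<open>d'\<close>. The claim of
    the lemma is \<open>b * u + a * v \<le> 0\<close>, written out.\<close>
  define u v where "u = s^2 + a^2 - (d' z x)^2" and "v = s^2 + b^2 - (d' z y)^2"
  have "b * u + a * v \<le> 0"
  proof (rule ccontr)
    assume "\<not> b * u + a * v \<le> 0"
    then have k0: "b * u + a * v > 0" by simp
    \<comment> \<open>The sum of the two cosines, which is positive exactly if the two angles sum to
      less than pi.\<close>
    define \<kappa> where "\<kappa> = u / (2 * s * a) + v / (2 * s * b)"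
    have "\<kappa> = (b * u + a * v) / (2 * s * a * b)" using sp unfolding \<kappa>_def by (simp add: field_simps)
    then have kp: "\<kappa> > 0" using k0 sp by simp
    \<comment> \<open>The points \<open>x'\<close>, \<open>y'\<close> are taken at distance
      \<open>\<delta>\<close> from \<open>q\<close> and \<open>z'\<close> at distance
      \<open>\<eta>\<close>. Passing through \<open>z'\<close> instead of \<open>q\<close> gains
      \<open>\<eta> * \<kappa>\<close> to first order and loses at most
      \<open>\<eta>^2 / \<delta>\<close>; the bound on \<open>\<eta>\<close> makes the loss at most
      half of the gain.\<close>
    define \<delta> where "\<delta> = min a b"
    define \<eta> where "\<eta> = min s (\<kappa> * \<delta> / 2)"
    have dp: "\<delta> > 0" "\<delta> \<le> a" "\<delta> \<le> b" "\<eta> > 0" "\<eta> \<le> s" "\<eta> \<le> \<kappa> * \<delta> / 2"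
      using sp kp unfolding \<delta>_def \<eta>_def by auto
    have near: "\<exists>w\<in>B. d q w = r \<and> d w p = d q p - r" if p: "p \<in> B" "0 \<le> r" "r \<le> d q p" for p r
    proof -
      obtain w where w: "w \<in> M" "d q w = r" "d w p = d q p - r"
        using between[OF inM[OF centre] inM[OF p(1)] p(2,3)] by blast
      then have "w \<in> I p q"
        unfolding metric_interval_def by (simp add: commute[of p w] commute[of w q] commute[of p q])
      then show ?thesis using star[OF p(1)] w by blast
    qed
    obtain x' y' z' where x': "x' \<in> B" "d q x' = \<delta>" "d x' x = a - \<delta>"
      and y': "y' \<in> B" "d q y' = \<delta>" "d y' y = b - \<delta>"
      and z': "z' \<in> B" "d q z' = \<eta>" "d z' z = s - \<eta>"
      using near[OF xyz(1), of \<delta>] near[OF xyz(2), of \<delta>] near[OF xyz(3), of \<eta>] dp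
      unfolding a_def b_def s_def by auto
    have side: "d' z' p' \<le> \<delta> - \<eta> * (s^2 + (d q p)^2 - (d' z p)^2) / (2 * s * d q p) + \<eta>^2 / (2 * \<delta>)"
      if p: "p \<in> B" "p' \<in> B" "d q p' = \<delta>" "d p' p = d q p - \<delta>" "\<delta> \<le> d q p" for p p'
    proof -
      define c where "c = d q p"
      have cp: "c > 0" using p dp unfolding c_def by linarith
      define l k where "l = \<delta> / c" and "k = \<eta> / s"
      have lk: "0 \<le> l" "l \<le> 1" "0 \<le> k" "k \<le> 1" "l * c = \<delta>" "k * s = \<eta>"
        using dp sp cp p unfolding l_def k_def c_def by auto
      have st: "I q p \<subseteq> B" "I q z \<subseteq> B"
        using star[OF p(1)] star[OF xyz(3)] metric_interval_commute by auto
      \<comment> \<open>The argument of \<open>hinge_comparison\<close> with apex \<open>q\<close>.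
        Stewart's inequality for \<open>d'\<close> is available here because both sides of the hinge
        are radii from \<open>q\<close> and therefore stay in \<open>B\<close>.\<close>
      have 1: "(d' z p')^2 \<le> (1 - l) * (d' z q)^2 + l * (d' z p)^2 - l * (1 - l) * (d q p)^2"
        by (rule stewart_inside_ratio[OF centre p(1) xyz(3) st(1) inM[OF p(2)]])
          (use lk p in \<open>auto simp: c_def algebra_simps\<close>)
      have 2: "(d' p' z')^2 \<le> (1 - k) * (d' p' q)^2 + k * (d' p' z)^2 - k * (1 - k) * (d q z)^2"
        by (rule stewart_inside_ratio[OF centre xyz(3) p(2) st(2) inM[OF z'(1)]])
          (use lk z' in \<open>auto simp: s_def algebra_simps\<close>)
      have eq: "d' z q = s" "d' p' q = \<delta>" "d q p = c" "d q z = s" "d' p' z = d' z p'" "d' p' z' = d' z' p'"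
        using dist_centre[OF xyz(3)] dist_centre[OF p(2)] p(3) commute[of q] E.commute
        unfolding s_def c_def by auto
      have "k * (d' z p')^2 \<le> k * ((1 - l) * s^2 + l * (d' z p)^2 - l * (1 - l) * c^2)"
        using 1 lk unfolding eq by (intro mult_left_mono)
      then have "(d' z' p')^2 \<le> (1 - k) * (l * c)^2 + k * ((1 - l) * s^2 + l * (d' z p)^2 - l * (1 - l) * c^2) - k * (1 - k) * s^2"
        using 2 unfolding eq lk(5) by linarith
      also have "\<dots> = (l * c)^2 + (k * s)^2 - l * k * (s^2 + c^2 - (d' z p)^2)"
        by (simp add: algebra_simps power2_eq_square)
      finally have 3: "(d' z' p')^2 \<le> \<delta>^2 + \<eta>^2 - l * k * (s^2 + c^2 - (d' z p)^2)" unfolding lk .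
      define w where "w = \<eta>^2 - l * k * (s^2 + c^2 - (d' z p)^2)"
      have 4: "(d' z' p')^2 \<le> \<delta>^2 + w" using 3 unfolding w_def by simp
      \<comment> \<open>The square root is replaced by its tangent at \<open>\<delta>^2\<close>, in
        the form of the inequality of arithmetic and geometric means.\<close>
      have "(d' z' p')^2 + \<delta>^2 \<ge> 2 * \<delta> * d' z' p'"
        using sum_squares_bound[of \<delta> "d' z' p'"] by (simp add: mult.assoc)
      then have "2 * \<delta> * d' z' p' \<le> 2 * \<delta> * \<delta> + w" using 4 by (simp add: power2_eq_square)
      then have "d' z' p' \<le> \<delta> + w / (2 * \<delta>)" using dp by (simp add: field_simps)
      also have "l * k / (2 * \<delta>) = \<eta> / (2 * s * c)"
        using dp cp sp unfolding l_def k_def by simp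
      then have "w / (2 * \<delta>) = \<eta>^2 / (2 * \<delta>) - \<eta> * (s^2 + c^2 - (d' z p)^2) / (2 * s * c)"
        unfolding w_def diff_divide_distrib by (metis times_divide_eq_left)
      finally show ?thesis unfolding c_def by simp
    qed
    have sx: "d' z' x' \<le> \<delta> - \<eta> * u / (2 * s * a) + \<eta>^2 / (2 * \<delta>)"
      using side[OF xyz(1) x'(1)] x' dp unfolding u_def a_def by simp
    have sy: "d' z' y' \<le> \<delta> - \<eta> * v / (2 * s * b) + \<eta>^2 / (2 * \<delta>)"
      using side[OF xyz(2) y'(1)] y' dp unfolding v_def b_def by simp
    have rad: "d' p p' = d p' p"
      if "p \<in> B" "p' \<in> B" "d q p' + d p' p = d q p" for p p'
    proof -
      have "p' \<in> I p q"
        using that inM unfolding metric_interval_def by (simp add: commute[of p p'] commute[of p' q] commute[of p q])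
      then show ?thesis
        using inside_subinterval[OF that(1) centre star[OF that(1)]]
          endpoints_in_metric_interval[OF inM[OF that(1)] inM[OF centre]] commute by metis
    qed
    \<comment> \<open>The way from \<open>x\<close> over \<open>x'\<close>, \<open>z'\<close> and
      \<open>y'\<close> to \<open>y\<close> cannot be shorter than \<open>d' x y\<close>, which is
      the length of the way through \<open>q\<close>.\<close>
    have "d' x y \<le> d' x x' + d' x' y" "d' x' y \<le> d' x' y' + d' y' y" "d' x' y' \<le> d' x' z' + d' z' y'"
      using E.triangle xyz x' y' z' by auto
    moreover have "d' x x' = a - \<delta>" "d' y' y = b - \<delta>"
      using rad[OF xyz(1) x'(1)] rad[OF xyz(2) y'(1)] x' y' unfolding a_def b_def by (auto simp: E.commute)
    ultimately have "2 * \<delta> \<le> d' z' x' + d' z' y'" using xy E.commute[of x' z'] unfolding a_def b_def by linarith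
    also have "\<dots> \<le> 2 * \<delta> - \<eta> * \<kappa> + \<eta>^2 / \<delta>"
      using sx sy unfolding \<kappa>_def by (simp add: field_simps)
    finally have "\<eta> * \<kappa> \<le> \<eta> * (\<eta> / \<delta>)" by (simp add: power2_eq_square)
    then have "\<kappa> \<le> \<eta> / \<delta>" using dp(4) mult_le_cancel_left_pos by blast
    also have "\<dots> \<le> \<kappa> / 2" using dp by (simp add: field_simps)
    finally show False using kp by simp
  qed
  moreover have "d' z q = s" using dist_centre[OF xyz(3)] commute unfolding s_def by metis
  ultimately show ?thesis unfolding xy u_def v_def a_def[symmetric] b_def[symmetric]
    by (simp add: algebra_simps power2_eq_square)
qed

text \<open>A point between \<open>x\<close> and \<open>y\<close> for \<open>d'\<close> lies on one
  of the two radii that form the detour. This is clear if one of the halves makes a detour itself.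
  Otherwise move from \<open>m\<close> to \<open>y\<close>: the distance from \<open>x\<close> is
  the direct one at first and the one through \<open>q\<close> at the end. Where the two agree,
  \<open>m\<close> and \<open>q\<close> lie on one and the same geodesic of \<open>d\<close>, so
  their order on it decides.\<close>

lemma detour_through_centre:
  assumes xy: "x \<in> B" "y \<in> B" "\<not> I x y \<subseteq> B"
    and m: "m \<in> B" "d' x m + d' m y = d' x y"
  shows "d' x m + d' m q = d' x q \<or> d' q m + d' m y = d' q y"
proof -
  have dxy: "d' x y = d x q + d q y" using detour[OF xy] .
  note c = dist_centre[OF m(1)] dist_centre[OF xy(1)] dist_centre[OF xy(2)]
  show ?thesis
  proof (cases "I x m \<subseteq> B \<and> I m y \<subseteq> B")
    case False
    then have "d' x m = d x q + d q m \<or> d' m y = d m q + d q y"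
      using detour xy m by blast
    then show ?thesis using m dxy c commute[of m q] by auto
  next
    case True
    then have e: "d' x m = d x m" "d' m y = d m y" using inside xy m by auto
    define L where "L = d m y"
    obtain g where g: "g 0 = m" "g L = y" "\<And>s t. \<lbrakk>s \<in> {0..L}; t \<in> {0..L}\<rbrakk> \<Longrightarrow> d (g s) (g t) = \<bar>s - t\<bar>"
      "g ` {0..L} = I m y"
      using geodesic_exists[OF inM inM, OF m(1) xy(2)] unfolding L_def by metis
    have L: "0 \<le> L" unfolding L_def by simp
    have gB: "g t \<in> B" "g t \<in> M" if "t \<in> {0..L}" for t using that g(4) True inM by blast+
    have gd': "d' (g s) (g t) = \<bar>s - t\<bar>" if "s \<in> {0..L}" "t \<in> {0..L}" for s t
    proof -
      have "g s \<in> I m y" "g t \<in> I m y" using g(4) that by blast+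
      then show ?thesis using inside_subinterval[OF m(1) xy(2)] True g(3) that by auto
    qed
    \<comment> \<open>\<open>m\<close> is on a shortest way from \<open>x\<close> to
      \<open>y\<close> for \<open>d'\<close>, so beyond \<open>m\<close> the distance from
      \<open>x\<close> grows at unit rate.\<close>
    have dxg: "d' x (g t) = d' x m + t" if t: "t \<in> {0..L}" for t
    proof -
      have "d' m (g t) = t" "d' (g t) y = L - t"
        using gd'[of 0 t] gd'[of t L] t L unfolding g(1,2) by auto
      then show ?thesis
        using E.triangle[OF xy(1) m(1) gB(1)[OF t]] E.triangle[OF xy(1) gB(1)[OF t] xy(2)] m(2) e
        unfolding L_def by linarith
    qed
    have gM: "g ` {0..L} \<subseteq> M" using gB by auto
    note dc = continuous_on_dist_geodesic[OF _ gM g(3)]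
    obtain t where t: "t \<in> {0..L}" "d' x m + t = d x (g t)" "d' x m + t = d x q + d q (g t)"
    proof (rule switching_point[of 0 L "\<lambda>t. d' x m + t" "\<lambda>t. d x (g t)" "\<lambda>t. d x q + d q (g t)"])
      show "continuous_on {0..L} (\<lambda>t. d x (g t))" by (rule dc[OF inM[OF xy(1)]])
      show "continuous_on {0..L} (\<lambda>t. d x q + d q (g t))"
        by (rule continuous_on_add[OF continuous_on_const dc[OF inM[OF centre]]])
      show "d' x m + t = d x (g t) \<or> d' x m + t = d x q + d q (g t)" if t: "t \<in> {0..L}" for t
        using inside[OF xy(1) gB(1)[OF t]] detour[OF xy(1) gB(1)[OF t]] dxg[OF t] by auto
      show "d' x m + 0 = d x (g 0)" using e g by simp
      show "d' x m + L = d x q + d q (g L)" using g e m(2) dxy unfolding L_def by simp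
    qed (use L in \<open>auto intro: continuous_intros\<close>)
    have "d m (g t) = t" using g(3)[of 0 t] t L unfolding g(1) by auto
    then have mi: "m \<in> I x (g t)" "q \<in> I x (g t)"
      using t e inM m centre unfolding metric_interval_def by auto
    have "d m q = \<bar>d x m - d x q\<bar>"
      by (rule between_dist[OF inM[OF xy(1)] gB(2)[OF t(1)] mi])
    then show ?thesis using c e m(2) dxy commute[of m q] by (auto simp: abs_if split: if_splits)
  qed
qed

text \<open>For \<open>m\<close> on the radius from \<open>x\<close> to \<open>q\<close>, the cevian
  \<open>z m\<close> is also a cevian of the triangle \<open>x q z\<close>, whose side
  \<open>z q\<close> is bounded by \<open>stewart_at_centre\<close>. The first inequality times
  \<open>a + b\<close> and the second times \<open>s\<close> add up to Stewart's inequality for the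
  whole triangle, much as in Alexandrov's lemma.\<close>

lemma stewart_detour:
  assumes xyz: "x \<in> B" "y \<in> B" "z \<in> B" and I: "\<not> I x y \<subseteq> B"
    and m: "m \<in> B" "d' x m + d' m q = d' x q"
  shows "d' x y * (d' z m)^2 \<le> (d' m q + d' q y) * (d' z x)^2 + d' x m * (d' z y)^2
    - d' x m * (d' m q + d' q y) * d' x y"
proof -
  define a b s r where "a = d q x" and "b = d q y" and "s = d' x m" and "r = d' m q"
  have cx: "d' x q = a" "d x q = a" "d' q y = b" "d m q = r"
    using dist_centre[OF xyz(1)] dist_centre[OF xyz(2)] dist_centre[OF m(1)] commute[of q x]
    unfolding a_def b_def r_def by auto
  have dxy: "d' x y = a + b" using detour[OF xyz(1,2) I] cx unfolding b_def by simp
  \<comment> \<open>If \<open>x\<close> were \<open>q\<close>, the geodesic to \<open>y\<close>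
    would be a radius and would stay in \<open>B\<close>.\<close>
  have "x \<noteq> q" using star[OF xyz(2)] I metric_interval_commute by auto
  then have ap: "a > 0" using mdist_pos_less[of q x] centre xyz inM unfolding a_def by auto
  have "y \<noteq> q" using star[OF xyz(1)] I by auto
  then have bp: "b > 0" using mdist_pos_less[of q y] centre xyz inM unfolding b_def by auto
  have sr: "s + r = a" using m(2) cx unfolding s_def r_def by simp
  have "d x m \<le> s" "a \<le> d x m + r"
    using dist_le[OF xyz(1) m(1)] triangle[of x m q] inM xyz m centre cx unfolding s_def by auto
  then have dxm: "d x m = s" using sr by simp
  have 1: "a * (d' z m)^2 \<le> r * (d' z x)^2 + s * (d' z q)^2 - s * r * a"
    using stewart_inside[OF xyz(1) centre xyz(3) star[OF xyz(1)], of m] m inM cx dxm sr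
    unfolding metric_interval_def by auto
  have 2: "(a + b) * (d' z q)^2 \<le> b * (d' z x)^2 + a * (d' z y)^2 - a * b * (a + b)"
    using stewart_at_centre[OF xyz, folded a_def b_def] dxy ap bp by simp
  have s0: "0 \<le> s" unfolding s_def by simp
  have "a * ((a + b) * (d' z m)^2) = (a + b) * (a * (d' z m)^2)" by simp
  also have "\<dots> \<le> (a + b) * (r * (d' z x)^2 + s * (d' z q)^2 - s * r * a)"
    using 1 ap bp by (intro mult_left_mono) auto
  also have "\<dots> = (a + b) * (r * (d' z x)^2 - s * r * a) + s * ((a + b) * (d' z q)^2)"
    by (simp add: algebra_simps)
  also have "\<dots> \<le> (a + b) * (r * (d' z x)^2 - s * r * a) + s * (b * (d' z x)^2 + a * (d' z y)^2 - a * b * (a + b))"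
    using 2 s0 by (intro add_left_mono mult_left_mono) auto
  also have "\<dots> = a * ((r + b) * (d' z x)^2 + s * (d' z y)^2 - s * (r + b) * (a + b))"
    unfolding sr[symmetric] by (simp add: algebra_simps power2_eq_square)
  finally have "(a + b) * (d' z m)^2 \<le> (r + b) * (d' z x)^2 + s * (d' z y)^2 - s * (r + b) * (a + b)"
    using ap mult_le_cancel_left_pos by blast
  then show ?thesis unfolding dxy cx r_def s_def .
qed

theorem stewart_space_detour: "stewart_space B d'"
proof
  fix x y a assume xy: "x \<in> B" "y \<in> B" and a: "0 \<le> a" "a \<le> d' x y"
  have M: "x \<in> M" "y \<in> M" "q \<in> M" using xy centre inM by auto
  \<comment> \<open>Points at a given distance exist along every geodesic of \<open>d\<close> that
    stays in \<open>B\<close>. A detour consists of two such geodesics, and the value of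
    \<open>a\<close> tells which of the two to search.\<close>
  have radial: "\<exists>m\<in>B. d' u m = a \<and> d' m v = d' u v - a"
    if uv: "u \<in> B" "v \<in> B" "I u v \<subseteq> B" "0 \<le> a" "a \<le> d' u v" for u v a
  proof -
    have "d' u v = d u v" using inside uv by auto
    then obtain m where m: "m \<in> M" "d u m = a" "d m v = d u v - a" using between[of u v a] inM uv by auto
    then have mi: "m \<in> I u v" unfolding metric_interval_def by auto
    then have "d' u m = d u m" "d' m v = d m v"
      using inside_subinterval[OF that(1-3)] endpoints_in_metric_interval[OF inM inM, OF that(1,2)] by auto
    then show ?thesis using m mi that(3) \<open>d' u v = d u v\<close> by auto
  qed
  show "\<exists>m\<in>B. d' x m = a \<and> d' m y = d' x y - a"
  proof (cases "I x y \<subseteq> B")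
    case True
    then show ?thesis using radial xy a by blast
  next
    case False
    then have e: "d' x y = d' x q + d' q y" using detour xy dist_centre by auto
    show ?thesis
    proof (cases "a \<le> d' x q")
      case True
      then obtain m where m: "m \<in> B" "d' x m = a" "d' m q = d' x q - a"
        using radial[OF xy(1) centre star[OF xy(1)]] a by auto
      then have "d' m y = d' x y - a"
        using E.triangle[OF xy(1) m(1) xy(2)] E.triangle[OF m(1) centre xy(2)] e by auto
      then show ?thesis using m by blast
    next
      case False
      then obtain m where m: "m \<in> B" "d' q m = a - d' x q" "d' m y = d' q y - (a - d' x q)"
        using radial[OF centre xy(2), of "a - d' x q"] star[OF xy(2)] a e metric_interval_commute by auto
      then have "d' x m = a"
        using E.triangle[OF xy(1) m(1) xy(2)] E.triangle[OF xy(1) centre m(1)] e by auto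
      then show ?thesis using m e by auto
    qed
  qed
next
  fix x y z m
  assume xyz: "x \<in> B" "y \<in> B" "z \<in> B" and m: "m \<in> B" "d' x m + d' m y = d' x y"
  show "d' x y * (d' z m)^2 \<le> d' m y * (d' z x)^2 + d' x m * (d' z y)^2 - d' x m * d' m y * d' x y"
  proof (cases "I x y \<subseteq> B")
    case True
    have e: "d' x y = d x y" using inside xyz True by auto
    \<comment> \<open>Since \<open>d\<close> is at most \<open>d'\<close> and they agree on
      \<open>x\<close> and \<open>y\<close>, a point between \<open>x\<close> and \<open>y\<close>
      for \<open>d'\<close> is also between them for \<open>d\<close>.\<close>
    have "d x m \<le> d' x m" "d m y \<le> d' m y" "d x y \<le> d x m + d m y"
      using dist_le xyz m triangle inM by auto
    then have e': "d' x m = d x m" "d' m y = d m y" using m e by linarith+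
    then have "m \<in> I x y" using m e inM unfolding metric_interval_def by auto
    from stewart_inside[OF xyz True this] show ?thesis unfolding e e' .
  next
    case False
    then have e: "d' x y = d' x q + d' q y" using detour xyz dist_centre by auto
    have False': "\<not> I y x \<subseteq> B" using False metric_interval_commute by simp
    consider "d' x m + d' m q = d' x q" | "d' y m + d' m q = d' y q"
      using detour_through_centre[OF xyz(1,2) False m] by (auto simp: E.commute add.commute)
    then show ?thesis
    proof cases
      case 1
      then have "d' m y = d' m q + d' q y" using m e by simp
      then show ?thesis using stewart_detour[OF xyz False m(1) 1] by simp
    next
      case 2
      then have "d' x m = d' m q + d' q x" using m e by (simp add: E.commute)
      then show ?thesis using stewart_detour[OF xyz(2,1,3) False' m(1) 2]
        by (simp add: E.commute[of y] algebra_simps)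
    qed
  qed
qed

end

section \<open>Curve lengths\<close>

text \<open>The sums in \<open>curve_length\<close> as a recursion over the list of vertices, so
  that splitting and reversing a partition become list inductions.\<close>

fun polygonal_length :: "('a \<Rightarrow> 'a \<Rightarrow> real) \<Rightarrow> 'a list \<Rightarrow> ennreal" where
  "polygonal_length d (x # y # zs) = ennreal (d x y) + polygonal_length d (y # zs)"
| "polygonal_length d zs = 0"

lemma curve_length_eq_polygonal:
  "curve_length d g = (SUP ts\<in>{ts. sorted ts \<and> set ts \<subseteq> {0..1}}. polygonal_length d (map g ts))"
proof -
  have "(\<Sum>k<length ts - 1. ennreal (d (g (ts ! k)) (g (ts ! Suc k)))) = polygonal_length d (map g ts)" for ts
  proof (induction ts)
    case (Cons a ts)
    then show ?case
      by (cases ts) (auto simp: sum.lessThan_Suc_shift simp del: sum.lessThan_Suc)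
  qed simp
  then show ?thesis unfolding curve_length_def by simp
qed

lemma polygonal_length_le_curve_length:
  assumes "sorted ts" "set ts \<subseteq> {0..1}"
  shows "polygonal_length d (map g ts) \<le> curve_length d g"
  unfolding curve_length_eq_polygonal using assms by (intro SUP_upper) auto

lemma curve_length_leI:
  assumes "\<And>ts. \<lbrakk>sorted ts; set ts \<subseteq> {0..1}\<rbrakk> \<Longrightarrow> polygonal_length d (map g ts) \<le> L"
  shows "curve_length d g \<le> L"
  unfolding curve_length_eq_polygonal using assms by (intro SUP_least) auto

lemma polygonal_length_split:
  "polygonal_length d (xs @ c # ys) = polygonal_length d (xs @ [c]) + polygonal_length d (c # ys)"
proof (induction xs)
  case (Cons x xs)
  then show ?case by (cases xs) (auto simp: add.assoc)
qed simp

lemma polygonal_length_rev: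
  assumes "\<And>x y. d x y = d y x"
  shows "polygonal_length d (rev xs) = polygonal_length d xs"
proof (induction xs)
  case (Cons x xs)
  show ?case
  proof (cases xs)
    case (Cons y ys)
    have "polygonal_length d (rev (x # xs)) = polygonal_length d (rev ys @ y # [x])" using Cons by simp
    also have "\<dots> = polygonal_length d (rev xs) + ennreal (d y x)"
      using polygonal_length_split[of d "rev ys" y "[x]"] Cons by simp
    finally show ?thesis using Cons.IH Cons assms[of x y] by (simp add: add.commute)
  qed simp
qed simp

text \<open>The induced distance before \<open>enn2real\<close> sends infinity to 0. With extended
  values the triangle inequality holds unconditionally; finiteness is a separate matter, settled in
  \<open>induced_edist_finite\<close>.\<close>

definition induced_edist :: "'a set \<Rightarrow> ('a \<Rightarrow> 'a \<Rightarrow> real) \<Rightarrow> 'a set \<Rightarrow> 'a \<Rightarrow> 'a \<Rightarrow> ennreal" where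
  "induced_edist M d S x y = (INF g\<in>{g.
     pathin (subtopology (Metric_space.mtopology M d) S) g \<and> g 0 = x \<and> g 1 = y}. curve_length d g)"

lemma induced_length_dist_eq: "induced_length_dist M d S x y = enn2real (induced_edist M d S x y)"
  unfolding induced_length_dist_def induced_edist_def ..

context Metric_space
begin

text \<open>Serves for partitions that skip the junction of two joined paths: the junction may be
  inserted, since this can only lengthen the polygon.\<close>

lemma polygonal_length_append_le:
  assumes "set xs \<union> set ys \<subseteq> M" "c \<in> M"
  shows "polygonal_length d (xs @ ys) \<le> polygonal_length d (xs @ [c]) + polygonal_length d (c # ys)"
  using assms(1)
proof (induction xs)
  case Nil
  then show ?case by (cases ys) auto
next
  case (Cons x xs)
  show ?case
  proof (cases xs)
    case Nil
    show ?thesis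
    proof (cases ys)
      case (Cons y zs)
      have "ennreal (d x y) \<le> ennreal (d x c) + ennreal (d c y)"
        using triangle[of x c y] Cons.prems assms(2) Cons
        by (simp add: ennreal_plus[symmetric] del: ennreal_plus)
      then show ?thesis using Nil Cons by (simp add: add.assoc[symmetric] add_right_mono)
    qed (use Nil in auto)
  next
    case (Cons x' xs')
    then show ?thesis using Cons.IH Cons.prems by (simp add: add.assoc add_left_mono)
  qed
qed

lemma pathin_mtopology_iff:
  "pathin (subtopology mtopology S) g \<longleftrightarrow> (\<forall>t\<in>{0..1}. g t \<in> M \<inter> S) \<and>
     (\<forall>t\<in>{0..1}. \<forall>\<epsilon>>0. \<exists>\<delta>>0. \<forall>s\<in>{0..1}. \<bar>s - t\<bar> < \<delta> \<longrightarrow> d (g t) (g s) < \<epsilon>)"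
  (is "?L \<longleftrightarrow> ?R")
proof
  assume L: ?L
  then have c: "continuous_map (top_of_set {0..1}) mtopology g" and S: "g ` {0..1} \<subseteq> S"
    unfolding pathin_def continuous_map_in_subtopology by auto
  have M: "g ` {0..1} \<subseteq> M" using continuous_map_image_subset_topspace[OF c] by simp
  show ?R
  proof (intro conjI ballI allI impI)
    show "g t \<in> M \<inter> S" if "t \<in> {0..1}" for t using S M that by blast
    fix t \<epsilon> :: real assume t: "t \<in> {0..1}" and e: "\<epsilon> > 0"
    obtain U where U: "openin (top_of_set {0..1}) U" "t \<in> U" "\<forall>y\<in>U. g y \<in> mball (g t) \<epsilon>"
      using c[unfolded continuous_map_to_metric, rule_format, of t \<epsilon>] t e by auto
    then obtain \<delta> where "\<delta> > 0" "\<forall>x'\<in>{0..1}. dist x' t < \<delta> \<longrightarrow> x' \<in> U"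
      unfolding openin_euclidean_subtopology_iff by blast
    then show "\<exists>\<delta>>0. \<forall>s\<in>{0..1}. \<bar>s - t\<bar> < \<delta> \<longrightarrow> d (g t) (g s) < \<epsilon>"
      using U(3) by (intro exI[of _ \<delta>]) (auto simp: dist_real_def)
  qed
next
  assume R: ?R
  have "continuous_map (top_of_set {0..1}) mtopology g"
    unfolding continuous_map_to_metric
  proof (intro ballI allI impI)
    fix t \<epsilon> :: real assume t: "t \<in> topspace (top_of_set {0..1})" and e: "\<epsilon> > 0"
    then obtain \<delta> where \<delta>: "\<delta> > 0" "\<forall>s\<in>{0..1}. \<bar>s - t\<bar> < \<delta> \<longrightarrow> d (g t) (g s) < \<epsilon>"
      using conjunct2[OF R, rule_format, of t \<epsilon>] by auto
    show "\<exists>U. openin (top_of_set {0..1}) U \<and> t \<in> U \<and> (\<forall>y\<in>U. g y \<in> mball (g t) \<epsilon>)"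
    proof (intro exI conjI)
      show "openin (top_of_set {0..1}) ({0..1} \<inter> ball t \<delta>)" by (rule openin_open_Int) simp
      show "t \<in> {0..1} \<inter> ball t \<delta>" using t \<delta> by simp
      show "\<forall>y\<in>{0..1} \<inter> ball t \<delta>. g y \<in> mball (g t) \<epsilon>"
        using R t \<delta>(2) by (auto simp: dist_real_def abs_minus_commute)
    qed
  qed
  then show ?L unfolding pathin_def continuous_map_in_subtopology using R by auto
qed

lemma pathin_join:
  assumes "pathin X g" "pathin X h" "g 1 = h 0"
  shows "pathin X (\<lambda>t. if t \<le> 1/2 then g (2 * t) else h (2 * t - 1))"
proof -
  let ?I = "top_of_set {0..1::real}"
  have "continuous_map ?I X (\<lambda>t. if t \<le> 1/2 then (g \<circ> (*) 2) t else (h \<circ> (\<lambda>t. 2 * t - 1)) t)"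
  proof (intro continuous_map_cases_le continuous_map_compose, force, force)
    show "continuous_map (subtopology ?I {x \<in> topspace ?I. x \<le> 1/2}) ?I ((*) 2)"
      by (auto simp: continuous_map_in_subtopology continuous_map_from_subtopology)
    have "continuous_map (subtopology ?I {x. 0 \<le> x \<and> x \<le> 1 \<and> 1 \<le> x * 2}) euclideanreal (\<lambda>t. 2 * t - 1)"
      by (intro continuous_intros) (force intro: continuous_map_from_subtopology)
    then show "continuous_map (subtopology ?I {x \<in> topspace ?I. 1/2 \<le> x}) ?I (\<lambda>t. 2 * t - 1)"
      by (force simp: continuous_map_in_subtopology)
    show "(g \<circ> (*) 2) t = (h \<circ> (\<lambda>t. 2 * t - 1)) t" if "t = 1/2" for t unfolding that using assms(3) by simp
  qed (use assms in \<open>auto simp: pathin_def\<close>)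
  then show ?thesis unfolding pathin_def o_def .
qed

lemma curve_length_join_le:
  assumes gM: "g ` {0..1} \<subseteq> M" "h ` {0..1} \<subseteq> M" and gh: "g 1 = h 0"
  shows "curve_length d (\<lambda>t. if t \<le> 1/2 then g (2 * t) else h (2 * t - 1)) \<le> curve_length d g + curve_length d h"
    (is "curve_length d ?j \<le> _")
proof (rule curve_length_leI)
  fix ts :: "real list" assume ts: "sorted ts" "set ts \<subseteq> {0..1}"
  \<comment> \<open>A partition of the joined path is split at the time 1/2, and the two parts are
    rescaled to partitions for \<open>g\<close> and \<open>h\<close>.\<close>
  define us vs where "us = filter (\<lambda>t. t \<le> 1/2) ts" and "vs = filter (\<lambda>t. \<not> t \<le> 1/2) ts"
  define us' vs' where "us' = map (\<lambda>t. 2 * t) us" and "vs' = map (\<lambda>t. 2 * t - 1) vs"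
  have srt: "ts = us @ vs"
    using ts(1) unfolding us_def vs_def
  proof (induction ts)
    case (Cons a ts)
    show ?case
    proof (cases "a \<le> 1/2")
      case False
      then have "\<forall>t\<in>set ts. \<not> t \<le> 1/2" using Cons.prems by force
      then show ?thesis using False by (simp add: filter_False filter_True)
    qed (use Cons in simp)
  qed simp
  have uv: "set us \<subseteq> {0..1/2}" "set vs \<subseteq> {1/2..1}" "sorted us" "sorted vs"
    using ts unfolding us_def vs_def by (auto intro: sorted_filter[where f = id, simplified])
  have u: "map ?j us = map g us'" "set us' \<subseteq> {0..1}" "sorted us'"
    using uv unfolding us'_def us_def by (auto simp: sorted_map intro: sorted_wrt_mono_rel)
  have v: "map ?j vs = map h vs'" "set vs' \<subseteq> {0..1}" "sorted vs'"
    using uv unfolding vs'_def vs_def by (auto simp: sorted_map intro: sorted_wrt_mono_rel)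
  have "polygonal_length d (map ?j ts) = polygonal_length d (map g us' @ map h vs')"
    unfolding srt using u(1) v(1) by simp
  also have "\<dots> \<le> polygonal_length d (map g us' @ [g 1]) + polygonal_length d (g 1 # map h vs')"
  proof (intro polygonal_length_append_le)
    have "g ` set us' \<subseteq> M" "h ` set vs' \<subseteq> M" using gM u(2) v(2) by blast+
    then show "set (map g us') \<union> set (map h vs') \<subseteq> M" by simp
    show "g 1 \<in> M" using gM(1) by auto
  qed
  also have "\<dots> = polygonal_length d (map g (us' @ [1])) + polygonal_length d (map h (0 # vs'))"
    using gh by simp
  also have "\<dots> \<le> curve_length d g + curve_length d h"
    using u v by (intro add_mono polygonal_length_le_curve_length) (auto simp: sorted_append)
  finally show "polygonal_length d (map ?j ts) \<le> curve_length d g + curve_length d h" .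
qed

lemma pathin_subset:
  assumes "pathin (subtopology mtopology S) g"
  shows "g ` {0..1} \<subseteq> M \<inter> S"
  using assms unfolding pathin_mtopology_iff by blast

lemma induced_edist_le:
  "\<lbrakk>pathin (subtopology mtopology S) g; g 0 = x; g 1 = y\<rbrakk> \<Longrightarrow> induced_edist M d S x y \<le> curve_length d g"
  unfolding induced_edist_def by (intro INF_lower) auto

lemma induced_edist_triangle:
  "induced_edist M d S x z \<le> induced_edist M d S x y + induced_edist M d S y z"
proof -
  let ?P = "\<lambda>x y. {g. pathin (subtopology mtopology S) g \<and> g 0 = x \<and> g 1 = y}"
  have *: "induced_edist M d S x z \<le> curve_length d g + curve_length d h" if "g \<in> ?P x y" "h \<in> ?P y z" for g h
  proof -
    let ?j = "\<lambda>t. if t \<le> 1/2 then g (2 * t) else h (2 * t - 1)"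
    have "induced_edist M d S x z \<le> curve_length d ?j"
      by (intro induced_edist_le pathin_join) (use that in auto)
    also have "\<dots> \<le> curve_length d g + curve_length d h"
      using that pathin_subset by (intro curve_length_join_le) auto
    finally show ?thesis .
  qed
  show ?thesis
  proof (rule ennreal_le_epsilon)
    fix \<epsilon> :: real
    assume fin: "induced_edist M d S x y + induced_edist M d S y z < top" and "0 < \<epsilon>"
    have near: "\<exists>g\<in>?P u v. curve_length d g \<le> induced_edist M d S u v + ennreal (\<epsilon>/2)"
      if "induced_edist M d S u v < top" for u v
    proof -
      have "induced_edist M d S u v < induced_edist M d S u v + ennreal (\<epsilon>/2)"
        using that \<open>0 < \<epsilon>\<close> by (simp add: ennreal_add_left_cancel_less)
      then show ?thesis
        unfolding induced_edist_def[of M d S u v] INF_less_iff by (meson less_imp_le)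
    qed
    obtain g h where "g \<in> ?P x y" "h \<in> ?P y z"
      and le: "curve_length d g \<le> induced_edist M d S x y + ennreal (\<epsilon>/2)"
        "curve_length d h \<le> induced_edist M d S y z + ennreal (\<epsilon>/2)"
      using near[of x y] near[of y z] fin by (auto simp: ennreal_add_less_top)
    then have "induced_edist M d S x z \<le> curve_length d g + curve_length d h" using * by blast
    also have "\<dots> \<le> (induced_edist M d S x y + ennreal (\<epsilon>/2)) + (induced_edist M d S y z + ennreal (\<epsilon>/2))"
      by (intro add_mono le)
    also have "\<dots> = induced_edist M d S x y + induced_edist M d S y z + (ennreal (\<epsilon>/2) + ennreal (\<epsilon>/2))"
      by (simp add: ac_simps)
    also have "ennreal (\<epsilon>/2) + ennreal (\<epsilon>/2) = ennreal \<epsilon>"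
      using \<open>0 < \<epsilon>\<close> by (subst ennreal_plus[symmetric]) auto
    finally show "induced_edist M d S x z \<le> induced_edist M d S x y + induced_edist M d S y z + ennreal \<epsilon>" .
  qed
qed

lemma induced_edist_commute: "induced_edist M d S x y = induced_edist M d S y x"
proof -
  have "induced_edist M d S x y \<le> induced_edist M d S y x" for x y
    unfolding induced_edist_def[of M d S y x]
  proof (rule INF_greatest)
    fix g assume g: "g \<in> {g. pathin (subtopology mtopology S) g \<and> g 0 = y \<and> g 1 = x}"
    define h where "h = (\<lambda>t. g (1 - t))"
    have "pathin (subtopology mtopology S) h"
      unfolding pathin_mtopology_iff h_def
    proof (intro conjI ballI allI impI)
      show "g (1 - t) \<in> M \<inter> S" if "t \<in> {0..1}" for t
        using g that unfolding pathin_mtopology_iff by auto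
      fix t \<epsilon> :: real assume "t \<in> {0..1}" "\<epsilon> > 0"
      then obtain \<delta> where \<delta>: "\<delta> > 0" "\<forall>s\<in>{0..1}. \<bar>s - (1 - t)\<bar> < \<delta> \<longrightarrow> d (g (1 - t)) (g s) < \<epsilon>"
        using g unfolding pathin_mtopology_iff by force
      show "\<exists>\<delta>>0. \<forall>s\<in>{0..1}. \<bar>s - t\<bar> < \<delta> \<longrightarrow> d (g (1 - t)) (g (1 - s)) < \<epsilon>"
      proof (intro exI conjI ballI impI)
        fix s :: real assume "s \<in> {0..1}" "\<bar>s - t\<bar> < \<delta>"
        then show "d (g (1 - t)) (g (1 - s)) < \<epsilon>" using \<delta>(2)[rule_format, of "1 - s"] by auto
      qed (rule \<delta>(1))
    qed
    then have "induced_edist M d S x y \<le> curve_length d h"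
      by (rule induced_edist_le) (use g in \<open>auto simp: h_def\<close>)
    also have "\<dots> \<le> curve_length d g"
    proof (rule curve_length_leI)
      fix ts :: "real list" assume ts: "sorted ts" "set ts \<subseteq> {0..1}"
      have "map h ts = rev (map g (rev (map (\<lambda>t. 1 - t) ts)))"
        unfolding h_def by (simp add: rev_map o_def)
      then have "polygonal_length d (map h ts) = polygonal_length d (map g (rev (map (\<lambda>t. 1 - t) ts)))"
        by (simp only: polygonal_length_rev commute)
      also have "\<dots> \<le> curve_length d g"
        using ts by (intro polygonal_length_le_curve_length)
          (auto simp: sorted_wrt_rev sorted_wrt_map intro: sorted_wrt_mono_rel)
      finally show "polygonal_length d (map h ts) \<le> curve_length d g" .
    qed
    finally show "induced_edist M d S x y \<le> curve_length d g" .
  qed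
  then show ?thesis by (intro antisym)
qed

lemma dist_le_induced_edist: "ennreal (d x y) \<le> induced_edist M d S x y"
  unfolding induced_edist_def
proof (rule INF_greatest)
  fix g assume g: "g \<in> {g. pathin (subtopology mtopology S) g \<and> g 0 = x \<and> g 1 = y}"
  then show "ennreal (d x y) \<le> curve_length d g"
    using polygonal_length_le_curve_length[of "[0,1]" d g] by simp
qed

text \<open>Confines a path of bounded length to an ellipse with foci at its end points. This keeps
  the points of a short path within the range of the hypothesis \<open>corner\<close> of
  \<open>induced_edist_ge_detour\<close>.\<close>

lemma dist_via_le_curve_length:
  assumes "t \<in> {0..1}" "0 \<le> d (g 0) (g t)"
  shows "ennreal (d (g 0) (g t) + d (g t) (g 1)) \<le> curve_length d g"
  using polygonal_length_le_curve_length[of "[0,t,1]" d g] assms by simp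

lemma Lipschitz_polygonal_length:
  assumes "\<And>s t. \<lbrakk>s \<in> {0..1}; t \<in> {0..1}\<rbrakk> \<Longrightarrow> d (g s) (g t) \<le> C * \<bar>s - t\<bar>" "0 \<le> C"
    and "sorted (t # ts)" "set (t # ts) \<subseteq> {0..1}"
  shows "polygonal_length d (map g (t # ts)) \<le> ennreal (C * (last (t # ts) - t))"
  using assms(3,4)
proof (induction ts arbitrary: t)
  case (Cons u ts)
  have "t \<le> u" "u \<le> last (u # ts)" using Cons.prems by auto
  have "ennreal (d (g t) (g u)) \<le> ennreal (C * (u - t))"
    using assms(1)[of t u] Cons.prems by (intro ennreal_leI) auto
  then have "polygonal_length d (map g (t # u # ts)) \<le> ennreal (C * (u - t)) + ennreal (C * (last (u # ts) - u))"
    using Cons.IH[of u] Cons.prems by (auto intro: add_mono)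
  also have "\<dots> = ennreal (C * (u - t) + C * (last (u # ts) - u))"
    using assms(2) \<open>t \<le> u\<close> \<open>u \<le> last (u # ts)\<close> by (intro ennreal_plus[symmetric]) auto
  also have "\<dots> = ennreal (C * (last (t # u # ts) - t))" by (simp add: algebra_simps)
  finally show ?case .
qed simp

lemma induced_edist_Lipschitz:
  assumes lip: "\<And>s t. \<lbrakk>s \<in> {0..1}; t \<in> {0..1}\<rbrakk> \<Longrightarrow> d (g s) (g t) \<le> C * \<bar>s - t\<bar>" and "0 \<le> C"
    and "g ` {0..1} \<subseteq> M \<inter> S"
  shows "induced_edist M d S (g 0) (g 1) \<le> ennreal C"
proof -
  have "pathin (subtopology mtopology S) g"
    unfolding pathin_mtopology_iff
  proof (intro conjI ballI allI impI)
    fix t \<epsilon> :: real assume t: "t \<in> {0..1}" and e: "\<epsilon> > 0"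
    show "\<exists>\<delta>>0. \<forall>s\<in>{0..1}. \<bar>s - t\<bar> < \<delta> \<longrightarrow> d (g t) (g s) < \<epsilon>"
    proof (intro exI[of _ "\<epsilon> / (C + 1)"] conjI ballI impI)
      show "0 < \<epsilon> / (C + 1)" using e assms by auto
      fix s assume s: "s \<in> {0..1}" "\<bar>s - t\<bar> < \<epsilon> / (C + 1)"
      have "d (g t) (g s) \<le> C * \<bar>t - s\<bar>" using lip t s by blast
      also have "\<dots> \<le> (C + 1) * \<bar>s - t\<bar>" by (simp add: algebra_simps abs_minus_commute)
      also have "\<dots> < \<epsilon>" using s(2) assms by (simp add: field_simps)
      finally show "d (g t) (g s) < \<epsilon>" .
    qed
  qed (use assms in auto)
  then have "induced_edist M d S (g 0) (g 1) \<le> curve_length d g" by (rule induced_edist_le) auto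
  also have "\<dots> \<le> ennreal C"
  proof (rule curve_length_leI)
    fix ts :: "real list" assume ts: "sorted ts" "set ts \<subseteq> {0..1}"
    show "polygonal_length d (map g ts) \<le> ennreal C"
    proof (cases ts)
      case (Cons t us)
      have "polygonal_length d (map g ts) \<le> ennreal (C * (last (t # us) - t))"
        using Lipschitz_polygonal_length[OF lip \<open>0 \<le> C\<close>, where ts = us and t = t] ts Cons by auto
      also have "\<dots> \<le> ennreal C"
      proof (intro ennreal_leI)
        have "last (t # us) \<in> {0..1}" "0 \<le> t" using ts(2) Cons last_in_set[of "t # us"] by auto
        then have "C * (last (t # us) - t) \<le> C * 1" using \<open>0 \<le> C\<close> by (intro mult_left_mono) auto
        then show "C * (last (t # us) - t) \<le> C" by simp
      qed
      finally show ?thesis .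
    qed simp
  qed
  finally show ?thesis .
qed

lemma induced_edist_refl: assumes "x \<in> M \<inter> S" shows "induced_edist M d S x x = 0"
  using induced_edist_Lipschitz[of "\<lambda>_. x" 0 S] assms by (simp add: image_subset_iff)

lemma induced_edist_geodesic:
  assumes iso: "\<And>s t. \<lbrakk>s \<in> {a..b}; t \<in> {a..b}\<rbrakk> \<Longrightarrow> d (g s) (g t) = \<bar>s - t\<bar>"
    and "a \<le> b" "g ` {a..b} \<subseteq> M \<inter> S"
  shows "induced_edist M d S (g a) (g b) \<le> ennreal (b - a)"
proof -
  define h where "h = (\<lambda>t. g (a + (b - a) * t))"
  have mem: "a + (b - a) * t \<in> {a..b}" if "t \<in> {0..1}" for t
    using that assms(2) mult_left_mono[of t 1 "b - a"] by auto
  have "induced_edist M d S (h 0) (h 1) \<le> ennreal (b - a)"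
  proof (rule induced_edist_Lipschitz)
    fix s t :: real assume "s \<in> {0..1}" "t \<in> {0..1}"
    then have "d (h s) (h t) = \<bar>(a + (b - a) * s) - (a + (b - a) * t)\<bar>"
      unfolding h_def using iso[OF mem mem] by blast
    also have "(a + (b - a) * s) - (a + (b - a) * t) = (b - a) * (s - t)" by (simp add: algebra_simps)
    finally have "d (h s) (h t) = \<bar>(b - a) * (s - t)\<bar>" .
    then show "d (h s) (h t) \<le> (b - a) * \<bar>s - t\<bar>" using assms(2) by (simp add: abs_mult)
  qed (use assms mem in \<open>auto simp: h_def\<close>)
  then show ?thesis unfolding h_def by simp
qed

end

text \<open>Finiteness excludes the default value of \<open>enn2real\<close>, which would put points
  that no rectifiable path joins at distance 0.\<close>

lemma Metric_space_induced_length_dist: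
  assumes "Metric_space M d" "S \<subseteq> M"
    and fin: "\<And>x y. \<lbrakk>x \<in> S; y \<in> S\<rbrakk> \<Longrightarrow> induced_edist M d S x y < top"
  shows "Metric_space S (induced_length_dist M d S)"
proof -
  interpret Metric_space M d by fact
  show ?thesis
  proof
    show "0 \<le> induced_length_dist M d S x y" for x y unfolding induced_length_dist_eq by simp
    show "induced_length_dist M d S x y = induced_length_dist M d S y x" for x y
      unfolding induced_length_dist_eq using induced_edist_commute by simp
    show "(induced_length_dist M d S x y = 0) = (x = y)" if "x \<in> S" "y \<in> S" for x y
    proof
      assume "induced_length_dist M d S x y = 0"
      then have "induced_edist M d S x y = 0"
        using fin[OF that] unfolding induced_length_dist_eq by (auto simp: enn2real_eq_0_iff)
      then have "d x y = 0" using dist_le_induced_edist[of x y S] nonneg[of x y] by (simp add: order_antisym)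
      then show "x = y" using zero[of x y] that assms(2) by blast
    next
      assume "x = y"
      then show "induced_length_dist M d S x y = 0"
        using induced_edist_refl[of x S] that assms(2) unfolding induced_length_dist_eq by auto
    qed
    show "induced_length_dist M d S x z \<le> induced_length_dist M d S x y + induced_length_dist M d S y z"
      if "x \<in> S" "y \<in> S" "z \<in> S" for x y z
    proof -
      have "enn2real (induced_edist M d S x z) \<le> enn2real (induced_edist M d S x y + induced_edist M d S y z)"
        using fin that by (intro enn2real_mono induced_edist_triangle) (simp add: ennreal_add_less_top)
      then show ?thesis using fin that unfolding induced_length_dist_eq by (simp add: enn2real_plus)
    qed
  qed
qed

section \<open>The square with a free side\<close>

lemma cell_faceI:
  assumes "i \<in> cubes K" "cube_face (cube_dim K i) l F" "cube_face (cube_dim K i) m G" "F \<subseteq> G"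
  shows "cell_face K (chart K i ` F) (chart K i ` G)"
  using assms unfolding cell_face_def by blast

lemma edist_sq: "(edist n u v)^2 = (\<Sum>k<n. (u k - v k)^2)"
  unfolding edist_def L2_set_def by (simp add: sum_nonneg)

lemma edist_nonneg: "0 \<le> edist n u v"
  unfolding edist_def by (rule L2_set_nonneg)

lemma cube_face_refl: "cube_face n n (unit_cube n)"
  unfolding cube_face_def by (intro exI[of _ "{}"]) auto

lemma cube_face_subset: "cube_face n m F \<Longrightarrow> F \<subseteq> unit_cube n"
  unfolding cube_face_def by auto

lemma cube_face_proper:
  assumes "cube_face n m F" "F \<noteq> unit_cube n"
  obtains k c where "k < n" "c = 0 \<or> c = 1" "\<And>x. x \<in> F \<Longrightarrow> x k = c"
proof -
  obtain A B where AB: "A \<subseteq> {..<n}" "B \<subseteq> {..<n}" "F = {x \<in> unit_cube n. (\<forall>k\<in>A. x k = 0) \<and> (\<forall>k\<in>B. x k = 1)}"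
    using assms(1) unfolding cube_face_def by auto
  then have "A \<noteq> {} \<or> B \<noteq> {}" using assms(2) by auto
  then show ?thesis using AB that by blast
qed

text \<open>Two points that are far apart bound the dimension of a face from below. This matters
  because gluing maps are only known to preserve distances.\<close>

lemma cube_face_edist_le:
  assumes "cube_face n m F" "u \<in> F" "v \<in> F"
  shows "(edist n u v)^2 \<le> real m"
proof -
  obtain A B where AB: "A \<subseteq> {..<n}" "B \<subseteq> {..<n}" "m + card (A \<union> B) = n"
      "F = {x \<in> unit_cube n. (\<forall>k\<in>A. x k = 0) \<and> (\<forall>k\<in>B. x k = 1)}"
    using assms(1) unfolding cube_face_def by auto
  have "(edist n u v)^2 = (\<Sum>k\<in>{..<n} - (A \<union> B). (u k - v k)^2)"
    unfolding edist_sq using assms(2,3) AB(4) by (intro sum.mono_neutral_right) auto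
  also have "\<dots> \<le> (\<Sum>k\<in>{..<n} - (A \<union> B). 1)"
  proof (intro sum_mono)
    fix k assume "k \<in> {..<n} - (A \<union> B)"
    then have "\<bar>u k - v k\<bar> \<le> 1" using assms(2,3) AB(4) unfolding unit_cube_def by (force simp: abs_le_iff)
    then show "(u k - v k)^2 \<le> 1" by (simp add: abs_square_le_1)
  qed
  also have "\<dots> = real (card ({..<n} - (A \<union> B)))" by simp
  also have "card ({..<n} - (A \<union> B)) = m"
    using AB(1-3) card_Diff_subset[of "A \<union> B" "{..<n}"] finite_subset[of _ "{..<n}"] by auto
  finally show ?thesis .
qed

lemma cube_face_2_eq:
  assumes "cube_face n m F" "n \<le> 2" "2 \<le> m"
  shows "n = 2" "F = unit_cube 2"
proof -
  obtain A B where AB: "A \<subseteq> {..<n}" "B \<subseteq> {..<n}" "m + card (A \<union> B) = n"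
      "F = {x \<in> unit_cube n. (\<forall>k\<in>A. x k = 0) \<and> (\<forall>k\<in>B. x k = 1)}"
    using assms(1) unfolding cube_face_def by auto
  then show "n = 2" using assms by auto
  have "card (A \<union> B) = 0" using AB(3) assms by linarith
  moreover have "finite (A \<union> B)" using AB(1,2) finite_subset[of "A \<union> B" "{..<n}"] by auto
  ultimately have "A \<union> B = {}" by (simp only: card_0_eq)
  then have "A = {}" "B = {}" by auto
  then show "F = unit_cube 2" using AB(4) \<open>n = 2\<close> by auto
qed

lemma cube_face_side:
  assumes "k < 2" "c = 0 \<or> c = 1"
  shows "cube_face 2 1 {x \<in> unit_cube 2. x k = c}"
  unfolding cube_face_def
  by (intro exI[of _ "if c = 0 then {k} else {}"] exI[of _ "if c = 0 then {} else {k}"]) (use assms in auto)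

lemma dist_prod_sq: "(dist p q)^2 = (fst p - fst q)^2 + (snd p - snd q)^2" for p q :: "real \<times> real"
  by (simp add: dist_prod_def dist_real_def)

lemma nat_less_2_iff: "(k::nat) < 2 \<longleftrightarrow> k = 0 \<or> k = 1" by auto

abbreviation square :: "(real \<times> real) set" where "square \<equiv> {0..1} \<times> {0..1}"

text \<open>Coordinates of the unit square in which the side \<open>x\<^sub>k = c\<close> becomes the top side.\<close>

definition side_coords :: "nat \<Rightarrow> real \<Rightarrow> real \<times> real \<Rightarrow> nat \<Rightarrow> real" where
  "side_coords k c p = (\<lambda>j. if j = k then (if c = 1 then snd p else 1 - snd p) else if j < 2 then fst p else 0)"

context
  fixes k :: nat and c :: real
  assumes k: "k < 2" and c: "c = 0 \<or> c = 1"
begin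

lemma side_coords_image: "side_coords k c ` square = unit_cube 2"
proof
  show "side_coords k c ` square \<subseteq> unit_cube 2"
    using k unfolding side_coords_def unit_cube_def by auto
  show "unit_cube 2 \<subseteq> side_coords k c ` square"
  proof
    fix x :: "nat \<Rightarrow> real" assume x: "x \<in> unit_cube 2"
    define p where "p = (x (1 - k), if c = 1 then x k else 1 - x k)"
    have "1 - k < 2" by simp
    then have "p \<in> square" using x k unfolding p_def unit_cube_def by auto
    moreover have "x = side_coords k c p"
    proof
      fix j show "x j = side_coords k c p j"
        using x k nat_less_2_iff[of k] nat_less_2_iff[of j] unfolding side_coords_def p_def unit_cube_def by auto
    qed
    ultimately show "x \<in> side_coords k c ` square" by blast
  qed
qed

lemma side_coords_edist: "edist 2 (side_coords k c p) (side_coords k c q) = dist p q"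
proof -
  have "(edist 2 (side_coords k c p) (side_coords k c q))^2 = (dist p q)^2"
    using k nat_less_2_iff[of k] unfolding edist_sq dist_prod_sq side_coords_def
    by (auto simp: numeral_2_eq_2 power2_eq_square algebra_simps)
  then show ?thesis using edist_nonneg by (metis power2_eq_imp_eq zero_le_dist)
qed

lemma side_coords_k: "side_coords k c p k = c \<longleftrightarrow> snd p = 1"
  using c unfolding side_coords_def by auto

lemma side_coords_other: "\<lbrakk>j < 2; j \<noteq> k\<rbrakk> \<Longrightarrow> side_coords k c p j = fst p"
  unfolding side_coords_def by auto

lemma side_coords_boundary:
  "(\<exists>j<2. side_coords k c p j = 0 \<or> side_coords k c p j = 1) \<longleftrightarrow>
    fst p = 0 \<or> fst p = 1 \<or> snd p = 0 \<or> snd p = 1"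
proof -
  have ex: "(\<exists>j<2. P j) \<longleftrightarrow> P 0 \<or> P 1" for P :: "nat \<Rightarrow> bool" unfolding nat_less_2_iff by auto
  consider "k = 0" | "k = 1" using k nat_less_2_iff[of k] by blast
  then show ?thesis unfolding ex by cases (auto simp: side_coords_def)
qed

lemma side_coords_inj: "inj (side_coords k c)"
proof (rule injI)
  fix p q assume "side_coords k c p = side_coords k c q"
  then have "dist p q = edist 2 (side_coords k c p) (side_coords k c p)"
    using side_coords_edist[of p q] by simp
  then show "p = q" using side_coords_edist[of p p] by simp
qed

text \<open>A face fixes some coordinates at 0 or 1. As \<open>fst p\<close> is strictly between
  these values, only the coordinate \<open>k\<close> can be fixed, and \<open>0 < snd p\<close>
  rules out the bottom side. The two alternatives are thus the only faces that meet
  \<open>upper_square\<close>.\<close>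

lemma top_side_face_cases:
  assumes T: "cube_face 2 m T" and p: "side_coords k c p \<in> T" "0 < fst p" "fst p < 1" "0 < snd p"
  shows "T = unit_cube 2 \<or> T = {x \<in> unit_cube 2. x k = c}"
proof -
  obtain A B where AB: "A \<subseteq> {..<2}" "B \<subseteq> {..<2}" "A \<inter> B = {}"
      "T = {x \<in> unit_cube 2. (\<forall>k\<in>A. x k = 0) \<and> (\<forall>k\<in>B. x k = 1)}"
    using T unfolding cube_face_def by auto
  have in01: "\<forall>k\<in>A. side_coords k' c' p' k = 0" "\<forall>k\<in>B. side_coords k' c' p' k = 1"
    if "side_coords k' c' p' \<in> T" for k' c' p' using that AB(4) by auto
  have sub: "A \<union> B \<subseteq> {k}"
  proof
    fix j assume j: "j \<in> A \<union> B"
    then have "j < 2" using AB by auto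
    then show "j \<in> {k}" using in01[OF p(1)] j p side_coords_other[of j p] by force
  qed
  have "side_coords k c p k = c" if "k \<in> A \<union> B"
  proof -
    have "side_coords k c p k = 0 \<or> side_coords k c p k = 1" using that in01[OF p(1)] by auto
    then have "snd p = 1 \<or> snd p = 0" using c unfolding side_coords_def by auto
    then show ?thesis using p(4) side_coords_k by auto
  qed
  then have "k \<in> A \<Longrightarrow> c = 0" "k \<in> B \<Longrightarrow> c = 1" using in01[OF p(1)] by auto
  then consider "A = {}" "B = {}" | "A = {k}" "B = {}" "c = 0" | "A = {}" "B = {k}" "c = 1"
    using sub AB(3) by blast
  then show ?thesis using AB(4) by cases auto
qed

end

text \<open>The distance \<open>sqrt 2\<close> is the diameter of the square, and reaching it
  requires both coordinates to differ by 1.\<close>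

lemma dist_square_corner:
  fixes a b :: "real \<times> real"
  assumes "a \<in> square" "b \<in> square" "dist a b = sqrt 2"
  shows "(fst a = 0 \<or> fst a = 1) \<and> (snd a = 0 \<or> snd a = 1)"
proof -
  have "(fst a - fst b)^2 + (snd a - snd b)^2 = 2"
    using assms(3) unfolding dist_prod_def dist_real_def by simp
  moreover have b: "\<bar>fst a - fst b\<bar> \<le> 1" "\<bar>snd a - snd b\<bar> \<le> 1" using assms by (auto simp: mem_Times_iff abs_le_iff)
  then have "(fst a - fst b)^2 \<le> 1" "(snd a - snd b)^2 \<le> 1" by (auto simp: abs_square_le_1)
  ultimately have "(fst a - fst b)^2 = 1" "(snd a - snd b)^2 = 1" by auto
  then show ?thesis using assms(1,2) by (auto simp: power2_eq_1_iff mem_Times_iff)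
qed

text \<open>The boundary of the square is metrically determined: a side is the set of points between
  adjacent corners, and the corners are the points at distance \<open>sqrt 2\<close> from some other point.\<close>

lemma square_isometry_boundary:
  fixes h :: "real \<times> real \<Rightarrow> real \<times> real"
  assumes h: "h ` square = square" "\<And>p q. \<lbrakk>p \<in> square; q \<in> square\<rbrakk> \<Longrightarrow> dist (h p) (h q) = dist p q"
    and w: "w \<in> square" "fst (h w) = 0 \<or> fst (h w) = 1 \<or> snd (h w) = 0 \<or> snd (h w) = 1"
  shows "fst w = 0 \<or> fst w = 1 \<or> snd w = 0 \<or> snd w = 1"
proof (rule ccontr)
  assume int: "\<not> ?thesis"
  define r where "r = h w"
  have r: "r \<in> square" using h(1) w(1) unfolding r_def by blast
  then have r': "0 \<le> fst r" "fst r \<le> 1" "0 \<le> snd r" "snd r \<le> 1" by (auto simp: mem_Times_iff)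
  \<comment> \<open>\<open>a1\<close> and \<open>a2\<close> are the ends of the side that contains
    \<open>r\<close>. The diagonally opposite points \<open>b1\<close> and \<open>b2\<close> certify
    by distances alone that they are corners.\<close>
  have "\<exists>a1\<in>square. \<exists>a2\<in>square. \<exists>b1\<in>square. \<exists>b2\<in>square.
    dist a1 b1 = sqrt 2 \<and> dist a2 b2 = sqrt 2 \<and> dist a1 a2 = 1 \<and> dist a1 r + dist r a2 = 1"
  proof -
    consider "fst r = 0" | "fst r = 1" | "snd r = 0" | "snd r = 1" using w(2) unfolding r_def by blast
    then show ?thesis
    proof cases
      case 1
      then show ?thesis using r'
        by (intro bexI[of _ "(0,0)"] bexI[of _ "(0,1)"] bexI[of _ "(1,1)"] bexI[of _ "(1,0)"])
          (auto simp: dist_prod_def dist_real_def)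
    next
      case 2
      then show ?thesis using r'
        by (intro bexI[of _ "(1,0)"] bexI[of _ "(1,1)"] bexI[of _ "(0,1)"] bexI[of _ "(0,0)"])
          (auto simp: dist_prod_def dist_real_def)
    next
      case 3
      then show ?thesis using r'
        by (intro bexI[of _ "(0,0)"] bexI[of _ "(1,0)"] bexI[of _ "(1,1)"] bexI[of _ "(0,1)"])
          (auto simp: dist_prod_def dist_real_def)
    next
      case 4
      then show ?thesis using r'
        by (intro bexI[of _ "(0,1)"] bexI[of _ "(1,1)"] bexI[of _ "(1,0)"] bexI[of _ "(0,0)"])
          (auto simp: dist_prod_def dist_real_def)
    qed
  qed
  then obtain a1' a2' b1' b2' where ab': "a1' \<in> square" "a2' \<in> square" "b1' \<in> square" "b2' \<in> square"
    "dist a1' b1' = sqrt 2" "dist a2' b2' = sqrt 2" "dist a1' a2' = 1" "dist a1' r + dist r a2' = 1"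
    by (elim bexE conjE) (rule that)
  have surj: "\<exists>q\<in>square. p = h q" if "p \<in> square" for p
  proof -
    have "p \<in> h ` square" using that h(1) by simp
    then show ?thesis by (rule imageE) (rule bexI)
  qed
  obtain a1 where a1: "a1 \<in> square" "a1' = h a1" using surj[OF ab'(1)] by (rule bexE)
  obtain a2 where a2: "a2 \<in> square" "a2' = h a2" using surj[OF ab'(2)] by (rule bexE)
  obtain b1 where b1: "b1 \<in> square" "b1' = h b1" using surj[OF ab'(3)] by (rule bexE)
  obtain b2 where b2: "b2 \<in> square" "b2' = h b2" using surj[OF ab'(4)] by (rule bexE)
  note ab = a1(1) a2(1) b1(1) b2(1) and h' = a1(2) a2(2) b1(2) b2(2)
  have e: "dist a1 b1 = sqrt 2" "dist a2 b2 = sqrt 2" "dist a1 a2 = 1" "dist a1 w + dist w a2 = 1"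
    using ab'(5-8) h(2)[OF ab(1,3)] h(2)[OF ab(2,4)] h(2)[OF ab(1,2)] h(2)[OF ab(1) w(1)] h(2)[OF w(1) ab(2)]
    unfolding h' r_def by auto
  \<comment> \<open>From a point off the boundary each corner is strictly farther than either
    coordinate difference, so the distances to two adjacent corners sum to more than 1.\<close>
  have far_fst: "\<bar>snd a - snd w\<bar> < dist a w" if "fst a = 0 \<or> fst a = 1" for a
  proof -
    have "0 < (fst a - fst w)^2" using that int by auto
    then have "(snd a - snd w)^2 < (dist a w)^2" unfolding dist_prod_def dist_real_def by simp
    then show ?thesis using power2_less_imp_less[of "\<bar>snd a - snd w\<bar>" "dist a w"] by simp
  qed
  have far_snd: "\<bar>fst a - fst w\<bar> < dist a w" if "snd a = 0 \<or> snd a = 1" for a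
  proof -
    have "0 < (snd a - snd w)^2" using that int by auto
    then have "(fst a - fst w)^2 < (dist a w)^2" unfolding dist_prod_def dist_real_def by simp
    then show ?thesis using power2_less_imp_less[of "\<bar>fst a - fst w\<bar>" "dist a w"] by simp
  qed
  have c: "(fst a1 = 0 \<or> fst a1 = 1) \<and> (snd a1 = 0 \<or> snd a1 = 1)" "(fst a2 = 0 \<or> fst a2 = 1) \<and> (snd a2 = 0 \<or> snd a2 = 1)"
    using dist_square_corner[OF ab(1,3) e(1)] dist_square_corner[OF ab(2,4) e(2)] by auto
  have "(fst a1 - fst a2)^2 + (snd a1 - snd a2)^2 = 1"
    using e(3) unfolding dist_prod_def dist_real_def by simp
  then have "\<bar>fst a1 - fst a2\<bar> = 1 \<or> \<bar>snd a1 - snd a2\<bar> = 1"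
    using c by (auto simp: power2_eq_square)
  then show False
    using far_fst[of a1] far_fst[of a2] far_snd[of a1] far_snd[of a2] c e(4) dist_commute[of w a2] by linarith
qed

section \<open>Overlaps of a square with other cubes\<close>

definition gluing :: "('i, 'a) cube_gluing \<Rightarrow> 'i \<Rightarrow> 'i \<Rightarrow> (nat \<Rightarrow> real) set \<Rightarrow> (nat \<Rightarrow> real) set \<Rightarrow>
    ((nat \<Rightarrow> real) \<Rightarrow> nat \<Rightarrow> real) \<Rightarrow> bool" where
  "gluing K i j T T' h \<longleftrightarrow> (\<exists>m. cube_face (cube_dim K i) m T) \<and> (\<exists>m'. cube_face (cube_dim K j) m' T') \<and> h ` T = T' \<and>
     (\<forall>u\<in>T. \<forall>v\<in>T. edist (cube_dim K j) (h u) (h v) = edist (cube_dim K i) u v) \<and>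
     (\<forall>u\<in>cube_of K i. \<forall>v\<in>cube_of K j. chart K i u = chart K j v \<longleftrightarrow> u \<in> T \<and> v = h u)"

lemma cubical_complex_gluing:
  assumes "cubical_complex K" "i \<in> cubes K" "j \<in> cubes K"
    and "u \<in> cube_of K i" "v \<in> cube_of K j" "chart K i u = chart K j v"
  obtains T T' h where "gluing K i j T T' h"
proof -
  have "chart K i ` cube_of K i \<inter> chart K j ` cube_of K j \<noteq> {}" using assms by blast
  then show ?thesis using assms(1-3) that unfolding cubical_complex_def gluing_def by blast
qed

locale square_complex_chart =
  fixes K :: "('i, 'a) cube_gluing" and i
  assumes K: "square_complex K" and i: "i \<in> cubes K" "cube_dim K i = 2"
begin

lemma cubical: "cubical_complex K" and dim_le: "j \<in> cubes K \<Longrightarrow> cube_dim K j \<le> 2"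
  using K unfolding square_complex_def by auto

lemma chart_inj: "j \<in> cubes K \<Longrightarrow> inj_on (chart K j) (cube_of K j)"
  using cubical unfolding cubical_complex_def by blast

lemma cube_of_i: "cube_of K i = unit_cube 2" unfolding cube_of_def i ..

text \<open>The gluing map preserves the length \<open>sqrt 2\<close> of a diagonal, and no face of
  dimension less than 2 has room for it.\<close>

lemma gluing_whole:
  assumes j: "j \<in> cubes K" and g: "gluing K i j (unit_cube 2) T' h"
  shows "cube_dim K j = 2" "T' = unit_cube 2" "\<And>u. u \<in> unit_cube 2 \<Longrightarrow> h u \<in> unit_cube 2 \<and> chart K i u = chart K j (h u)"
proof -
  obtain m' where m': "cube_face (cube_dim K j) m' T'" using g unfolding gluing_def by blast
  define p q where "p = side_coords 0 1 (0,0)" and "q = side_coords 0 1 (1,1)"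
  have pq: "p \<in> unit_cube 2" "q \<in> unit_cube 2"
    unfolding p_def q_def using side_coords_image[of 0 1] by auto
  have "edist 2 p q = sqrt 2"
    unfolding p_def q_def using side_coords_edist[of 0 1] by (simp add: dist_prod_def)
  then have "(edist (cube_dim K j) (h p) (h q))^2 = 2" using g pq i(2) unfolding gluing_def by simp
  moreover have "h p \<in> T'" "h q \<in> T'" using g pq unfolding gluing_def by auto
  ultimately have "2 \<le> m'" using cube_face_edist_le[OF m'] by (metis of_nat_le_iff of_nat_numeral)
  then show d: "cube_dim K j = 2" and T: "T' = unit_cube 2"
    using cube_face_2_eq[OF m'] dim_le[OF j] by auto
  fix u assume u: "u \<in> unit_cube 2"
  then have "h u \<in> unit_cube 2" using g T unfolding gluing_def by auto
  then show "h u \<in> unit_cube 2 \<and> chart K i u = chart K j (h u)"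
    using g u d i(2) unfolding gluing_def cube_of_def by auto
qed

lemma covered_cube:
  assumes j: "j \<in> cubes K" and sub: "chart K i ` unit_cube 2 \<subseteq> chart K j ` cube_of K j"
  obtains h where "gluing K i j (unit_cube 2) (unit_cube 2) h"
proof -
  have "side_coords 0 1 (0,0) \<in> side_coords 0 1 ` square" by (rule imageI) simp
  then obtain u where u: "u \<in> unit_cube 2" using side_coords_image[of 0 1] by auto
  then obtain v where "v \<in> cube_of K j" "chart K i u = chart K j v" using sub by blast
  then obtain T T' h where g: "gluing K i j T T' h"
    using cubical_complex_gluing[OF cubical i(1) j, of u v] u cube_of_i by auto
  have "unit_cube 2 \<subseteq> T"
  proof
    fix u assume u: "u \<in> unit_cube 2"
    then obtain v where "v \<in> cube_of K j" "chart K i u = chart K j v" using sub by blast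
    then show "u \<in> T" using g u cube_of_i unfolding gluing_def by auto
  qed
  moreover have "T \<subseteq> unit_cube 2" using g cube_face_subset i(2) unfolding gluing_def by metis
  ultimately have T: "T = unit_cube 2" by blast
  show ?thesis using that g gluing_whole[OF j] unfolding T by metis
qed

text \<open>The same cell may be presented by several cubes of \<open>K\<close>. A 2-cell is always
  presented by a whole square, and any two presentations differ by an isometry of squares.\<close>

lemma covering_face:
  assumes j: "j \<in> cubes K" and G: "cube_face (cube_dim K j) m G" and eq: "chart K i ` unit_cube 2 = chart K j ` G"
  obtains h where "gluing K i j (unit_cube 2) (unit_cube 2) h" "G = unit_cube 2" "cube_dim K j = 2"
proof -
  have Gs: "G \<subseteq> cube_of K j" using cube_face_subset[OF G] unfolding cube_of_def .
  then obtain h where h: "gluing K i j (unit_cube 2) (unit_cube 2) h" using covered_cube[OF j] eq by blast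
  have d: "cube_dim K j = 2" by (rule gluing_whole(1)[OF j h])
  have "chart K j ` unit_cube 2 = chart K i ` unit_cube 2"
  proof -
    have "h ` unit_cube 2 = unit_cube 2" using h unfolding gluing_def by blast
    then have "chart K j ` unit_cube 2 = (\<lambda>u. chart K j (h u)) ` unit_cube 2" by (metis image_image)
    also have "\<dots> = chart K i ` unit_cube 2" using gluing_whole(3)[OF j h] by (intro image_cong) auto
    finally show ?thesis .
  qed
  then have "chart K j ` G = chart K j ` unit_cube 2" using eq by simp
  then have "G = unit_cube 2"
    using inj_on_image_eq_iff[OF chart_inj[OF j] Gs, of "unit_cube 2"] d unfolding cube_of_def by simp
  then show ?thesis using that h d by blast
qed

end

text \<open>The cubes that exhibit \<open>\<sigma>\<close> as a 2-cell, \<open>e\<close> as a 1-cell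
  and \<open>e\<close> as a face of \<open>\<sigma>\<close> may all be different. In the last of
  them \<open>e\<close> must be recognised as a side: it is not the whole square because
  \<open>e \<noteq> \<sigma>\<close>, and not a vertex because a 1-cell has two points.\<close>

lemma square_free_face_chart:
  fixes K :: "('i, 'a) cube_gluing"
  assumes K: "square_complex K" and s: "is_cell K 2 \<sigma>" and e: "is_cell K 1 e" and f: "cell_face K e \<sigma>" "e \<noteq> \<sigma>"
  obtains i k c where "i \<in> cubes K" "cube_dim K i = 2" "\<sigma> = chart K i ` unit_cube 2" "k < 2" "c = 0 \<or> c = 1"
    "e = chart K i ` {x \<in> unit_cube 2. x k = c}"
proof -
  obtain i0 F0 where i0: "i0 \<in> cubes K" "cube_face (cube_dim K i0) 2 F0" "\<sigma> = chart K i0 ` F0"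
    using s unfolding is_cell_def by auto
  have "cube_dim K i0 \<le> 2" using K i0 unfolding square_complex_def by auto
  then have d0: "cube_dim K i0 = 2" "F0 = unit_cube 2" using cube_face_2_eq[OF i0(2)] by auto
  interpret I0: square_complex_chart K i0 by unfold_locales (use K i0 d0 in auto)
  obtain i l m F G where i: "i \<in> cubes K" "cube_face (cube_dim K i) l F" "cube_face (cube_dim K i) m G"
    "F \<subseteq> G" "e = chart K i ` F" "\<sigma> = chart K i ` G"
    using f(1) unfolding cell_face_def by auto
  obtain h where G: "G = unit_cube 2" "cube_dim K i = 2"
    using I0.covering_face[OF i(1,3)] i0(3) i(6) d0(2) by metis
  obtain A B where AB: "A \<subseteq> {..<2}" "B \<subseteq> {..<2}" "A \<inter> B = {}"
      "F = {x \<in> unit_cube 2. (\<forall>k\<in>A. x k = 0) \<and> (\<forall>k\<in>B. x k = 1)}"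
    using i(2) G(2) unfolding cube_face_def by auto
  have "A \<noteq> {} \<or> B \<noteq> {}" using AB(4) f(2) i(5,6) G by auto
  moreover have "A \<union> B \<noteq> {0,1}"
  proof
    assume AB01: "A \<union> B = {0,1}"
    have one: "x = y" if "x \<in> F" "y \<in> F" for x y
    proof
      fix k show "x k = y k"
      proof (cases "k < 2")
        case True
        then have "k \<in> A \<union> B" using AB01 nat_less_2_iff[of k] by auto
        then show ?thesis using that AB(4) by auto
      next
        case False
        then show ?thesis using that AB(4) unfolding unit_cube_def by auto
      qed
    qed
    obtain i1 F1 where i1: "i1 \<in> cubes K" "cube_face (cube_dim K i1) 1 F1" "e = chart K i1 ` F1"
      using e unfolding is_cell_def by auto
    obtain A' B' where AB': "A' \<subseteq> {..<cube_dim K i1}" "B' \<subseteq> {..<cube_dim K i1}" "A' \<inter> B' = {}" "1 + card (A' \<union> B') = cube_dim K i1"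
        "F1 = {x \<in> unit_cube (cube_dim K i1). (\<forall>k\<in>A'. x k = 0) \<and> (\<forall>k\<in>B'. x k = 1)}"
      using i1(2) unfolding cube_face_def by auto
    have "A' \<union> B' \<noteq> {..<cube_dim K i1}" using AB'(4) by (metis card_lessThan n_not_Suc_n plus_1_eq_Suc)
    then obtain k where k: "k < cube_dim K i1" "k \<notin> A' \<union> B'" using AB'(1,2) by blast
    \<comment> \<open>Two distinct points of \<open>e\<close>: the coordinate \<open>k\<close>,
      which the 1-dimensional face leaves free, takes the values 0 and 1.\<close>
    define x where "x = (\<lambda>j. if j \<in> B' then 1 else 0 :: real)"
    have x: "x \<in> F1" "x(k := 1) \<in> F1"
      using AB' k unfolding x_def unit_cube_def by auto
    have "x \<noteq> x(k := 1)" using k unfolding x_def by (auto simp: fun_eq_iff)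
    moreover have "F1 \<subseteq> cube_of K i1" using cube_face_subset[OF i1(2)] unfolding cube_of_def .
    ultimately have ne: "chart K i1 x \<noteq> chart K i1 (x(k := 1))"
      using x I0.chart_inj[OF i1(1)] by (meson inj_onD subsetD)
    have "chart K i1 x \<in> chart K i ` F" "chart K i1 (x(k := 1)) \<in> chart K i ` F"
      unfolding i(5)[symmetric] i1(3) using x by (auto intro: imageI)
    then obtain a b where "a \<in> F" "chart K i1 x = chart K i a" "b \<in> F" "chart K i1 (x(k := 1)) = chart K i b"
      by (elim imageE) (rule that)
    then show False using ne one[of a b] by simp
  qed
  moreover have "A \<union> B \<subseteq> {0,1}" using AB(1,2) by auto
  then have "A \<union> B = {} \<or> A \<union> B = {0} \<or> A \<union> B = {1} \<or> A \<union> B = {0,1}" by blast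
  ultimately have "A \<union> B = {0} \<or> A \<union> B = {1}" by blast
  then obtain k where AB_k: "A \<union> B = {k}" and k2: "k < 2" using zero_less_numeral one_less_numeral_iff by (metis semiring_norm(76))
  have k: "A = {k} \<and> B = {} \<or> A = {} \<and> B = {k}" "k < 2"
  proof -
    have "A \<subseteq> {k}" "B \<subseteq> {k}" using AB_k by auto
    then have "A = {} \<or> A = {k}" "B = {} \<or> B = {k}" by (simp_all only: subset_singleton_iff)
    then show "A = {k} \<and> B = {} \<or> A = {} \<and> B = {k}" using AB(3) AB_k by auto
  qed (rule k2)
  then have "F = {x \<in> unit_cube 2. x k = (if B = {} then 0 else 1)}" using AB(4) by auto
  then show ?thesis using that[of i k "if B = {} then 0 else 1"] i G k(2) by auto
qed

text \<open>The part of the square that the collapse removes: the open 2-cell together with the open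
  free side, which is placed on top.\<close>

definition upper_square :: "(real \<times> real) set" where "upper_square = {0<..<1} \<times> {0<..1}"

text \<open>All that the metric arguments use about the position of the square in \<open>K\<close>.
  The condition \<open>open_star\<close> expresses that the top side is free: a cube that meets the
  removed part has no point outside the square.\<close>

locale square_chart =
  fixes K :: "('i, 'a) cube_gluing" and \<Phi> :: "real \<times> real \<Rightarrow> 'a"
  assumes inj: "inj_on \<Phi> square"
    and in_cube: "\<exists>i\<in>cubes K. \<forall>a\<in>square. \<Phi> a \<in> chart K i ` cube_of K i"
    and isometric: "\<And>j u v a b. \<lbrakk>j \<in> cubes K; u \<in> cube_of K j; v \<in> cube_of K j; a \<in> square; b \<in> square;
       chart K j u = \<Phi> a; chart K j v = \<Phi> b\<rbrakk> \<Longrightarrow> edist (cube_dim K j) u v = dist a b"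
    and open_star: "\<And>j. \<lbrakk>j \<in> cubes K; chart K j ` cube_of K j \<inter> \<Phi> ` upper_square \<noteq> {}\<rbrakk> \<Longrightarrow>
       chart K j ` cube_of K j \<subseteq> \<Phi> ` square"

lemma free_face_square_chart:
  fixes K :: "('i, 'a) cube_gluing"
  assumes K: "square_complex K" and s: "is_cell K 2 \<sigma>" and e: "is_cell K 1 e" and f: "free_face K e \<sigma>"
  obtains \<Phi> where "square_chart K \<Phi>" "collapse K e \<sigma> = realization K - \<Phi> ` upper_square"
proof -
  have cf: "cell_face K e \<sigma>" "e \<noteq> \<sigma>"
    and free: "\<And>c. \<lbrakk>c \<in> cells K; cell_face K e c\<rbrakk> \<Longrightarrow> c = \<sigma> \<or> c = e"
    using f unfolding free_face_def by auto
  obtain i k c where i: "i \<in> cubes K" "cube_dim K i = 2" and sig: "\<sigma> = chart K i ` unit_cube 2" and k: "k < 2" and c: "c = 0 \<or> c = 1"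
    and ee: "e = chart K i ` {x \<in> unit_cube 2. x k = c}"
    by (rule square_free_face_chart[OF K s e cf])
  interpret square_complex_chart K i by unfold_locales (use K i in auto)
  define \<psi> where "\<psi> = side_coords k c"
  note psi = side_coords_image[OF k c, folded \<psi>_def] side_coords_edist[OF k c, folded \<psi>_def]
    side_coords_k[OF k c, folded \<psi>_def] side_coords_boundary[OF k c, folded \<psi>_def]
    side_coords_inj[OF k c, folded \<psi>_def]
  have psi_mem: "\<psi> a \<in> unit_cube 2" if "a \<in> square" for a using psi(1) that by blast
  define \<Phi> where "\<Phi> = (\<lambda>p. chart K i (\<psi> p))"
  have sq: "\<Phi> ` square = \<sigma>" unfolding sig \<Phi>_def psi(1)[symmetric] by (simp add: image_image)
  have top: "{x \<in> unit_cube 2. x k = c} = \<psi> ` ({0..1} \<times> {1})"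
  proof
    show "\<psi> ` ({0..1} \<times> {1}) \<subseteq> {x \<in> unit_cube 2. x k = c}"
      using psi_mem psi(3) by force
    show "{x \<in> unit_cube 2. x k = c} \<subseteq> \<psi> ` ({0..1} \<times> {1})"
    proof
      fix x assume x: "x \<in> {x \<in> unit_cube 2. x k = c}"
      then obtain p where p: "p \<in> square" "x = \<psi> p" using psi(1) by blast
      then have "snd p = 1" using x psi(3) by auto
      then show "x \<in> \<psi> ` ({0..1} \<times> {1})" using p by (auto simp: mem_Times_iff)
    qed
  qed
  have ePhi: "e = \<Phi> ` ({0..1} \<times> {1})" unfolding ee top \<Phi>_def by (simp add: image_image)
  have inj: "inj_on \<Phi> square"
  proof (rule inj_onI)
    fix a b assume ab: "a \<in> square" "b \<in> square" "\<Phi> a = \<Phi> b"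
    then have "\<psi> a = \<psi> b" using chart_inj[OF i(1)] psi_mem cube_of_i unfolding \<Phi>_def by (metis inj_onD)
    then show "a = b" using psi(5) by (metis injD)
  qed
  have glue: "\<exists>T T' h. gluing K i j T T' h \<and> \<psi> a \<in> T \<and> u = h (\<psi> a)"
    if ju: "j \<in> cubes K" "u \<in> cube_of K j" "a \<in> square" "chart K j u = \<Phi> a" for j u a
  proof -
    obtain T T' h where g: "gluing K i j T T' h"
      using cubical_complex_gluing[OF cubical i(1) ju(1), of "\<psi> a" u] ju psi_mem cube_of_i unfolding \<Phi>_def by metis
    then have "chart K i (\<psi> a) = chart K j u \<longleftrightarrow> \<psi> a \<in> T \<and> u = h (\<psi> a)"
      using that psi_mem cube_of_i unfolding gluing_def by blast
    then show ?thesis using g that(4) unfolding \<Phi>_def by metis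
  qed
  have P2: "edist (cube_dim K j) u v = dist a b"
    if ju: "j \<in> cubes K" "u \<in> cube_of K j" "v \<in> cube_of K j" "a \<in> square" "b \<in> square"
      "chart K j u = \<Phi> a" "chart K j v = \<Phi> b" for j u v a b
  proof -
    obtain T T' h where g: "gluing K i j T T' h" "\<psi> a \<in> T" "u = h (\<psi> a)" using glue[OF ju(1,2,4,6)] by (elim exE conjE) (rule that)
    have "chart K i (\<psi> b) = chart K j v \<longleftrightarrow> \<psi> b \<in> T \<and> v = h (\<psi> b)"
      using g(1) that(3) psi_mem[OF that(5)] cube_of_i unfolding gluing_def by blast
    then have "\<psi> b \<in> T" "v = h (\<psi> b)" using that(7) unfolding \<Phi>_def by auto
    then have "edist (cube_dim K j) u v = edist 2 (\<psi> a) (\<psi> b)" using g i(2) unfolding gluing_def by auto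
    then show ?thesis using psi(2) by simp
  qed
  have P3: "chart K j ` cube_of K j \<subseteq> \<Phi> ` square"
    if j: "j \<in> cubes K" and meet: "chart K j ` cube_of K j \<inter> \<Phi> ` upper_square \<noteq> {}" for j
  proof -
    obtain y where y: "y \<in> chart K j ` cube_of K j" "y \<in> \<Phi> ` upper_square" using meet by blast
    obtain u where u: "y = chart K j u" "u \<in> cube_of K j" using y(1) by (rule imageE)
    obtain a0 where a0: "y = \<Phi> a0" "a0 \<in> upper_square" using y(2) by (rule imageE)
    obtain a where a: "a \<in> upper_square" "u \<in> cube_of K j" "chart K j u = \<Phi> a" using a0 u by simp
    have asq: "a \<in> square" using a(1) unfolding upper_square_def by auto
    obtain T T' h where g: "gluing K i j T T' h" "\<psi> a \<in> T" using glue[OF j a(2) asq a(3)] by (elim exE conjE) (rule that)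
    obtain m m' where T: "cube_face 2 m T" and T': "cube_face (cube_dim K j) m' T'" using g(1) i(2) unfolding gluing_def by auto
    have hT: "chart K j ` T' = chart K i ` T"
    proof -
      have "chart K j (h u) = chart K i u" if "u \<in> T" for u
      proof -
        have "u \<in> cube_of K i" using that cube_face_subset[OF T] cube_of_i by blast
        moreover have "h u \<in> cube_of K j" using that g(1) cube_face_subset[OF T'] unfolding gluing_def cube_of_def by blast
        ultimately show ?thesis using g(1) that unfolding gluing_def by metis
      qed
      moreover have "T' = h ` T" using g(1) unfolding gluing_def by blast
      ultimately show ?thesis by (auto simp: image_image)
    qed
    \<comment> \<open>The cube \<open>j\<close> is glued along a face that meets
      \<open>upper_square\<close>. If this face is the whole square, then so is the cube; if it is
      the top side, then \<open>e\<close> is a face of the cube and freeness applies.\<close>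
    have "T = unit_cube 2 \<or> T = {x \<in> unit_cube 2. x k = c}"
      using top_side_face_cases[OF k c T, of a] g(2) a(1) unfolding \<psi>_def upper_square_def by auto
    then show ?thesis
    proof
      assume T2: "T = unit_cube 2"
      then have "T' = unit_cube 2" "cube_dim K j = 2" using gluing_whole[OF j] g(1) by auto
      then show ?thesis using hT T2 sq sig unfolding cube_of_def by simp
    next
      assume "T = {x \<in> unit_cube 2. x k = c}"
      then have "e = chart K j ` T'" using hT ee by simp
      then have "cell_face K e (chart K j ` cube_of K j)"
        unfolding cube_of_def using cell_faceI[OF j T' cube_face_refl cube_face_subset[OF T']] by simp
      moreover have "chart K j ` cube_of K j \<in> cells K"
        unfolding cells_def is_cell_def cube_of_def using j cube_face_refl by blast
      ultimately have "chart K j ` cube_of K j = \<sigma> \<or> chart K j ` cube_of K j = e" using free by blast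
      moreover have "e \<subseteq> \<Phi> ` square" unfolding ePhi by (intro image_mono) auto
      ultimately show ?thesis unfolding sq by auto
    qed
  qed
  have osig: "open_cell K \<sigma> = \<Phi> ` ({0<..<1} \<times> {0<..<1})"
  proof
    show "open_cell K \<sigma> \<subseteq> \<Phi> ` ({0<..<1} \<times> {0<..<1})"
    proof
      fix x assume x: "x \<in> open_cell K \<sigma>"
      then have "x \<in> \<Phi> ` square" unfolding sq open_cell_def by simp
      then obtain a where a: "x = \<Phi> a" "a \<in> square" by (rule imageE)
      have "\<not> (\<exists>j<2. \<psi> a j = 0 \<or> \<psi> a j = 1)"
      proof
        assume "\<exists>j<2. \<psi> a j = 0 \<or> \<psi> a j = 1"
        then obtain j where j: "j < 2" "\<psi> a j = 0 \<or> \<psi> a j = 1" by blast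
        define r where "r = \<psi> a j"
        define F where "F = {y \<in> unit_cube 2. y j = r}"
        have F: "cube_face 2 1 F" unfolding F_def by (rule cube_face_side) (use j in \<open>auto simp: r_def\<close>)
        have ne: "F \<noteq> unit_cube 2"
        proof
          assume F2: "F = unit_cube 2"
          \<comment> \<open>A point of the square on the side opposite to \<open>F\<close>.\<close>
          have "(\<lambda>n. if n = j then 1 - r else 0) \<in> unit_cube 2"
            using j unfolding unit_cube_def r_def by auto
          then have "(\<lambda>n. if n = j then 1 - r else 0) \<in> F" using F2 by simp
          then have "1 - r = r" unfolding F_def by simp
          then show False using j(2) unfolding r_def by auto
        qed
        have Fs: "F \<subseteq> unit_cube 2" by (rule cube_face_subset[OF F])
        have "chart K i ` F \<noteq> \<sigma>"
          unfolding sig using ne inj_on_image_eq_iff[OF chart_inj[OF i(1)], of F "unit_cube 2"] Fs cube_of_i by auto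
        moreover have "cell_face K (chart K i ` F) \<sigma>"
          unfolding sig using cell_faceI[OF i(1), of 1 F 2 "unit_cube 2"] i(2) F Fs cube_face_refl[of 2] by simp
        moreover have "x \<in> chart K i ` F" using a psi_mem unfolding \<Phi>_def F_def r_def by auto
        ultimately show False using x unfolding open_cell_def by blast
      qed
      then have "\<not> (fst a = 0 \<or> fst a = 1 \<or> snd a = 0 \<or> snd a = 1)" using psi(4) by blast
      then show "x \<in> \<Phi> ` ({0<..<1} \<times> {0<..<1})" using a by (force simp: mem_Times_iff)
    qed
    show "\<Phi> ` ({0<..<1} \<times> {0<..<1}) \<subseteq> open_cell K \<sigma>"
    proof
      fix x assume "x \<in> \<Phi> ` ({0<..<1} \<times> {0<..<1})"
      then obtain a where "x = \<Phi> a" "a \<in> {0<..<1} \<times> {0<..<1}" by (rule imageE)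
      note a = this(2,1)
      then have asq: "a \<in> square" by (auto simp: mem_Times_iff)
      have "x \<notin> f" if f: "cell_face K f \<sigma>" "f \<noteq> \<sigma>" for f
      proof
        assume xf: "x \<in> f"
        obtain j l m F G where j: "j \<in> cubes K" "cube_face (cube_dim K j) l F" "cube_face (cube_dim K j) m G"
          "F \<subseteq> G" "f = chart K j ` F" "\<sigma> = chart K j ` G"
          using f(1) unfolding cell_face_def by auto
        obtain h where h: "gluing K i j (unit_cube 2) (unit_cube 2) h" and G: "G = unit_cube 2" "cube_dim K j = 2"
          using covering_face[OF j(1,3)] sig j(6) by metis
        have "F \<noteq> unit_cube 2" using f(2) j(5,6) G by auto
        then obtain n r where n: "n < 2" "r = 0 \<or> r = 1" "\<And>x. x \<in> F \<Longrightarrow> x n = r"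
          using cube_face_proper[of 2 l F] j(2) G(2) by metis
        obtain u where u: "u \<in> F" "x = chart K j u" using xf j(5) by blast
        have uc: "u \<in> cube_of K j" using u j(4) G unfolding cube_of_def by auto
        then have uh: "u = h (\<psi> a)"
          using h u(2) a(2) psi_mem[OF asq] cube_of_i unfolding gluing_def \<Phi>_def by metis
        \<comment> \<open>The face \<open>f\<close> may be presented by a cube \<open>j\<close>
          other than \<open>i\<close>. In coordinates the gluing becomes an isometry
          \<open>H\<close> of the square onto itself, and such a map takes no interior point to the
          boundary.\<close>
        define H where "H = (\<lambda>p. inv_into square \<psi> (h (\<psi> p)))"
        have hm: "h (\<psi> p) \<in> \<psi> ` square" if "p \<in> square" for p
          using gluing_whole(3)[OF j(1) h psi_mem[OF that]] psi(1) by simp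
        have H: "\<psi> (H p) = h (\<psi> p)" "H p \<in> square" if "p \<in> square" for p
          unfolding H_def using hm[OF that] by (auto intro: f_inv_into_f inv_into_into)
        have "fst a = 0 \<or> fst a = 1 \<or> snd a = 0 \<or> snd a = 1"
        proof (rule square_isometry_boundary[of H])
          show "dist (H p) (H q) = dist p q" if "p \<in> square" "q \<in> square" for p q
          proof -
            have "dist (H p) (H q) = edist 2 (h (\<psi> p)) (h (\<psi> q))" using psi(2)[of "H p" "H q"] H that by simp
            also have "\<dots> = edist 2 (\<psi> p) (\<psi> q)" using h psi_mem that i(2) G(2) unfolding gluing_def by auto
            finally show ?thesis using psi(2) by simp
          qed
          show "H ` square = square"
          proof
            show "H ` square \<subseteq> square" using H(2) by blast
            show "square \<subseteq> H ` square"
            proof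
              fix q assume q: "q \<in> square"
              then have "\<psi> q \<in> h ` unit_cube 2" using h psi_mem unfolding gluing_def by auto
              then obtain w where w: "\<psi> q = h w" "w \<in> unit_cube 2" by (rule imageE)
              then have "w \<in> \<psi> ` square" using psi(1) by simp
              then obtain p where p: "w = \<psi> p" "p \<in> square" by (rule imageE)
              then have "\<psi> q = \<psi> (H p)" using H w by simp
              then have "q = H p" using psi(5) by (metis injD)
              then show "q \<in> H ` square" using p(2) by (rule image_eqI)
            qed
          qed
          show "a \<in> square" by fact
          have "\<exists>j<2. \<psi> (H a) j = 0 \<or> \<psi> (H a) j = 1"
            using n u(1) unfolding H(1)[OF asq] uh[symmetric] by auto
          then show "fst (H a) = 0 \<or> fst (H a) = 1 \<or> snd (H a) = 0 \<or> snd (H a) = 1"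
            using psi(4) by blast
        qed
        then show False using a(1) by auto
      qed
      moreover have "x \<in> \<sigma>" unfolding sq[symmetric] a(2) using asq by (rule imageI)
      ultimately show "x \<in> open_cell K \<sigma>" unfolding open_cell_def by blast
    qed
  qed
  have oe: "open_cell K e = \<Phi> ` ({0<..<1} \<times> {1})"
  proof
    show "open_cell K e \<subseteq> \<Phi> ` ({0<..<1} \<times> {1})"
    proof
      fix x assume x: "x \<in> open_cell K e"
      then have "x \<in> \<Phi> ` ({0..1} \<times> {1})" unfolding ePhi[symmetric] open_cell_def by simp
      then obtain a where "x = \<Phi> a" "a \<in> {0..1} \<times> {1}" by (rule imageE)
      note a = this(2,1)
      then have asq: "a \<in> square" by (auto simp: mem_Times_iff)
      have "fst a \<noteq> 0 \<and> fst a \<noteq> 1"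
      proof (rule ccontr)
        assume "\<not> (fst a \<noteq> 0 \<and> fst a \<noteq> 1)"
        then have fa: "fst a = 0 \<or> fst a = 1" by blast
        \<comment> \<open>An end of \<open>e\<close> is a vertex: all its coordinates are 0 or 1,
          and \<open>A\<close> and \<open>B\<close> collect them.\<close>
        define A B where "A = {j. j < 2 \<and> \<psi> a j = 0}" and "B = {j. j < 2 \<and> \<psi> a j = 1}"
        have all: "\<psi> a j = 0 \<or> \<psi> a j = 1" if "j < 2" for j
          using fa a(1) c that unfolding \<psi>_def side_coords_def by auto
        have AB2: "A \<union> B = {..<2}" unfolding A_def B_def using all by auto
        have F: "cube_face 2 0 {\<psi> a}"
          unfolding cube_face_def
        proof (intro exI conjI)
          show "A \<subseteq> {..<2}" "B \<subseteq> {..<2}" "A \<inter> B = {}" unfolding A_def B_def by auto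
          show "0 + card (A \<union> B) = 2" unfolding AB2 by simp
          show "{\<psi> a} = {x \<in> unit_cube 2. (\<forall>k\<in>A. x k = 0) \<and> (\<forall>k\<in>B. x k = 1)}"
          proof
            show "{\<psi> a} \<subseteq> {x \<in> unit_cube 2. (\<forall>k\<in>A. x k = 0) \<and> (\<forall>k\<in>B. x k = 1)}"
              using psi_mem[OF asq] unfolding A_def B_def by auto
            show "{x \<in> unit_cube 2. (\<forall>k\<in>A. x k = 0) \<and> (\<forall>k\<in>B. x k = 1)} \<subseteq> {\<psi> a}"
            proof
              fix y assume y: "y \<in> {x \<in> unit_cube 2. (\<forall>k\<in>A. x k = 0) \<and> (\<forall>k\<in>B. x k = 1)}"
              have "y = \<psi> a"
              proof
                fix j show "y j = \<psi> a j"
                  using y all[of j] psi_mem[OF asq] unfolding A_def B_def unit_cube_def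
                  by (cases "j < 2") auto
              qed
              then show "y \<in> {\<psi> a}" by simp
            qed
          qed
        qed
        have top1: "cube_face 2 1 {x \<in> unit_cube 2. x k = c}" by (rule cube_face_side[OF k c])
        have "{\<psi> a} \<subseteq> {x \<in> unit_cube 2. x k = c}" unfolding top using a(1) by auto
        then have "cell_face K (chart K i ` {\<psi> a}) e"
          unfolding ee using cell_faceI[OF i(1), of 0 "{\<psi> a}" 1] i(2) F top1 by simp
        moreover have "x \<in> chart K i ` {\<psi> a}" using a(2) unfolding \<Phi>_def by simp
        moreover have "chart K i ` {\<psi> a} \<noteq> e"
        proof
          assume "chart K i ` {\<psi> a} = e"
          then have "e = {\<Phi> a}" unfolding \<Phi>_def by simp
          moreover have "\<Phi> (0,1) \<in> e" "\<Phi> (1,1) \<in> e" unfolding ePhi by auto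
          ultimately have "\<Phi> (0,1) = \<Phi> (1,1)" by simp
          then show False using inj_onD[OF inj, of "(0,1)" "(1,1)"] by auto
        qed
        ultimately show False using x unfolding open_cell_def by blast
      qed
      then show "x \<in> \<Phi> ` ({0<..<1} \<times> {1})" using a by (force simp: mem_Times_iff)
    qed
    show "\<Phi> ` ({0<..<1} \<times> {1}) \<subseteq> open_cell K e"
    proof
      fix x assume "x \<in> \<Phi> ` ({0<..<1} \<times> {1})"
      then obtain a where "x = \<Phi> a" "a \<in> {0<..<1} \<times> {1}" by (rule imageE)
      note a = this(2,1)
      then have asq: "a \<in> square" by (auto simp: mem_Times_iff)
      have "x \<notin> f" if f: "cell_face K f e" "f \<noteq> e" for f
      proof
        assume xf: "x \<in> f"
        obtain j l m F G where j: "j \<in> cubes K" "cube_face (cube_dim K j) l F" "cube_face (cube_dim K j) m G"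
          "F \<subseteq> G" "f = chart K j ` F" "e = chart K j ` G"
          using f(1) unfolding cell_face_def by auto
        have "F \<noteq> G" using f(2) j by auto
        obtain A B where AB: "A \<subseteq> {..<cube_dim K j}" "B \<subseteq> {..<cube_dim K j}"
          "F = {x \<in> unit_cube (cube_dim K j). (\<forall>k\<in>A. x k = 0) \<and> (\<forall>k\<in>B. x k = 1)}"
          using j(2) unfolding cube_face_def by auto
        obtain A' B' where AB': "A' \<subseteq> {..<cube_dim K j}" "B' \<subseteq> {..<cube_dim K j}"
          "G = {x \<in> unit_cube (cube_dim K j). (\<forall>k\<in>A'. x k = 0) \<and> (\<forall>k\<in>B'. x k = 1)}"
          using j(3) unfolding cube_face_def by auto
        obtain u where u: "u \<in> F" "x = chart K j u" using xf j(5) by blast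
        obtain v where v: "v \<in> G" "v \<notin> F" using \<open>F \<noteq> G\<close> j(4) by blast
        have vc: "v \<in> unit_cube (cube_dim K j)" using v(1) AB'(3) by blast
        obtain n where n: "n \<in> A \<and> v n \<noteq> 0 \<or> n \<in> B \<and> v n \<noteq> 1"
          using v AB(3) vc by blast
        have un: "u n = 0 \<or> u n = 1" and nd: "n < cube_dim K j" using n AB u(1) by auto
        have vu: "v n \<noteq> u n" using n AB(3) u(1) by auto
        \<comment> \<open>Flipping the coordinate \<open>n\<close>, which is fixed in
          \<open>F\<close> but free in \<open>G\<close>, yields a point of \<open>e\<close> at
          distance 1 from \<open>x\<close>. There is no such point, because \<open>e\<close> is a
          unit side and \<open>x\<close> is not one of its ends.\<close>
        define w where "w = u(n := 1 - u n)"
        have uG: "u \<in> G" using u(1) j(4) by blast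
        have nAB: "n \<notin> A'" "n \<notin> B'" using uG v(1) vu AB'(3) by auto
        have wG: "w \<in> G"
          using uG nAB un nd unfolding AB'(3) w_def unit_cube_def by auto
        have Gc: "G \<subseteq> cube_of K j" unfolding cube_of_def by (rule cube_face_subset[OF j(3)])
        have "chart K j w \<in> \<Phi> ` ({0..1} \<times> {1})" unfolding ePhi[symmetric] j(6) using wG by (rule imageI)
        then obtain b where "chart K j w = \<Phi> b" "b \<in> {0..1} \<times> {1}" by (rule imageE)
        note b = this(2,1)
        have bsq: "b \<in> square" using b(1) by (auto simp: mem_Times_iff)
        have "edist (cube_dim K j) u w = dist a b"
          by (rule P2[OF j(1)]) (use uG wG Gc asq bsq u(2) a(2) b(2) in auto)
        moreover have "(edist (cube_dim K j) u w)^2 = (\<Sum>k<cube_dim K j. if k = n then 1 else 0)"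
          unfolding edist_sq w_def using un by (intro sum.cong) auto
        then have "(edist (cube_dim K j) u w)^2 = 1" using nd by simp
        ultimately have "(fst a - fst b)^2 = 1" using a(1) b(1) by (auto simp: dist_prod_def dist_real_def)
        then show False using a(1) b(1) by (auto simp: power2_eq_1_iff)
      qed
      moreover have "a \<in> {0..1} \<times> {1}" using a(1) by (auto simp: mem_Times_iff)
      then have "x \<in> e" unfolding ePhi a(2) by (rule imageI)
      ultimately show "x \<in> open_cell K e" unfolding open_cell_def by blast
    qed
  qed
  have "open_cell K e \<union> open_cell K \<sigma> = \<Phi> ` upper_square"
  proof -
    have "upper_square = ({0<..<1} \<times> {1}) \<union> ({0<..<1} \<times> {0<..<1})" unfolding upper_square_def by auto
    then have "\<Phi> ` upper_square = \<Phi> ` (({0<..<1} \<times> {1}) \<union> ({0<..<1} \<times> {0<..<1}))" by (rule arg_cong)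
    also have "\<dots> = \<Phi> ` ({0<..<1} \<times> {1}) \<union> \<Phi> ` ({0<..<1} \<times> {0<..<1})" by (rule image_Un)
    finally show ?thesis unfolding osig oe by (rule sym)
  qed
  then have P4: "collapse K e \<sigma> = realization K - \<Phi> ` upper_square" unfolding collapse_def by simp
  have P5: "\<exists>i\<in>cubes K. \<forall>a\<in>square. \<Phi> a \<in> chart K i ` cube_of K i"
    using i psi_mem cube_of_i unfolding \<Phi>_def by blast
  show ?thesis by (rule that[OF square_chart.intro[OF inj P5 P2 P3] P4])
qed

section \<open>The metric near the square\<close>

lemma convex_comb_ge:
  fixes m x y l :: real
  assumes "m \<le> x" "m \<le> y" "0 \<le> l" "l \<le> 1"
  shows "m \<le> (1 - l) * x + l * y"
proof -
  have "0 \<le> (1 - l) * (x - m) + l * (y - m)" using assms by simp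
  then show ?thesis by (simp add: algebra_simps)
qed

lemma dist_convex_comb:
  fixes a b :: "'b::real_normed_vector"
  shows "dist ((1 - s) *\<^sub>R a + s *\<^sub>R b) ((1 - t) *\<^sub>R a + t *\<^sub>R b) = \<bar>s - t\<bar> * dist a b"
proof -
  have "((1 - s) *\<^sub>R a + s *\<^sub>R b) - ((1 - t) *\<^sub>R a + t *\<^sub>R b) = (t - s) *\<^sub>R (a - b)"
    by (simp add: algebra_simps)
  then show ?thesis by (simp add: dist_norm abs_minus_commute)
qed

lemma square_convex_comb:
  assumes "a \<in> square" "b \<in> square" "0 \<le> l" "l \<le> 1"
  shows "(1 - l) *\<^sub>R a + l *\<^sub>R b \<in> square"
proof -
  have "convex square" by (intro convex_Times) auto
  then show ?thesis using assms convexD_alt by blast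
qed

lemma upper_square_subset: "upper_square \<subseteq> square" unfolding upper_square_def by auto

text \<open>For a point of the square, its distance to the three sides that remain after the
  collapse. The free top side does not count, so the depth is positive on it except at its
  ends.\<close>

definition depth :: "real \<times> real \<Rightarrow> real" where "depth p = min (min (fst p) (1 - fst p)) (snd p)"

lemma depth_nonneg: "p \<in> square \<Longrightarrow> 0 \<le> depth p"
  unfolding depth_def by (auto simp: mem_Times_iff)

lemma depth_pos_iff: "p \<in> square \<Longrightarrow> 0 < depth p \<longleftrightarrow> p \<in> upper_square"
  unfolding depth_def upper_square_def by (auto simp: mem_Times_iff)

lemma depth_nonexpansive: "\<bar>depth p - depth q\<bar> \<le> dist p q"
proof -
  have "\<bar>fst p - fst q\<bar> \<le> dist p q" "\<bar>snd p - snd q\<bar> \<le> dist p q"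
    using dist_fst_le[of p q] dist_snd_le[of p q] by (auto simp: dist_real_def)
  then show ?thesis unfolding depth_def by linarith
qed

lemma depth_convex_comb:
  assumes "0 \<le> l" "l \<le> 1"
  shows "min (depth a) (depth b) \<le> depth ((1 - l) *\<^sub>R a + l *\<^sub>R b)"
proof -
  define m where "m = min (depth a) (depth b)"
  have m: "m \<le> fst a" "m \<le> fst b" "m \<le> 1 - fst a" "m \<le> 1 - fst b" "m \<le> snd a" "m \<le> snd b"
    unfolding m_def depth_def by auto
  have "m \<le> (1 - l) * (1 - fst a) + l * (1 - fst b)" by (rule convex_comb_ge[OF m(3,4) assms])
  also have "\<dots> = 1 - ((1 - l) * fst a + l * fst b)" by (simp add: algebra_simps)
  finally show ?thesis
    using convex_comb_ge[OF m(1,2) assms] convex_comb_ge[OF m(5,6) assms]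
    unfolding m_def[symmetric] unfolding depth_def by simp
qed

text \<open>The ends lie on the three remaining sides. They are not on one side, since the segment
  enters \<open>upper_square\<close>, and not on the two vertical sides, since it is shorter than 1.
  So one is on the bottom and one on a vertical side, with a bottom corner cut off. Taking the
  midpoint halves the distances to these two sides, whence the factor 2.\<close>

lemma square_segment_cuts_corner:
  assumes a: "a \<in> square" "a \<notin> upper_square" and b: "b \<in> square" "b \<notin> upper_square" and short: "dist a b < 1"
    and l: "0 \<le> l" "l \<le> 1" and c: "(1 - l) *\<^sub>R a + l *\<^sub>R b \<in> upper_square"
  shows "\<exists>p\<in>{(0,0),(1,0)}. min (dist a p) (dist b p) \<le> 2 * depth ((1/2) *\<^sub>R a + (1/2) *\<^sub>R b) \<and>
    dist a p < dist a b \<and> dist b p < dist a b"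
proof -
  have main: "dist a (e,0) < dist a b \<and> dist b (e,0) < dist a b \<and>
      min (dist a (e,0)) (dist b (e,0)) \<le> 2 * depth ((1/2) *\<^sub>R a + (1/2) *\<^sub>R b)"
    if e: "e = 0 \<or> e = 1" and a: "a \<in> square" and b: "b \<in> square" and "fst a = e" "snd b = 0" "dist a b < 1"
      "snd a > 0" "fst b \<noteq> e" for a b :: "real \<times> real" and e
  proof -
    have r: "0 \<le> fst b" "fst b \<le> 1" "snd a \<le> 1" using a b by (auto simp: mem_Times_iff)
    have "dist a (e,0) = snd a" "dist b (e,0) = \<bar>fst b - e\<bar>"
      using that by (auto simp: dist_prod_def dist_real_def)
    moreover have "(dist a b)^2 = \<bar>fst b - e\<bar>^2 + (snd a)^2"
      unfolding dist_prod_sq using that by (simp add: power2_commute)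
    then have "\<bar>fst b - e\<bar>^2 < (dist a b)^2" "(snd a)^2 < (dist a b)^2" using that by auto
    then have lt: "\<bar>fst b - e\<bar> < dist a b" "snd a < dist a b" by (auto intro: power2_less_imp_less)
    moreover have "min (snd a) \<bar>fst b - e\<bar> \<le> 2 * depth ((1/2) *\<^sub>R a + (1/2) *\<^sub>R b)"
      using e r that unfolding depth_def by (auto simp: min_def)
    ultimately show ?thesis by simp
  qed
  have sides: "fst p = 0 \<or> fst p = 1 \<or> snd p = 0" if "p \<in> square" "p \<notin> upper_square" for p
    using that unfolding upper_square_def by (auto simp: mem_Times_iff)
  have in_c: "0 < (1 - l) * fst a + l * fst b" "(1 - l) * fst a + l * fst b < 1" "0 < (1 - l) * snd a + l * snd b"
    using c unfolding upper_square_def by (auto simp: mem_Times_iff)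
  have nn: "0 \<le> snd a" "0 \<le> snd b" using a(1) b(1) by (auto simp: mem_Times_iff)
  have f: "\<bar>fst a - fst b\<bar> < 1" using dist_fst_le[of a b] short by (auto simp: dist_real_def)
  have 1: "\<not> (snd a = 0 \<and> snd b = 0)" "\<not> (fst a = 0 \<and> fst b = 0)" "\<not> (fst a = 1 \<and> fst b = 1)"
    using in_c by auto
  have 2: "\<not> (fst a = 0 \<and> fst b = 1)" "\<not> (fst a = 1 \<and> fst b = 0)" using f by auto
  have "(\<exists>e. (e = 0 \<or> e = 1) \<and> fst a = e \<and> snd b = 0 \<and> snd a > 0 \<and> fst b \<noteq> e) \<or>
      (\<exists>e. (e = 0 \<or> e = 1) \<and> fst b = e \<and> snd a = 0 \<and> snd b > 0 \<and> fst a \<noteq> e)"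
    using 1 2 sides[OF a] sides[OF b] nn by (smt (verit))
  then consider e where "e = 0 \<or> e = 1" "fst a = e" "snd b = 0" "snd a > 0" "fst b \<noteq> e"
    | e where "e = 0 \<or> e = 1" "fst b = e" "snd a = 0" "snd b > 0" "fst a \<noteq> e" by blast
  then show ?thesis
  proof cases
    case e: (1 e)
    then show ?thesis using main[OF e(1) a(1) b(1) e(2,3) short e(4,5)] by (intro bexI[of _ "(e,0)"]) auto
  next
    case e: (2 e)
    then show ?thesis
      using main[OF e(1) b(1) a(1) e(2,3) _ e(4,5)] short
      by (intro bexI[of _ "(e,0)"]) (auto simp: dist_commute add.commute min.commute)
  qed
qed

lemma first_positive:
  fixes f :: "real \<Rightarrow> real"
  assumes lip: "\<And>s t. \<lbrakk>s \<in> {0..D}; t \<in> {0..D}\<rbrakk> \<Longrightarrow> \<bar>f s - f t\<bar> \<le> \<bar>s - t\<bar>"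
    and f0: "f 0 \<le> 0" and t: "t \<in> {0..D}" "0 < f t"
  obtains r where "0 \<le> r" "r \<le> t" "\<forall>s\<in>{0..r}. f s \<le> 0"
    "\<forall>\<epsilon>>0. \<exists>s\<in>{r..t}. s < r + \<epsilon> \<and> 0 < f s"
proof -
  define T where "T = {s\<in>{0..t}. 0 < f s}"
  define r where "r = Inf T"
  have T: "t \<in> T" "bdd_below T" using t unfolding T_def by auto
  have r0: "0 \<le> r" unfolding r_def using T by (intro cInf_greatest) (auto simp: T_def)
  have rt: "r \<le> t" unfolding r_def using T by (intro cInf_lower)
  have below: "f s \<le> 0" if "0 \<le> s" "s < r" for s
  proof (rule ccontr)
    assume "\<not> f s \<le> 0"
    then have "s \<in> T" using that rt unfolding T_def by auto
    then have "r \<le> s" unfolding r_def using T by (intro cInf_lower)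
    then show False using that by simp
  qed
  have fr: "f r \<le> 0"
  proof (rule ccontr)
    assume n: "\<not> f r \<le> 0"
    then have rp: "0 < r" using f0 r0 by (cases "r = 0") auto
    \<comment> \<open>A time before the infimum \<open>r\<close>, but so close to it that the
      Lipschitz bound keeps \<open>f\<close> positive.\<close>
    define s where "s = max 0 (r - f r / 2)"
    have s: "0 \<le> s" "s < r" "r - s \<le> f r / 2" using rp n unfolding s_def by (auto simp: max_def)
    then have "\<bar>f s - f r\<bar> \<le> f r / 2" using lip[of s r] rt t by auto
    then have "0 < f s" using n by linarith
    then show False using below[OF s(1,2)] by simp
  qed
  show ?thesis
  proof (rule that[OF r0 rt]; intro ballI allI impI)
    show "f s \<le> 0" if "s \<in> {0..r}" for s using below[of s] fr that by (cases "s = r") auto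
    fix \<epsilon> :: real assume "0 < \<epsilon>"
    then obtain s where "s \<in> T" "s < r + \<epsilon>" using cInf_lessD[of T "r + \<epsilon>"] T unfolding r_def by auto
    moreover have "r \<le> s" unfolding r_def using T \<open>s \<in> T\<close> by (intro cInf_lower)
    ultimately show "\<exists>s\<in>{r..t}. s < r + \<epsilon> \<and> 0 < f s" unfolding T_def by auto
  qed
qed

text \<open>Both sides of the hinge at \<open>x\<close> are cut in the same ratio \<open>l\<close>,
  and the hinge inequality then collapses to \<open>d w w' \<le> l * d m m'\<close>. Geodesics from
  \<open>x\<close> thus depend continuously on their end, uniformly along their length.\<close>

lemma (in stewart_space) near_interval_point:
  assumes x: "x \<in> M" and m: "m \<in> M" "m' \<in> M" and w: "w \<in> I x m"
  obtains w' where "w' \<in> I x m'" "d w w' \<le> d m m'"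
proof -
  have wM: "w \<in> M" "d x w + d w m = d x m" using w unfolding metric_interval_def by auto
  obtain l where l: "0 \<le> l" "l \<le> 1" "d x w = l * d x m" "d w m = (1 - l) * d x m"
  proof (cases "d x m = 0")
    case True
    then have "d x w = 0" "d w m = 0" using wM nonneg[of x w] nonneg[of w m] by linarith+
    then show ?thesis using that[of 0] True by simp
  next
    case False
    then have pos: "d x m > 0" using nonneg[of x m] by linarith
    define l where "l = d x w / d x m"
    have lw: "d x w = l * d x m" using pos unfolding l_def by simp
    have "d x w \<le> d x m" using wM nonneg[of w m] by linarith
    then have "l \<le> 1" "0 \<le> l" using pos unfolding l_def by auto
    then show ?thesis using that[of l] lw wM by (simp add: algebra_simps)
  qed
  have "l * d x m' \<le> d x m'" using l mult_right_mono[of l 1 "d x m'"] by simp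
  then obtain w' where w': "w' \<in> M" "d x w' = l * d x m'" "d w' m' = d x m' - l * d x m'"
    using between[OF x m(2), of "l * d x m'"] l by auto
  have "(d w w')^2 \<le> (l * d x m)^2 + (l * d x m')^2 - l * l * ((d x m)^2 + (d x m')^2 - (d m m')^2)"
    by (rule hinge_comparison) (use assms wM w' l in \<open>auto simp: algebra_simps\<close>)
  also have "\<dots> = (l * d m m')^2" by (simp add: power2_eq_square algebra_simps)
  finally have "d w w' \<le> l * d m m'" by (rule power2_le_imp_le) (use l in auto)
  also have "\<dots> \<le> d m m'" using l mult_right_mono[of l 1 "d m m'"] by simp
  finally have "d w w' \<le> d m m'" .
  moreover have "w' \<in> I x m'" using w' unfolding metric_interval_def by auto
  ultimately show ?thesis using that by blast
qed

section \<open>Nonexpansive functions on the complex and the isometric embedding of the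
  square\<close>

lemma chain_nonexpansive:
  assumes lip: "\<And>j u v. \<lbrakk>j \<in> cubes K; u \<in> cube_of K j; v \<in> cube_of K j\<rbrakk> \<Longrightarrow>
      \<bar>f (chart K j u) - f (chart K j v)\<bar> \<le> edist (cube_dim K j) u v"
    and "chain K x y l"
  shows "\<bar>f x - f y\<bar> \<le> l"
  using assms(2)
proof induction
  case (chain_step i u v y l)
  then show ?case using lip[of i u v] by linarith
qed simp

lemma complex_dist_chart_le:
  assumes "j \<in> cubes K" "u \<in> cube_of K j" "v \<in> cube_of K j"
  shows "complex_dist K (chart K j u) (chart K j v) \<le> edist (cube_dim K j) u v"
proof -
  have "chart K j v \<in> realization K" using assms unfolding realization_def by blast
  then have "chain K (chart K j u) (chart K j v) (edist (cube_dim K j) u v + 0)"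
    using assms by (intro chain_step chain_refl)
  then have "(INF l\<in>{l. chain K (chart K j u) (chart K j v) l}. ennreal l) \<le> ennreal (edist (cube_dim K j) u v)"
    by (intro INF_lower2[of "edist (cube_dim K j) u v"]) auto
  then show ?thesis unfolding complex_dist_def by (intro enn2real_leI edist_nonneg)
qed

lemma nonexpansive_complex_dist:
  assumes lip: "\<And>j u v. \<lbrakk>j \<in> cubes K; u \<in> cube_of K j; v \<in> cube_of K j\<rbrakk> \<Longrightarrow>
      \<bar>f (chart K j u) - f (chart K j v)\<bar> \<le> edist (cube_dim K j) u v"
    and met: "Metric_space (realization K) (complex_dist K)" and xy: "x \<in> realization K" "y \<in> realization K"
  shows "\<bar>f x - f y\<bar> \<le> complex_dist K x y"
proof (cases "\<exists>l. chain K x y l")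
  case True
  then obtain l where "chain K x y l" by blast
  then have fin: "(INF l\<in>{l. chain K x y l}. ennreal l) < top"
    by (intro le_less_trans[OF INF_lower, of l]) auto
  have "ennreal \<bar>f x - f y\<bar> \<le> (INF l\<in>{l. chain K x y l}. ennreal l)"
    using chain_nonexpansive[of K f, OF lip] by (intro INF_greatest ennreal_leI) auto
  then have "enn2real (ennreal \<bar>f x - f y\<bar>) \<le> complex_dist K x y"
    unfolding complex_dist_def using fin by (intro enn2real_mono)
  then show ?thesis by simp
next
  case False
  then have none: "{l. chain K x y l} = {}" by blast
  \<comment> \<open>Without a chain the infimum is infinite and \<open>enn2real\<close> gives 0,
    which a metric space allows only for \<open>x = y\<close>.\<close>
  have "complex_dist K x y = 0" unfolding complex_dist_def none by simp
  then have "x = y" using Metric_space.zero[OF met xy] by blast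
  then show ?thesis using Metric_space.nonneg[OF met] by simp
qed

locale collapsible_square = square_chart K \<Phi>
  for K :: "('i, 'a) cube_gluing" and \<Phi> :: "real \<times> real \<Rightarrow> 'a" +
  assumes cat: "CAT0 (realization K) (complex_dist K)"
begin

abbreviation X where "X \<equiv> realization K"
abbreviation d where "d \<equiv> complex_dist K"
abbreviation S where "S \<equiv> realization K - \<Phi> ` upper_square"

sublocale stewart_space X d by (rule CAT0_imp_stewart_space[OF cat])

lemma Phi_X: "a \<in> square \<Longrightarrow> \<Phi> a \<in> X"
  using in_cube unfolding realization_def by blast

lemma Phi_S: "\<lbrakk>a \<in> square; a \<notin> upper_square\<rbrakk> \<Longrightarrow> \<Phi> a \<in> S"
  using Phi_X inj_on_image_mem_iff[OF inj _ upper_square_subset] by simp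

lemma dist_Phi_le:
  assumes "a \<in> square" "b \<in> square" shows "d (\<Phi> a) (\<Phi> b) \<le> dist a b"
proof -
  obtain i where i: "i \<in> cubes K" "\<forall>a\<in>square. \<Phi> a \<in> chart K i ` cube_of K i" using in_cube by (rule bexE)
  obtain u where u: "\<Phi> a = chart K i u" "u \<in> cube_of K i" using bspec[OF i(2) assms(1)] by (rule imageE)
  obtain v where v: "\<Phi> b = chart K i v" "v \<in> cube_of K i" using bspec[OF i(2) assms(2)] by (rule imageE)
  show ?thesis
    using complex_dist_chart_le[OF i(1) u(2) v(2)] isometric[OF i(1) u(2) v(2) assms u(1)[symmetric] v(1)[symmetric]]
    unfolding u(1) v(1) by simp
qed

text \<open>Since only subcells of the square meet \<open>\<Phi> ` upper_square\<close>, a function on the square that is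
  constant off \<open>upper_square\<close> extends by this constant to the whole complex.\<close>

definition extend :: "(real \<times> real \<Rightarrow> real) \<Rightarrow> real \<Rightarrow> 'a \<Rightarrow> real" where
  "extend F c x = (if x \<in> \<Phi> ` square then F (inv_into square \<Phi> x) else c)"

lemma extend_Phi: "a \<in> square \<Longrightarrow> extend F c (\<Phi> a) = F a"
  unfolding extend_def using inj by simp

lemma extend_S:
  assumes "\<And>a. \<lbrakk>a \<in> square; a \<notin> upper_square\<rbrakk> \<Longrightarrow> F a = c" "x \<in> S"
  shows "extend F c x = c"
proof (cases "x \<in> \<Phi> ` square")
  case True
  then obtain a where a: "x = \<Phi> a" "a \<in> square" by (rule imageE)
  then have "a \<notin> upper_square" using assms(2) by auto
  then show ?thesis using a assms(1) extend_Phi by simp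
qed (simp add: extend_def)

lemma extend_nonexpansive:
  assumes F: "\<And>a b. \<lbrakk>a \<in> square; b \<in> square\<rbrakk> \<Longrightarrow> \<bar>F a - F b\<bar> \<le> dist a b"
    and const: "\<And>a. \<lbrakk>a \<in> square; a \<notin> upper_square\<rbrakk> \<Longrightarrow> F a = c"
    and xy: "x \<in> X" "y \<in> X"
  shows "\<bar>extend F c x - extend F c y\<bar> \<le> d x y"
proof (rule nonexpansive_complex_dist[OF _ Metric_space_axioms xy])
  fix j u v assume j: "j \<in> cubes K" "u \<in> cube_of K j" "v \<in> cube_of K j"
  show "\<bar>extend F c (chart K j u) - extend F c (chart K j v)\<bar> \<le> edist (cube_dim K j) u v"
  proof (cases "chart K j ` cube_of K j \<inter> \<Phi> ` upper_square = {}")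
    case True
    have "extend F c (chart K j w) = c" if "w \<in> cube_of K j" for w
    proof (rule extend_S[OF const])
      have "chart K j w \<in> X" using j(1) that unfolding realization_def by blast
      then show "chart K j w \<in> S" using True that by blast
    qed
    then show ?thesis using j edist_nonneg by simp
  next
    case False
    then have sub: "chart K j ` cube_of K j \<subseteq> \<Phi> ` square" by (rule open_star[OF j(1)])
    obtain a where a: "chart K j u = \<Phi> a" "a \<in> square" using subsetD[OF sub imageI[OF j(2)]] by (rule imageE)
    obtain b where b: "chart K j v = \<Phi> b" "b \<in> square" using subsetD[OF sub imageI[OF j(3)]] by (rule imageE)
    have "edist (cube_dim K j) u v = dist a b" by (rule isometric) (use j a b in auto)
    then show ?thesis using F a b extend_Phi by simp
  qed
qed

text \<open>Vanishes on the collapsed complex and is positive on the removed part, hence detects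
  continuously whether a geodesic leaves \<open>S\<close>, and how deeply.\<close>

abbreviation mu where "mu \<equiv> extend depth 0"

lemma depth_zero: "\<lbrakk>a \<in> square; a \<notin> upper_square\<rbrakk> \<Longrightarrow> depth a = 0"
  using depth_nonneg[of a] depth_pos_iff[of a] by linarith

lemma mu_nonexpansive: "\<lbrakk>x \<in> X; y \<in> X\<rbrakk> \<Longrightarrow> \<bar>mu x - mu y\<bar> \<le> d x y"
  by (rule extend_nonexpansive[OF depth_nonexpansive depth_zero])

lemma mu_S: "x \<in> S \<Longrightarrow> mu x = 0" by (rule extend_S[OF depth_zero])

lemma mu_pos: assumes "x \<in> \<Phi> ` upper_square" shows "0 < mu x"
proof -
  obtain a where a: "x = \<Phi> a" "a \<in> upper_square" using assms by (rule imageE)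
  then have "a \<in> square" using upper_square_subset by blast
  then show ?thesis using a extend_Phi depth_pos_iff by simp
qed

text \<open>Lower bounds for \<open>d\<close> come from nonexpansive test functions. The distance to
  \<open>v\<close>, truncated at \<open>depth v\<close>, is constant off \<open>upper_square\<close>
  and so extends to the whole complex.\<close>

lemma dist_Phi_ge_local:
  assumes v: "v \<in> square" and a: "a \<in> square"
  shows "min (dist v a) (depth v) \<le> d (\<Phi> v) (\<Phi> a)"
proof -
  define F where "F = (\<lambda>a. min (dist v a) (depth v))"
  have "\<bar>extend F (depth v) (\<Phi> v) - extend F (depth v) (\<Phi> a)\<bar> \<le> d (\<Phi> v) (\<Phi> a)"
  proof (rule extend_nonexpansive)
    show "\<bar>F a - F b\<bar> \<le> dist a b" for a b
    proof -
      have "dist v a \<le> dist v b + dist a b" "dist v b \<le> dist v a + dist a b"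
        using dist_triangle[of v a b] dist_triangle[of v b a] by (auto simp: dist_commute)
      then show ?thesis unfolding F_def by linarith
    qed
    show "F a = depth v" if "a \<in> square" "a \<notin> upper_square" for a
      using depth_nonexpansive[of v a] depth_zero[OF that] unfolding F_def by auto
  qed (use Phi_X v a in auto)
  moreover have "F v = 0" using depth_nonneg[OF v] unfolding F_def by simp
  ultimately show ?thesis using extend_Phi v a unfolding F_def by (auto simp: abs_le_iff)
qed

text \<open>Along the segment the depth is at least the smaller of the depths of its ends, so its
  image is geodesic on the scale \<open>m\<close>. In a CAT(0) space a local geodesic is a
  geodesic.\<close>

lemma dist_Phi_upper:
  assumes a: "a \<in> upper_square" and b: "b \<in> upper_square"
  shows "d (\<Phi> a) (\<Phi> b) = dist a b"
proof (cases "a = b")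
  case True
  then show ?thesis using Phi_X upper_square_subset a by auto
next
  case False
  define L where "L = dist a b"
  have L: "L > 0" using False unfolding L_def by simp
  have sq: "a \<in> square" "b \<in> square" using a b upper_square_subset by auto
  define p where "p = (\<lambda>t. (1 - t / L) *\<^sub>R a + (t / L) *\<^sub>R b)"
  define m where "m = min (depth a) (depth b)"
  have m: "m > 0" using a b sq depth_pos_iff unfolding m_def by simp
  have p: "p t \<in> square" "m \<le> depth (p t)" if "t \<in> {0..L}" for t
    unfolding p_def m_def using that L by (intro square_convex_comb depth_convex_comb sq; simp)+
  have pd: "dist (p s) (p t) = \<bar>s - t\<bar>" for s t
  proof -
    have "dist (p s) (p t) = \<bar>s / L - t / L\<bar> * L" unfolding p_def dist_convex_comb L_def ..
    also have "s / L - t / L = (s - t) / L" by (simp add: diff_divide_distrib)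
    finally show ?thesis using L by (simp add: abs_divide)
  qed
  have "d (\<Phi> (p 0)) (\<Phi> (p L)) = \<bar>0 - L\<bar>"
  proof (rule local_geodesic_imp_geodesic[of L "\<lambda>t. \<Phi> (p t)" m])
    show "\<Phi> (p t) \<in> X" if "t \<in> {0..L}" for t using p[OF that] Phi_X by simp
    show "d (\<Phi> (p s)) (\<Phi> (p t)) = \<bar>s - t\<bar>" if "s \<in> {0..L}" "t \<in> {0..L}" "\<bar>s - t\<bar> \<le> m" for s t
      using dist_Phi_le[OF p(1) p(1), OF that(1,2)] dist_Phi_ge_local[OF p(1) p(1), OF that(1,2)] that(3) p(2)[OF that(1)]
      unfolding pd by simp
  qed (use L m in auto)
  then show ?thesis using L unfolding p_def L_def by simp
qed

text \<open>By approximation from \<open>upper_square\<close>, into which the homothety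
  \<open>h\<close> shrinks the square towards its centre.\<close>

lemma dist_Phi:
  assumes a: "a \<in> square" and b: "b \<in> square"
  shows "d (\<Phi> a) (\<Phi> b) = dist a b"
proof (rule antisym[OF dist_Phi_le[OF a b]])
  define L where "L = dist a b"
  define c :: "real \<times> real" where "c = (1/2, 1/2)"
  show "dist a b \<le> d (\<Phi> a) (\<Phi> b)"
  proof (rule field_le_epsilon)
    fix \<epsilon> :: real assume e: "0 < \<epsilon>"
    \<comment> \<open>Each end moves by at most \<open>\<delta>\<close> and the segment becomes
      shorter by \<open>\<delta> * L\<close>, a total error of
      \<open>\<delta> * (2 + L)\<close>.\<close>
    define \<delta> where "\<delta> = min (1/2) (\<epsilon> / (2 + L))"
    have Lp: "0 < 2 + L" unfolding L_def by (simp add: add_pos_nonneg)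
    have "\<delta> \<le> \<epsilon> / (2 + L)" unfolding \<delta>_def by simp
    then have "\<delta> * (2 + L) \<le> \<epsilon>" using Lp by (simp add: field_simps)
    then have de: "2 * \<delta> + \<delta> * L \<le> \<epsilon>" by (simp add: algebra_simps)
    have d01: "0 < \<delta>" "\<delta> \<le> 1/2" using e Lp unfolding \<delta>_def by (auto simp: min_def)
    define h where "h = (\<lambda>p. (1 - \<delta>) *\<^sub>R p + \<delta> *\<^sub>R c)"
    have csq: "c \<in> square" unfolding c_def by simp
    have hsq: "h p \<in> square" if "p \<in> square" for p
      unfolding h_def using square_convex_comb[OF that csq] d01 by simp
    have hup: "h p \<in> upper_square" if "p \<in> square" for p
    proof -
      have p: "0 \<le> fst p" "fst p \<le> 1" "0 \<le> snd p" using that by (auto simp: mem_Times_iff)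
      have "(1 - \<delta>) * fst p \<le> 1 - \<delta>" "0 \<le> (1 - \<delta>) * fst p" "0 \<le> (1 - \<delta>) * snd p"
        using p d01 mult_left_mono[of "fst p" 1 "1 - \<delta>"] by auto
      moreover have "fst (h p) = (1 - \<delta>) * fst p + \<delta> / 2" "snd (h p) = (1 - \<delta>) * snd p + \<delta> / 2"
        unfolding h_def c_def by auto
      ultimately have "0 < depth (h p)" unfolding depth_def using d01 by linarith
      then show ?thesis using depth_pos_iff hsq that by blast
    qed
    have hd: "d (\<Phi> p) (\<Phi> (h p)) \<le> \<delta>" if "p \<in> square" for p
    proof -
      have "h p = (1 - \<delta>) *\<^sub>R p + \<delta> *\<^sub>R c" "p = (1 - 0) *\<^sub>R p + 0 *\<^sub>R c" unfolding h_def by auto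
      then have "dist p (h p) = \<delta> * dist p c" using dist_convex_comb[of 0 p c \<delta>] d01 by simp
      also have "dist p c \<le> 1"
      proof -
        have "0 \<le> fst p" "fst p \<le> 1" "0 \<le> snd p" "snd p \<le> 1" using that by (auto simp: mem_Times_iff)
        then have "\<bar>fst p - 1/2\<bar> \<le> 1/2" "\<bar>snd p - 1/2\<bar> \<le> 1/2" by linarith+
        then have "(fst p - 1/2)^2 \<le> (1/2)^2" "(snd p - 1/2)^2 \<le> (1/2)^2"
          using abs_le_square_iff[of "fst p - 1/2" "1/2"] abs_le_square_iff[of "snd p - 1/2" "1/2"] by auto
        then have "(dist p c)^2 \<le> 1^2" unfolding dist_prod_sq c_def by (simp add: power2_eq_square)
        then show ?thesis by (rule power2_le_imp_le) simp
      qed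
      then have "\<delta> * dist p c \<le> \<delta>" using d01 mult_left_mono[of "dist p c" 1 \<delta>] by simp
      finally show ?thesis using dist_Phi_le[OF that hsq[OF that]] by linarith
    qed
    have "L - \<delta> * L = dist (h a) (h b)"
    proof -
      have "h a - h b = (1 - \<delta>) *\<^sub>R (a - b)" unfolding h_def by (simp add: algebra_simps)
      then have "dist (h a) (h b) = (1 - \<delta>) * L" using d01 unfolding dist_norm L_def by simp
      then show ?thesis by (simp add: algebra_simps)
    qed
    also have "\<dots> = d (\<Phi> (h a)) (\<Phi> (h b))" using dist_Phi_upper hup a b by simp
    also have "\<dots> \<le> d (\<Phi> (h a)) (\<Phi> a) + (d (\<Phi> a) (\<Phi> b) + d (\<Phi> b) (\<Phi> (h b)))"
      using triangle[OF Phi_X[OF hsq[OF a]] Phi_X[OF a] Phi_X[OF hsq[OF b]]]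
        triangle[OF Phi_X[OF a] Phi_X[OF b] Phi_X[OF hsq[OF b]]] by linarith
    also have "\<dots> \<le> \<delta> + (d (\<Phi> a) (\<Phi> b) + \<delta>)"
      using hd[OF a] hd[OF b] commute[of "\<Phi> (h a)" "\<Phi> a"] by linarith
    finally show "dist a b \<le> d (\<Phi> a) (\<Phi> b) + \<epsilon>" using de unfolding L_def[symmetric] by linarith
  qed
qed

text \<open>Compactness of the square, carried over by the isometry \<open>\<Phi>\<close>.\<close>

lemma Phi_square_closed:
  assumes q: "q \<in> X" and near: "\<And>\<epsilon>. 0 < \<epsilon> \<Longrightarrow> \<exists>a\<in>square. d q (\<Phi> a) < \<epsilon>"
  obtains a where "a \<in> square" "q = \<Phi> a"
proof -
  have "\<forall>n. \<exists>a\<in>square. d q (\<Phi> a) < 1 / real (Suc n)" using near by simp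
  then obtain f where f: "\<And>n. f n \<in> square" "\<And>n. d q (\<Phi> (f n)) < 1 / real (Suc n)" by metis
  have "compact square" by (intro compact_Times) auto
  then obtain a r where a: "a \<in> square" "strict_mono r" "(f \<circ> r) \<longlonglongrightarrow> a"
    using f(1) unfolding compact_def by (metis (no_types, lifting))
  have "d q (\<Phi> a) \<le> 0"
  proof (rule LIMSEQ_le_const)
    have "(\<lambda>n. dist ((f \<circ> r) n) a) \<longlonglongrightarrow> 0" using a(3) tendsto_dist_iff by blast
    moreover have "(\<lambda>n. 1 / real (Suc (r n))) \<longlonglongrightarrow> 0"
      using LIMSEQ_subseq_LIMSEQ[OF lim_1_over_n a(2)] LIMSEQ_subseq_LIMSEQ[OF LIMSEQ_inverse_real_of_nat a(2)]
      by (simp add: o_def inverse_eq_divide)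
    ultimately show "(\<lambda>n. 1 / real (Suc (r n)) + dist ((f \<circ> r) n) a) \<longlonglongrightarrow> 0"
      using tendsto_add by fastforce
    show "\<exists>N. \<forall>n\<ge>N. d q (\<Phi> a) \<le> 1 / real (Suc (r n)) + dist ((f \<circ> r) n) a"
    proof (intro exI allI impI)
      fix n :: nat
      have "d q (\<Phi> a) \<le> d q (\<Phi> (f (r n))) + d (\<Phi> (f (r n))) (\<Phi> a)"
        by (intro triangle q Phi_X f a)
      then show "d q (\<Phi> a) \<le> 1 / real (Suc (r n)) + dist ((f \<circ> r) n) a"
        using f(2)[of "r n"] dist_Phi[OF f(1) a(1), of "r n"] by simp
    qed
  qed
  then have "d q (\<Phi> a) = 0" using nonneg[of q "\<Phi> a"] by linarith
  then have "q = \<Phi> a" using zero[OF q Phi_X[OF a(1)]] by blast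
  then show ?thesis using that a by blast
qed

end

section \<open>Geodesics and paths in the collapsed complex\<close>

context collapsible_square
begin

lemma in_S_iff_mu: assumes "x \<in> X" shows "x \<in> S \<longleftrightarrow> mu x \<le> 0"
  using assms mu_S[of x] mu_pos[of x] by auto

text \<open>\<open>t1\<close> is the first time of entry into the removed part and \<open>t2\<close>
  the last time of exit. At both times the geodesic is a limit of removed points without being one,
  so by closedness of the square it is on a remaining side.\<close>

lemma geodesic_enters_square:
  assumes xy: "x \<in> S" "y \<in> S" and cross: "\<not> I x y \<subseteq> S"
  obtains g t1 t t2 a b where "g 0 = x" "g (d x y) = y" "g ` {0..d x y} = I x y"
    "\<forall>s\<in>{0..d x y}. \<forall>t\<in>{0..d x y}. d (g s) (g t) = \<bar>s - t\<bar>"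
    "0 \<le> t1" "t1 \<le> t" "t \<le> t2" "t2 \<le> d x y" "a \<in> square" "a \<notin> upper_square" "b \<in> square" "b \<notin> upper_square"
    "g t1 = \<Phi> a" "g t2 = \<Phi> b" "g t \<in> \<Phi> ` upper_square"
    "g ` {0..t1} \<subseteq> S" "g ` {t2..d x y} \<subseteq> S"
proof -
  define D where "D = d x y"
  obtain g where g: "g 0 = x" "g D = y" "\<And>s t. \<lbrakk>s \<in> {0..D}; t \<in> {0..D}\<rbrakk> \<Longrightarrow> d (g s) (g t) = \<bar>s - t\<bar>"
    "g ` {0..D} = I x y" using geodesic_exists[of x y] xy unfolding D_def by (metis DiffD1)
  have gX: "g s \<in> X" if "s \<in> {0..D}" for s
    using imageI[OF that, of g] unfolding g(4) metric_interval_def by simp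
  obtain z where z: "z \<in> I x y" "z \<notin> S" using cross by blast
  then have "z \<in> g ` {0..D}" using g(4) by simp
  then obtain t where t: "z = g t" "t \<in> {0..D}" by (rule imageE)
  have gt: "g t \<in> \<Phi> ` upper_square" using z(2) gX[OF t(2)] unfolding t(1) by blast
  define f where "f = (\<lambda>s. mu (g s))"
  have lip: "\<bar>f s - f r\<bar> \<le> \<bar>s - r\<bar>" if "s \<in> {0..D}" "r \<in> {0..D}" for s r
    using mu_nonexpansive[OF gX gX, OF that] g(3)[OF that] unfolding f_def by simp
  have ft: "0 < f t" using mu_pos[OF gt] unfolding f_def .
  have f0: "f 0 \<le> 0" "f D \<le> 0" using mu_S xy unfolding f_def g(1,2) by simp_all
  have inS: "g s \<in> S" if "s \<in> {0..D}" "f s \<le> 0" for s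
    using that gX in_S_iff_mu unfolding f_def by blast
  obtain t1 where t1: "0 \<le> t1" "t1 \<le> t" "\<forall>s\<in>{0..t1}. f s \<le> 0"
    "\<forall>\<epsilon>>0. \<exists>s\<in>{t1..t}. s < t1 + \<epsilon> \<and> 0 < f s"
    by (rule first_positive[OF lip f0(1) t(2) ft])
  \<comment> \<open>The last exit is the first entry of the reversed geodesic.\<close>
  obtain r where r: "0 \<le> r" "r \<le> D - t" "\<forall>s\<in>{0..r}. f (D - s) \<le> 0"
    "\<forall>\<epsilon>>0. \<exists>s\<in>{r..D - t}. s < r + \<epsilon> \<and> 0 < f (D - s)"
  proof (rule first_positive[of D "\<lambda>s. f (D - s)" "D - t"])
    show "\<bar>f (D - s) - f (D - u)\<bar> \<le> \<bar>s - u\<bar>" if "s \<in> {0..D}" "u \<in> {0..D}" for s u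
      using lip[of "D - s" "D - u"] that by auto
  qed (use f0 ft t(2) in auto)
  define t2 where "t2 = D - r"
  have t2: "t \<le> t2" "t2 \<le> D" using r unfolding t2_def by auto
  have limit: "\<exists>a. a \<in> square \<and> a \<notin> upper_square \<and> g s = \<Phi> a"
    if s: "s \<in> {0..D}" "g s \<in> S" and near: "\<And>\<epsilon>. 0 < \<epsilon> \<Longrightarrow> \<exists>u\<in>{0..D}. \<bar>s - u\<bar> < \<epsilon> \<and> 0 < f u" for s
  proof -
    obtain a where a: "a \<in> square" "g s = \<Phi> a"
    proof (rule Phi_square_closed[OF gX[OF s(1)]])
      fix \<epsilon> :: real assume "0 < \<epsilon>"
      then obtain u where u: "u \<in> {0..D}" "\<bar>s - u\<bar> < \<epsilon>" "0 < f u" using near by blast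
      then have "g u \<in> \<Phi> ` upper_square" using in_S_iff_mu[OF gX[OF u(1)]] gX[OF u(1)] unfolding f_def by auto
      then obtain a where a: "g u = \<Phi> a" "a \<in> upper_square" by (rule imageE)
      have "d (g s) (\<Phi> a) < \<epsilon>" using g(3)[OF s(1) u(1)] u(2) a(1) by simp
      then show "\<exists>a\<in>square. d (g s) (\<Phi> a) < \<epsilon>" using subsetD[OF upper_square_subset a(2)] by (rule bexI)
    qed
    have "a \<notin> upper_square" using s(2) a(2) by auto
    then show ?thesis using a by blast
  qed
  have "g t1 \<in> S" using inS bspec[OF t1(3), of t1] t1(1,2) t(2) by auto
  then have ex_a: "\<exists>a. a \<in> square \<and> a \<notin> upper_square \<and> g t1 = \<Phi> a"
  proof (rule limit[rotated])
    fix \<epsilon> :: real assume "0 < \<epsilon>"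
    then obtain s where "s \<in> {t1..t}" "s < t1 + \<epsilon>" "0 < f s" using t1(4) by blast
    then show "\<exists>u\<in>{0..D}. \<bar>t1 - u\<bar> < \<epsilon> \<and> 0 < f u" using t1(1) t(2) by (intro bexI[of _ s]) auto
  qed (use t1 t(2) in auto)
  have "g t2 \<in> S" using inS[of t2] bspec[OF r(3), of r] r(1) t2 t(2) unfolding t2_def by auto
  then have ex_b: "\<exists>b. b \<in> square \<and> b \<notin> upper_square \<and> g t2 = \<Phi> b"
  proof (rule limit[rotated])
    fix \<epsilon> :: real assume "0 < \<epsilon>"
    then obtain s where "s \<in> {r..D - t}" "s < r + \<epsilon>" "0 < f (D - s)" using r(4) by blast
    then show "\<exists>u\<in>{0..D}. \<bar>t2 - u\<bar> < \<epsilon> \<and> 0 < f u"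
      using r(1) t(2) unfolding t2_def by (intro bexI[of _ "D - s"]) auto
  qed (use t2 t(2) in auto)
  obtain a where a: "a \<in> square" "a \<notin> upper_square" "g t1 = \<Phi> a" using ex_a by (elim exE conjE) (rule that)
  obtain b where b: "b \<in> square" "b \<notin> upper_square" "g t2 = \<Phi> b" using ex_b by (elim exE conjE) (rule that)
  have pre: "g ` {0..t1} \<subseteq> S"
  proof (intro image_subsetI)
    fix s assume "s \<in> {0..t1}"
    then show "g s \<in> S" using inS[of s] bspec[OF t1(3), of s] t1(2) t(2) by auto
  qed
  have post: "g ` {t2..D} \<subseteq> S"
  proof (intro image_subsetI)
    fix s assume "s \<in> {t2..D}"
    then show "g s \<in> S" using inS[of s] bspec[OF r(3), of "D - s"] t2 t(2) unfolding t2_def by auto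
  qed
  have iso: "\<forall>s\<in>{0..D}. \<forall>t\<in>{0..D}. d (g s) (g t) = \<bar>s - t\<bar>" using g(3) by simp
  show ?thesis
    by (rule that[of g, folded D_def, OF g(1,2,4) iso t1(1,2) t2 a(1,2) b(1,2) a(3) b(3) gt pre post])
qed

text \<open>Here \<open>u\<close> is the nearer of the two points where the geodesic crosses the sides at the corner \<open>p\<close>,
  and \<open>w\<close> is the midpoint between these two points.\<close>

lemma geodesic_cuts_corner:
  assumes xy: "x \<in> S" "y \<in> S" and short: "d x y < 1" and cross: "\<not> I x y \<subseteq> S"
  obtains p u w where "p = \<Phi> (0,0) \<or> p = \<Phi> (1,0)" "u \<in> I x y" "w \<in> I x y" "d u p \<le> 2 * mu w"
    "d u p < d x y" "x \<noteq> p" "y \<noteq> p"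
proof -
  define D where "D = d x y"
  obtain g t1 t t2 a b where g': "g 0 = x" "g D = y" "g ` {0..D} = I x y"
    "\<forall>s\<in>{0..D}. \<forall>t\<in>{0..D}. d (g s) (g t) = \<bar>s - t\<bar>"
    and t: "0 \<le> t1" "t1 \<le> t" "t \<le> t2" "t2 \<le> D" and a: "a \<in> square" "a \<notin> upper_square"
    and b: "b \<in> square" "b \<notin> upper_square"
    and gab: "g t1 = \<Phi> a" "g t2 = \<Phi> b" and gt: "g t \<in> \<Phi> ` upper_square"
    by (rule geodesic_enters_square[OF xy cross, folded D_def])
  note g = g'(1-3) bspec[OF bspec[OF g'(4)]]
  have T: "t1 \<in> {0..D}" "t2 \<in> {0..D}" "t \<in> {0..D}" "0 \<in> {0..D}" "D \<in> {0..D}" using t by auto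
  define L where "L = t2 - t1"
  have dab: "dist a b = L" using g(4)[OF T(1,2)] dist_Phi[OF a(1) b(1)] t unfolding gab L_def by simp
  have gX: "g s \<in> X" if "s \<in> {0..D}" for s
    using imageI[OF that, of g] unfolding g(3) metric_interval_def by simp
  \<comment> \<open>Geodesics are unique and \<open>\<Phi>\<close> is isometric, so between
    \<open>t1\<close> and \<open>t2\<close> the geodesic is the image of the segment from
    \<open>a\<close> to \<open>b\<close>.\<close>
  have straight: "g (t1 + l * L) = \<Phi> ((1 - l) *\<^sub>R a + l *\<^sub>R b)" if l: "0 \<le> l" "l \<le> 1" for l
  proof -
    define s where "s = t1 + l * L"
    have L0: "0 \<le> L" using t unfolding L_def by simp
    have "l * L \<le> L" "0 \<le> l * L" using l L0 mult_right_mono[of l 1 L] by auto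
    then have s: "t1 \<le> s" "s \<le> t2" "s \<in> {0..D}" using t unfolding s_def L_def by auto
    define c where "c = (1 - l) *\<^sub>R a + l *\<^sub>R b"
    have csq: "c \<in> square" unfolding c_def by (rule square_convex_comb[OF a(1) b(1) l])
    have c1: "dist a c = l * L" unfolding c_def using dist_convex_comb[of 0 a b l] l dab by simp
    have c2: "dist c b = (1 - l) * L" unfolding c_def using dist_convex_comb[of l a b 1] l dab by (simp add: abs_minus_commute)
    have "g s = \<Phi> c"
    proof (rule between_unique[of "\<Phi> a" "\<Phi> b"])
      show "\<Phi> a \<in> X" "\<Phi> b \<in> X" using Phi_X a b by auto
      have ds: "d (\<Phi> a) (g s) = s - t1" "d (g s) (\<Phi> b) = t2 - s" "d (\<Phi> a) (\<Phi> b) = L"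
        using g(4)[OF T(1) s(3)] g(4)[OF s(3) T(2)] g(4)[OF T(1,2)] s t unfolding gab[symmetric] L_def by auto
      then show "g s \<in> I (\<Phi> a) (\<Phi> b)" using gX[OF s(3)] unfolding metric_interval_def L_def by simp
      have dc: "d (\<Phi> a) (\<Phi> c) = l * L" "d (\<Phi> c) (\<Phi> b) = (1 - l) * L"
        using dist_Phi a b csq c1 c2 by auto
      then show "\<Phi> c \<in> I (\<Phi> a) (\<Phi> b)" using Phi_X[OF csq] ds unfolding metric_interval_def by (simp add: algebra_simps)
      show "d (\<Phi> a) (g s) = d (\<Phi> a) (\<Phi> c)" using ds dc unfolding s_def by simp
    qed
    then show ?thesis unfolding s_def c_def .
  qed
  have "t1 < t" "t < t2"
  proof -
    have "g t \<noteq> \<Phi> a" "g t \<noteq> \<Phi> b" using gt Phi_S[OF a] Phi_S[OF b] by auto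
    then show "t1 < t" "t < t2" using t gab by (cases "t = t1"; cases "t = t2"; force)+
  qed
  then have L: "0 < L" unfolding L_def by simp
  define l where "l = (t - t1) / L"
  have l: "0 \<le> l" "l \<le> 1" "l * L = t - t1" using L t unfolding l_def by (auto simp: L_def)
  have lsq: "(1 - l) *\<^sub>R a + l *\<^sub>R b \<in> square" by (rule square_convex_comb[OF a(1) b(1) l(1,2)])
  have "\<Phi> ((1 - l) *\<^sub>R a + l *\<^sub>R b) \<in> \<Phi> ` upper_square" using straight[OF l(1,2)] gt l(3) by simp
  then have mid_up: "(1 - l) *\<^sub>R a + l *\<^sub>R b \<in> upper_square"
    using inj_on_image_mem_iff[OF inj lsq upper_square_subset] by simp
  have LD: "L \<le> D" unfolding L_def using t by simp
  then have "dist a b < 1" using dab short unfolding D_def by simp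
  from square_segment_cuts_corner[OF a b this l(1,2) mid_up]
  obtain p0 where p0: "p0 \<in> {(0,0),(1,0)}" "min (dist a p0) (dist b p0) \<le> 2 * depth ((1/2) *\<^sub>R a + (1/2) *\<^sub>R b)"
    "dist a p0 < L" "dist b p0 < L" unfolding dab by (elim bexE conjE) (rule that)
  have p0sq: "p0 \<in> square" using p0(1) by auto
  define p w where "p = \<Phi> p0" and "w = g (t1 + 1/2 * L)"
  define u where "u = (if dist a p0 \<le> dist b p0 then \<Phi> a else \<Phi> b)"
  have wmid: "w = \<Phi> ((1/2) *\<^sub>R a + (1/2) *\<^sub>R b)" unfolding w_def using straight[of "1/2"] by simp
  have msq: "(1/2) *\<^sub>R a + (1/2) *\<^sub>R b \<in> square" using square_convex_comb[OF a(1) b(1), of "1/2"] by simp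
  have "d u p = min (dist a p0) (dist b p0)"
    unfolding u_def p_def using dist_Phi a b p0sq by (auto simp: min_def)
  moreover have "mu w = depth ((1/2) *\<^sub>R a + (1/2) *\<^sub>R b)" unfolding wmid by (rule extend_Phi[OF msq])
  ultimately have up: "d u p \<le> 2 * mu w" "d u p < D" using p0 LD by auto
  have uI: "u \<in> I x y"
    unfolding u_def gab[symmetric] g(3)[symmetric] using imageI[OF T(1), of g] imageI[OF T(2), of g] by auto
  have half: "1/2 * L \<le> L" "0 \<le> 1/2 * L" using L by simp_all
  have "t1 + L \<le> D" using t unfolding L_def by simp
  then have "t1 + 1/2 * L \<in> {0..D}" using t(1) half unfolding atLeastAtMost_iff by simp
  then have wI: "w \<in> I x y" unfolding w_def g(3)[symmetric] by (rule imageI)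
  \<comment> \<open>Otherwise the exit point would be at distance \<open>t2 \<ge> L\<close> from the
    corner, whereas a leg of the cut-off triangle is shorter than its hypotenuse
    \<open>L\<close>.\<close>
  have "x \<noteq> p"
  proof
    assume "x = p"
    then have "dist p0 b = t2" using g(4)[OF T(4,2)] dist_Phi[OF p0sq b(1)] t unfolding g(1) gab p_def by simp
    then show False using p0(4) t unfolding L_def by (simp add: dist_commute)
  qed
  moreover have "y \<noteq> p"
  proof
    assume "y = p"
    then have "dist a p0 = D - t1" using g(4)[OF T(1,5)] dist_Phi[OF a(1) p0sq] t unfolding g(2) gab p_def by simp
    then show False using p0(3) t unfolding L_def by simp
  qed
  moreover have "p = \<Phi> (0,0) \<or> p = \<Phi> (1,0)" using p0(1) unfolding p_def by auto
  ultimately show ?thesis using that uI wI up unfolding D_def by blast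
qed

lemma corners_in_S: "\<Phi> (0,0) \<in> S" "\<Phi> (1,0) \<in> S"
  by (rule Phi_S; simp add: upper_square_def)+

abbreviation ledist where "ledist \<equiv> induced_edist X d S"

text \<open>Along a path of the collapsed complex, the geodesics from \<open>x\<close> switch from staying inside to
  cutting off \<open>q\<close>. At the switching time the cut-off piece is arbitrarily small.\<close>

lemma induced_edist_ge_detour:
  assumes xy: "x \<in> S" "y \<in> S" and q: "q \<in> X" and cross: "\<not> I x y \<subseteq> S"
    and corner: "\<And>m. \<lbrakk>m \<in> S; d x m < d x q + d q y; \<not> I x m \<subseteq> S\<rbrakk> \<Longrightarrow>
      \<exists>u\<in>I x m. \<exists>w\<in>I x m. d u q \<le> 2 * mu w"
  shows "ennreal (d x q + d q y) \<le> ledist x y"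
  unfolding induced_edist_def
proof (rule INF_greatest)
  fix g assume "g \<in> {g. pathin (subtopology mtopology S) g \<and> g 0 = x \<and> g 1 = y}"
  then have g: "pathin (subtopology mtopology S) g" "g 0 = x" "g 1 = y" by auto
  have gS: "g t \<in> S" "g t \<in> X" if "t \<in> {0..1}" for t
    using conjunct1[OF g(1)[unfolded pathin_mtopology_iff]] that by auto
  have cont: "\<exists>\<delta>>0. \<forall>s\<in>{0..1}. \<bar>s - t\<bar> < \<delta> \<longrightarrow> d (g t) (g s) < \<epsilon>" if "t \<in> {0..1}" "0 < \<epsilon>" for t \<epsilon>
    using conjunct2[OF g(1)[unfolded pathin_mtopology_iff], rule_format, OF that] .
  have X: "x \<in> X" "y \<in> X" using xy by auto
  show "ennreal (d x q + d q y) \<le> curve_length d g"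
  proof (rule ccontr)
    assume "\<not> ?thesis"
    then have lt: "curve_length d g < ennreal (d x q + d q y)" by simp
    then have "curve_length d g < top" by (rule less_trans) simp
    then obtain c where c: "0 \<le> c" "curve_length d g = ennreal c" by (cases "curve_length d g") auto
    have clt: "c < d x q + d q y" using lt ennreal_less_iff[OF c(1)] unfolding c(2) by blast
    have via: "d x (g t) + d (g t) y \<le> c" if "t \<in> {0..1}" for t
      using dist_via_le_curve_length[OF that, of g] unfolding c(2) g(2,3) ennreal_le_iff[OF c(1)] by simp
    have "d x q + d q y \<le> c"
    proof (rule field_le_epsilon)
      fix \<epsilon>' :: real assume "0 < \<epsilon>'"
      \<comment> \<open>The detour from \<open>u\<close> to \<open>q\<close> and back costs at most
        \<open>2 * \<epsilon>\<close> in each direction, hence the division by 4.\<close>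
      define \<epsilon> where "\<epsilon> = \<epsilon>' / 4"
      have e: "0 < \<epsilon>" using \<open>0 < \<epsilon>'\<close> unfolding \<epsilon>_def by simp
      \<comment> \<open>The times at which the geodesic from \<open>x\<close> stays inside. Close to
        the supremum of \<open>T\<close> there are a time \<open>t'\<close> in \<open>T\<close> and
        a time \<open>t''\<close> not in \<open>T\<close>, so their points \<open>m0\<close> and
        \<open>m\<close> are close to each other.\<close>
      define T where "T = {t\<in>{0..1}. I x (g t) \<subseteq> S}"
      have "I x x \<subseteq> S"
      proof
        fix z assume "z \<in> I x x"
        then have z: "z \<in> X" "d x z + d z x = 0" using X unfolding metric_interval_def by auto
        then have "d x z = 0" using nonneg[of x z] nonneg[of z x] by linarith
        then show "z \<in> S" using zero[OF X(1) z(1)] xy by blast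
      qed
      then have T: "0 \<in> T" "1 \<notin> T" "bdd_above T" using g cross unfolding T_def by auto
      define t0 where "t0 = Sup T"
      have t0: "t0 \<in> {0..1}"
        unfolding t0_def using T(1,3) by (auto simp: T_def intro!: cSup_upper2[of 0] cSup_least)
      obtain \<delta> where \<delta>: "\<delta> > 0" "\<forall>s\<in>{0..1}. \<bar>s - t0\<bar> < \<delta> \<longrightarrow> d (g t0) (g s) < \<epsilon>/2"
        using cont[OF t0, of "\<epsilon>/2"] e by auto
      obtain t' where t': "t' \<in> T" "t0 - \<delta> < t'"
        using less_cSupD[of T "t0 - \<delta>"] T \<delta>(1) unfolding t0_def by auto
      have "t' \<le> t0" unfolding t0_def using t'(1) T(3) by (rule cSup_upper)
      then have t'n: "t' \<in> {0..1}" "\<bar>t' - t0\<bar> < \<delta>" using t' unfolding T_def by auto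
      obtain t'' where t'': "t'' \<in> {0..1}" "t'' \<notin> T" "\<bar>t'' - t0\<bar> < \<delta>"
      proof (cases "t0 \<in> T")
        case True
        then have "t0 < 1" using T(2) t0 by (cases "t0 = 1") auto
        define s where "s = min 1 (t0 + \<delta>/2)"
        have s: "t0 < s" "s \<le> 1" "\<bar>s - t0\<bar> < \<delta>" using \<open>t0 < 1\<close> \<delta>(1) unfolding s_def by (auto simp: min_def)
        then have "s \<notin> T" using cSup_upper[OF _ T(3), of s] unfolding t0_def by auto
        then show ?thesis using that[of s] s t0 by auto
      next
        case False
        then show ?thesis using that[of t0] t0 \<delta>(1) by auto
      qed
      define m m0 where "m = g t''" and "m0 = g t'"
      have m: "m \<in> S" "m \<in> X" "m0 \<in> X" using gS t'' t'n unfolding m_def m0_def by auto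
      have "d (g t0) m < \<epsilon>/2" "d (g t0) m0 < \<epsilon>/2" using \<delta>(2) t'' t'n unfolding m_def m0_def by auto
      then have mm: "d m m0 \<le> \<epsilon>"
        using triangle[OF m(2) gS(2)[OF t0] m(3)] commute[of m "g t0"] by linarith
      have bad: "\<not> I x m \<subseteq> S" using t'' unfolding T_def m_def by auto
      have good: "I x m0 \<subseteq> S" using t'(1) unfolding T_def m0_def by auto
      \<comment> \<open>As the path is shorter than the way through \<open>q\<close>, so is the
        distance from \<open>x\<close> to \<open>m\<close>, and the hypothesis \<open>corner\<close>
        applies.\<close>
      have vm: "d x m + d m y \<le> c" using via[OF t''(1)] unfolding m_def .
      then have "d x m < d x q + d q y" using clt nonneg[of m y] by linarith
      then obtain u w where uw: "u \<in> I x m" "w \<in> I x m" "d u q \<le> 2 * mu w" using corner[OF m(1) _ bad] by blast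
      obtain w' where w': "w' \<in> I x m0" "d w w' \<le> d m m0" using near_interval_point[OF X(1) m(2,3) uw(2)] by blast
      have wX: "w \<in> X" "w' \<in> X" using uw(2) w'(1) unfolding metric_interval_def by auto
      \<comment> \<open>The point \<open>w\<close> of the bad geodesic is close to a point of the
        good one, where \<open>mu\<close> vanishes. So \<open>mu w\<close> is small, and the
        geodesic to \<open>m\<close> nearly passes through \<open>q\<close>.\<close>
      have "mu w' = 0" using mu_S good w'(1) by blast
      then have "mu w \<le> \<epsilon>" using mu_nonexpansive[OF wX] w'(2) mm by linarith
      then have uq: "d u q \<le> 2 * \<epsilon>" using uw(3) by linarith
      have u: "u \<in> X" "d x u + d u m = d x m" using uw(1) unfolding metric_interval_def by auto
      have "d x q \<le> d x u + d u q" "d q m \<le> d u q + d u m" "d q y \<le> d q m + d m y"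
        using triangle[OF X(1) u(1) q] triangle[OF q u(1) m(2)] triangle[OF q m(2) X(2)] commute[of q u] by auto
      then have "d x q + d q y \<le> c + 4 * \<epsilon>" using uq u(2) vm by linarith
      then show "d x q + d q y \<le> c + \<epsilon>'" unfolding \<epsilon>_def by simp
    qed
    then show False using clt by simp
  qed
qed

text \<open>A short geodesic that leaves \<open>S\<close> cuts off a corner near its ends. If
  \<open>r\<close> is small compared with the distances from \<open>q\<close> to the other corners,
  this corner is \<open>q\<close>. A geodesic ending at \<open>q\<close> then stays in
  \<open>S\<close>, since the corner cut off is never one of the ends.\<close>

lemma local_structure:
  assumes q: "q \<in> S"
  obtains r where "0 < r" "\<And>x. \<lbrakk>x \<in> S; d q x < r\<rbrakk> \<Longrightarrow> I x q \<subseteq> S"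
    "\<And>x y. \<lbrakk>x \<in> S; y \<in> S; d q x < r; d q y < r; \<not> I x y \<subseteq> S\<rbrakk> \<Longrightarrow>
      ennreal (d x q + d q y) \<le> ledist x y"
proof -
  \<comment> \<open>A corner \<open>p\<close> that is cut off satisfies
    \<open>d q p < r + 4 * r + 4 * r\<close>, by way of \<open>x\<close> and \<open>u\<close>, so
    the factor 10 puts corners other than \<open>q\<close> out of reach. The value 1 for
    \<open>p = q\<close> is a default, and the bound \<open>1/8\<close> below makes
    \<open>4 * r\<close> less than 1.\<close>
  define \<rho> where "\<rho> p = (if p = q then 1 else d q p / 10)" for p
  define r where "r = min (1/8) (min (\<rho> (\<Phi> (0,0))) (\<rho> (\<Phi> (1,0))))"
  have qX: "q \<in> X" using q by blast
  have "0 < \<rho> p" if "p \<in> S" for p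
  proof (cases "p = q")
    case False
    then have "d q p \<noteq> 0" using zero[OF qX, of p] that by blast
    then have "0 < d q p" using nonneg[of q p] by linarith
    then show ?thesis unfolding \<rho>_def by simp
  qed (simp add: \<rho>_def)
  then have r: "0 < r" "r \<le> 1/8" using corners_in_S unfolding r_def by (simp_all add: min_def)
  have far: "p = q" if "p = \<Phi> (0,0) \<or> p = \<Phi> (1,0)" "d q p < 10 * r" for p
  proof (rule ccontr)
    assume "p \<noteq> q"
    then have "\<rho> p = d q p / 10" unfolding \<rho>_def by simp
    moreover have "r \<le> \<rho> p" using that(1) unfolding r_def by auto
    ultimately show False using that(2) by simp
  qed
  have key: "x \<noteq> q \<and> m \<noteq> q \<and> (\<exists>u\<in>I x m. \<exists>w\<in>I x m. d u q \<le> 2 * mu w)"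
    if x: "x \<in> S" "d q x < r" and m: "m \<in> S" "d x m < 4 * r" and bad: "\<not> I x m \<subseteq> S" for x m
  proof -
    have lt1: "d x m < 1" using m(2) r by simp
    obtain p u w where p: "p = \<Phi> (0,0) \<or> p = \<Phi> (1,0)" "u \<in> I x m" "w \<in> I x m" "d u p \<le> 2 * mu w"
      "d u p < d x m" "x \<noteq> p" "m \<noteq> p"
      by (rule geodesic_cuts_corner[OF x(1) m(1) lt1 bad])
    have X: "x \<in> X" "u \<in> X" "p \<in> X" using x(1) p(1,2) corners_in_S unfolding metric_interval_def by auto
    have "d x u + d u m = d x m" using p(2) unfolding metric_interval_def by simp
    then have "d x u \<le> d x m" using nonneg[of u m] by linarith
    then have "d q p < 10 * r"
      using triangle[OF qX X(1,3)] triangle[OF X] p(5) m(2) x(2) r(1) by linarith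
    then have "p = q" using far p(1) by blast
    then show ?thesis using p by blast
  qed
  show ?thesis
  proof (rule that[OF r(1)])
    show "I x q \<subseteq> S" if "x \<in> S" "d q x < r" for x
    proof (rule ccontr)
      assume bad: "\<not> I x q \<subseteq> S"
      have "d x q < 4 * r" using that(2) r(1) commute[of x q] by linarith
      then show False using key[OF that q _ bad] by blast
    qed
    show "ennreal (d x q + d q y) \<le> ledist x y"
      if xy: "x \<in> S" "y \<in> S" "d q x < r" "d q y < r" "\<not> I x y \<subseteq> S" for x y
    proof (rule induced_edist_ge_detour[OF xy(1,2) qX xy(5)])
      fix m assume m: "m \<in> S" "d x m < d x q + d q y" "\<not> I x m \<subseteq> S"
      then have "d x m < 4 * r" using xy(3,4) commute[of x q] r(1) by linarith
      then show "\<exists>u\<in>I x m. \<exists>w\<in>I x m. d u q \<le> 2 * mu w" using key[OF xy(1,3) m(1) _ m(3)] by blast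
    qed
  qed
qed

section \<open>Finiteness of the induced distance\<close>

lemma induced_edist_inside:
  assumes "x \<in> S" "y \<in> S" "I x y \<subseteq> S"
  shows "ledist x y \<le> ennreal (d x y)"
proof -
  obtain g where g: "g 0 = x" "g (d x y) = y" "\<And>s t. \<lbrakk>s \<in> {0..d x y}; t \<in> {0..d x y}\<rbrakk> \<Longrightarrow> d (g s) (g t) = \<bar>s - t\<bar>"
    "g ` {0..d x y} = I x y" using geodesic_exists[of x y] assms by (metis DiffD1)
  have "ledist (g 0) (g (d x y)) \<le> ennreal (d x y - 0)"
    by (rule induced_edist_geodesic[OF g(3)]) (use g(4) assms in auto)
  then show ?thesis using g by simp
qed

lemma induced_edist_side:
  assumes "a \<in> square" "b \<in> square" "\<And>l. \<lbrakk>0 \<le> l; l \<le> 1\<rbrakk> \<Longrightarrow> (1 - l) *\<^sub>R a + l *\<^sub>R b \<notin> upper_square"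
  shows "ledist (\<Phi> a) (\<Phi> b) < top"
proof -
  define g where "g = (\<lambda>t. \<Phi> ((1 - t) *\<^sub>R a + t *\<^sub>R b))"
  have sq: "(1 - t) *\<^sub>R a + t *\<^sub>R b \<in> square" if "t \<in> {0..1}" for t
    using square_convex_comb assms that by simp
  have "ledist (g 0) (g 1) \<le> ennreal (dist a b)"
  proof (rule induced_edist_Lipschitz)
    show "d (g s) (g t) \<le> dist a b * \<bar>s - t\<bar>" if "s \<in> {0..1}" "t \<in> {0..1}" for s t
      unfolding g_def dist_Phi[OF sq sq, OF that] dist_convex_comb by simp
    show "g ` {0..1} \<subseteq> X \<inter> S"
    proof (rule image_subsetI)
      fix t :: real assume "t \<in> {0..1}"
      then show "g t \<in> X \<inter> S" unfolding g_def using Phi_S[OF sq assms(3)] by auto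
    qed
  qed simp
  then show ?thesis unfolding g_def by (simp add: le_less_trans)
qed

text \<open>The left, bottom and right sides form a rectifiable path that the collapse leaves in
  place.\<close>

lemma induced_edist_three_sides:
  assumes a: "a \<in> square" "a \<notin> upper_square" and b: "b \<in> square" "b \<notin> upper_square"
  shows "ledist (\<Phi> a) (\<Phi> b) < top"
proof -
  have trans: "ledist u w < top" if "ledist u v < top" "ledist v w < top" for u v w
    using induced_edist_triangle[of S u w v] that by (meson ennreal_add_less_top le_less_trans)
  have origin: "ledist (\<Phi> a) (\<Phi> (0,0)) < top" if asq: "a \<in> square" "a \<notin> upper_square" for a
  proof -
    have bottom: "ledist (\<Phi> a) (\<Phi> (0,0)) < top" if "a \<in> square" "snd a = 0" for a
      by (rule induced_edist_side) (use that in \<open>auto simp: upper_square_def\<close>)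
    consider "fst a = 0" | "fst a = 1" | "snd a = 0"
      using asq unfolding upper_square_def by (auto simp: mem_Times_iff)
    then show ?thesis
    proof cases
      case 1
      then show ?thesis using asq by (intro induced_edist_side) (auto simp: upper_square_def)
    next
      case 2
      have "ledist (\<Phi> a) (\<Phi> (1,0)) < top"
        by (rule induced_edist_side) (use asq 2 in \<open>auto simp: upper_square_def mem_Times_iff\<close>)
      then show ?thesis using trans bottom[of "(1,0)"] by auto
    next
      case 3
      then show ?thesis using bottom asq by blast
    qed
  qed
  show ?thesis
    using trans[OF origin[OF a]] origin[OF b] induced_edist_commute[of S "\<Phi> b"] by simp
qed

text \<open>Follow the geodesic of \<open>X\<close> up to its first entry into the removed part, go
  around along the three remaining sides, and continue from the last exit.\<close>

lemma induced_edist_finite: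
  assumes xy: "x \<in> S" "y \<in> S"
  shows "ledist x y < top"
proof (cases "I x y \<subseteq> S")
  case True
  then show ?thesis using induced_edist_inside[OF xy] by (simp add: le_less_trans)
next
  case False
  obtain g t1 t t2 a b where g: "g 0 = x" "g (d x y) = y"
    "\<forall>s\<in>{0..d x y}. \<forall>t\<in>{0..d x y}. d (g s) (g t) = \<bar>s - t\<bar>"
    and t: "0 \<le> t1" "t1 \<le> t" "t \<le> t2" "t2 \<le> d x y" and a: "a \<in> square" "a \<notin> upper_square"
    and b: "b \<in> square" "b \<notin> upper_square" and gab: "g t1 = \<Phi> a" "g t2 = \<Phi> b"
    and gS: "g ` {0..t1} \<subseteq> S" "g ` {t2..d x y} \<subseteq> S"
    by (rule geodesic_enters_square[OF xy False])
  have 1: "ledist x (\<Phi> a) \<le> ennreal (t1 - 0)"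
    unfolding g(1)[symmetric] gab(1)[symmetric]
    by (rule induced_edist_geodesic) (use g(3) t gS in auto)
  have 2: "ledist (\<Phi> b) y \<le> ennreal (d x y - t2)"
    by (subst g(2)[symmetric], subst gab(2)[symmetric], rule induced_edist_geodesic) (use g(3) t gS in auto)
  have "ledist x y \<le> ledist x (\<Phi> a) + (ledist (\<Phi> a) (\<Phi> b) + ledist (\<Phi> b) y)"
    by (rule order_trans[OF induced_edist_triangle[of S x y "\<Phi> a"] add_left_mono[OF induced_edist_triangle]])
  also have "\<dots> < top"
    using le_less_trans[OF 1 ennreal_less_top] le_less_trans[OF 2 ennreal_less_top] induced_edist_three_sides[OF a b]
    by (simp add: ennreal_add_less_top)
  finally show ?thesis .
qed

theorem nonpositively_curved_collapse: "nonpositively_curved S (induced_length_dist X d S)"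
proof -
  define d' where "d' = induced_length_dist X d S"
  interpret C: Metric_space S d'
    unfolding d'_def by (rule Metric_space_induced_length_dist[OF Metric_space_axioms _ induced_edist_finite]) auto
  have d': "ennreal (d' x y) = ledist x y" if "x \<in> S" "y \<in> S" for x y
    unfolding d'_def induced_length_dist_eq using induced_edist_finite[OF that] by (simp add: less_top)
  have le: "d x y \<le> d' x y" if "x \<in> S" "y \<in> S" for x y
    using dist_le_induced_edist[of x y S] unfolding d'[OF that, symmetric] by (simp add: ennreal_le_iff)
  have inside: "d' x y = d x y" if "x \<in> S" "y \<in> S" "I x y \<subseteq> S" for x y
    using induced_edist_inside[OF that] le[OF that(1,2)] unfolding d'[OF that(1,2), symmetric]
    by (simp add: ennreal_le_iff)
  have "\<exists>r>0. CAT0 (C.mball q r) d'" if q: "q \<in> S" for q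
  proof -
    obtain r where r: "0 < r" and star: "\<And>x. \<lbrakk>x \<in> S; d q x < r\<rbrakk> \<Longrightarrow> I x q \<subseteq> S"
      and detour: "\<And>x y. \<lbrakk>x \<in> S; y \<in> S; d q x < r; d q y < r; \<not> I x y \<subseteq> S\<rbrakk> \<Longrightarrow>
        ennreal (d x q + d q y) \<le> ledist x y"
      using local_structure[OF q] by blast
    define B where "B = C.mball q r"
    have qX: "q \<in> X" using q by blast
    have star': "d' x q = d x q" "d' q x = d q x" if "x \<in> S" "d q x < r" for x
      using inside[OF that(1) q star[OF that]] by (auto simp: commute C.commute)
    \<comment> \<open>The balls of \<open>d\<close> and \<open>d'\<close> around \<open>q\<close>
      have the same points of \<open>S\<close>, because radii stay in \<open>S\<close> and
      \<open>d\<close> is at most \<open>d'\<close>.\<close>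
    have B: "x \<in> B \<longleftrightarrow> x \<in> S \<and> d q x < r" for x
      unfolding B_def using q le[OF q, of x] star'(2)[of x] by auto
    \<comment> \<open>Balls of \<open>d\<close> are convex because the distance to \<open>q\<close>
      is convex along geodesics. Hence a geodesic between points of \<open>B\<close> leaves
      \<open>B\<close> only by leaving \<open>S\<close>.\<close>
    have ball_convex: "d q z < r" if xyz: "x \<in> X" "y \<in> X" "d q x < r" "d q y < r" "z \<in> I x y" for x y z
    proof -
      obtain g where g: "g 0 = x" "g (d x y) = y" "\<And>s t. \<lbrakk>s \<in> {0..d x y}; t \<in> {0..d x y}\<rbrakk> \<Longrightarrow> d (g s) (g t) = \<bar>s - t\<bar>"
        "g ` {0..d x y} = I x y" using geodesic_exists[OF xyz(1,2)] by metis
      have gX: "g ` {0..d x y} \<subseteq> X" unfolding g(4) metric_interval_def by auto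
      define e where "e = max (d q x) (d q y)"
      have "z \<in> g ` {0..d x y}" using xyz(5) g(4) by simp
      then obtain t where t: "z = g t" "t \<in> {0..d x y}" by (rule imageE)
      have "d q (g t) + (0 * t + - e) \<le> 0"
        by (rule convex_on_interval_nonpos[OF convex_on_add_affine[OF convex_on_dist[OF qX gX g(3)]], of "0" "d x y"])
          (use t g(1,2) in \<open>auto simp: e_def\<close>)
      then show ?thesis using xyz(3,4) t(1) unfolding e_def by auto
    qed
    have I_B: "I x y \<subseteq> B \<longleftrightarrow> I x y \<subseteq> S" if "x \<in> B" "y \<in> B" for x y
      using ball_convex[of x y] that unfolding B subset_iff by auto
    interpret detour_space X d B d' q
    proof (intro detour_space.intro detour_space_axioms.intro)
      show "stewart_space X d" by unfold_locales
      show "Metric_space B d'" unfolding B_def by (rule C.subspace) auto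
      show "B \<subseteq> X" using B by auto
      show "q \<in> B" using B q r by auto
      show "d x y \<le> d' x y" if "x \<in> B" "y \<in> B" for x y using le that B by auto
      show "d' x y = d x y" if "x \<in> B" "y \<in> B" "I x y \<subseteq> B" for x y using inside I_B that B by auto
      show "I x q \<subseteq> B" if "x \<in> B" for x using I_B[OF that \<open>q \<in> B\<close>] star that B by auto
      show "d' x y = d x q + d q y" if xy: "x \<in> B" "y \<in> B" "\<not> I x y \<subseteq> B" for x y
      proof (rule antisym)
        have S: "x \<in> S" "y \<in> S" "d q x < r" "d q y < r" using xy B by auto
        show "d' x y \<le> d x q + d q y"
          using C.triangle[OF S(1) q S(2)] star'(1)[OF S(1,3)] star'(2)[OF S(2,4)] by simp
        have "ennreal (d x q + d q y) \<le> ennreal (d' x y)"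
          unfolding d'[OF S(1,2)] using detour[OF S] I_B xy by blast
        then show "d x q + d q y \<le> d' x y" unfolding ennreal_le_iff[OF C.nonneg] .
      qed
    qed
    have "CAT0 B d'" by (rule stewart_space.CAT0[OF stewart_space_detour])
    then show ?thesis using r unfolding B_def by blast
  qed
  then show ?thesis unfolding nonpositively_curved_def d'_def[symmetric] using C.Metric_space_axioms by blast
qed

end

theorem proposition3p11:
  fixes K :: "('i, 'a) cube_gluing" and e \<sigma> :: "'a set"
  assumes "square_complex K"
    and "finite (cells K)"
    and "CAT0 (realization K) (complex_dist K)"
    and "is_cell K 2 \<sigma>"
    and "is_cell K 1 e"
    and "free_face K e \<sigma>"
  shows "nonpositively_curved (collapse K e \<sigma>)
           (induced_length_dist (realization K) (complex_dist K) (collapse K e \<sigma>))"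
proof -
  obtain \<Phi> where \<Phi>: "square_chart K \<Phi>" and eq: "collapse K e \<sigma> = realization K - \<Phi> ` upper_square"
    by (rule free_face_square_chart[OF assms(1,4,5,6)])
  interpret collapsible_square K \<Phi>
    by (intro collapsible_square.intro collapsible_square_axioms.intro \<Phi> assms(3))
  show ?thesis unfolding eq by (rule nonpositively_curved_collapse)
qed

end
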